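(* Let $(E,\langle~,~\rangle,[~,~]_E,\rho)$ and $(E,\langle~,~\rangle,[~,~]'_E,\rho')$ be two compatible Courant algebroids over a smooth manifold $M$, with corresponding $L_\infty$-algebras $(L(E),l_1,l_2,l_3)$ and $(L(E),l'_1,l'_2,l'_3)$ on the graded vector space $L(E)=C^\infty(M)\oplus\Gamma E$. Then $(L(E),\{l_1,l_2,l_3\},\{l'_1,l'_2,l'_3\})$ is a compatible $L_\infty$-algebra.
   Context: A Courant algebroid $(E,\langle~,~\rangle,[~,~]_E,\rho)$ over $M$ consists of a smooth vector bundle $E\to M$, a symmetric nondegenerate $C^\infty(M)$-valued pairing $\langle~,~\rangle:\Gamma E\times\Gamma E\to C^\infty(M)$ (a fibrewise bundle pairing), a bilinear bracket $[~,~]_E:\Gamma E\times\Gamma E\to\Gamma E$ and a bundle map $\rho:E\to TM$ such that for $X,Y,Z\in\Gamma E$, $f\in C^\infty(M)$: $[X,[Y,Z]_E]_E=[[X,Y]_E,Z]_E+[Y,[X,Z]_E]_E$; $[X,fY]_E=f[X,Y]_E+\rho(X)(f)Y$; $\rho[X,Y]_E=[\rho(X),\rho(Y)]$; $[X,X]_E=\frac12\mathcal{D}\langle X,X\rangle$; $\rho(X)\langle Y,Z\rangle=\langle[X,Y]_E,Z\rangle+\langle Y,[X,Z]_E\rangle$. Here $\mathcal{D}:C^\infty(M)\to\Gamma E$ is the composite $C^\infty(M)\xrightarrow{d}\Omega^1(M)\xrightarrow{\rho^*}\Gamma E^*\simeq\Gamma E$, the isomorphism being induced by $\langle~,~\rangle$;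 thus $\langle\mathcal{D}f,X\rangle=\rho(X)(f)$. The corresponding $L_\infty$-algebra (Roytenberg-Weinstein) is on $L(E)=C^\infty(M)\oplus\Gamma E$ with $C^\infty(M)$ in degree $-1$ and $\Gamma E$ in degree $0$: $l_1=\mathcal{D}$; $l_2(X,Y)=\lfloor X,Y\rfloor_E:=[X,Y]_E-\frac12\mathcal{D}\langle X,Y\rangle$; $l_2(X,f)=-l_2(f,X)=\frac12\langle X,\mathcal{D}f\rangle$; $l_3(X,Y,Z)=-\frac16\langle\lfloor X,Y\rfloor_E,Z\rangle+\text{cyclic permutations of }X,Y,Z$ (i.e. $-\frac16$ times the cyclic sum); all other components and all higher maps vanish. Two Courant algebroids $(E,\langle~,~\rangle,[~,~]_E,\rho)$ and $(E,\langle~,~\rangle,[~,~]'_E,\rho')$ on the same bundle with the same pairing are compatible if for all $X,Y,Z\in\Gamma E$: $[X,[Y,Z]_E]'_E+[X,[Y,Z]'_E]_E=[[X,Y]_E,Z]'_E+[[X,Y]'_E,Z]_E+[Y,[X,Z]_E]'_E+[Y,[X,Z]'_E]_E$ and $\rho([X,Y]'_E)+\rho'([X,Y]_E)=[\rho(X),\rho'(Y)]+[\rho'(X),\rho(Y)]$. For $\sigma\in S_n$, $\chi(\sigma)=(-1)^\sigma\epsilon(\sigma)$ with $\epsilon(\sigma)$ the Koszul sign; $Sh(i,n-i)$ is the set of $(i,n-i)$-shuffles ($\sigma(1)<\cdots<\sigma(i)$, $\sigma(i+1)<\cdots<\sigma(n)$). An $L_\infty$-algebra is a graded vector space with graded skew-symmetric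 multilinear maps $l_k$ of degree $2-k$, $k\ge1$, such that for all $n\ge1$, $\sum_{i+j=n+1}\sum_{\sigma\in Sh(i,n-i)}\chi(\sigma)(-1)^{i(j-1)}l_j(l_i(x_{\sigma(1)},\dots,x_{\sigma(i)}),x_{\sigma(i+1)},\dots,x_{\sigma(n)})=0$. A compatible $L_\infty$-algebra is given by two $L_\infty$-structures $\{l_k\},\{l'_k\}$ on the same graded vector space such that for all $n\ge1$, $\sum_{i+j=n+1}\sum_{\sigma\in Sh(i,n-i)}\chi(\sigma)(-1)^{i(j-1)}\{l_j(l'_i(x_{\sigma(1)},\dots,x_{\sigma(i)}),x_{\sigma(i+1)},\dots,x_{\sigma(n)})+l'_j(l_i(x_{\sigma(1)},\dots,x_{\sigma(i)}),x_{\sigma(i+1)},\dots,x_{\sigma(n)})\}=0$. *)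

theory Defs
  imports
    "HOL-Analysis.Analysis"
    "HOL-Library.Function_Algebras"
    "HOL-Combinatorics.Permutations"
begin

section \<open>Vector spaces of functions\<close>

text \<open>Together with \<^theory>\<open>HOL-Library.Function_Algebras\<close> this makes functions and sections
  real vector spaces under the pointwise operations.\<close>

instantiation "fun" :: (type, real_vector) real_vector
begin

definition scaleR_fun :: "real \<Rightarrow> ('a \<Rightarrow> 'b) \<Rightarrow> 'a \<Rightarrow> 'b"
  where "scaleR_fun c f = (\<lambda>x. c *\<^sub>R f x)"

instance
  by standard (auto simp: scaleR_fun_def plus_fun_def fun_eq_iff scaleR_add_right scaleR_add_left)

end


section \<open>Smooth manifolds\<close>

text \<open>For open \<open>S\<close> in a finite-dimensional space, \<open>Ck_on k S f\<close> says that \<open>f\<close> is of class \<open>C\<^sup>k\<close>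
  on \<open>S\<close>: all iterated directional derivatives up to order \<open>k\<close> exist and are continuous.\<close>

primrec Ck_on ::
  "nat \<Rightarrow> 'b::real_normed_vector set \<Rightarrow> ('b \<Rightarrow> 'c::real_normed_vector) \<Rightarrow> bool"
where
  "Ck_on 0 S f \<longleftrightarrow> continuous_on S f"
| "Ck_on (Suc k) S f \<longleftrightarrow>
     (\<forall>x\<in>S. f differentiable (at x)) \<and>
     (\<forall>v. Ck_on k S (\<lambda>x. frechet_derivative f (at x) v))"

definition smooth_on :: "'b::real_normed_vector set \<Rightarrow> ('b \<Rightarrow> 'c::real_normed_vector) \<Rightarrow> bool"
  where "smooth_on S f \<longleftrightarrow> (\<forall>k. Ck_on k S f)"

text \<open>The model space of a manifold (and the model fibre of a bundle) is a finite-dimensional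
  Euclidean vector space. The class \<^class>\<open>euclidean_space\<close> is not used because its types have
  positive dimension, which would exclude manifolds of dimension 0 and bundles of rank 0.\<close>

definition finite_dimensional :: "'b::real_vector itself \<Rightarrow> bool"
  where "finite_dimensional _ \<longleftrightarrow> (\<exists>B::'b set. finite B \<and> span B = UNIV)"

text \<open>The manifold is the whole type \<open>'m\<close>, and \<open>A\<close> is a smooth atlas. Chart maps are total
  functions of which only the restriction to the chart domain matters.\<close>

locale smooth_manifold =
  fixes A :: "('m::{t2_space,second_countable_topology} set \<times> ('m \<Rightarrow> 'b::real_inner)) set"
  assumes finite_dim_model: "finite_dimensional TYPE('b)"
    and chart_open: "(U, \<phi>) \<in> A \<Longrightarrow> open U"
    and chart_open_image: "(U, \<phi>) \<in> A \<Longrightarrow> open (\<phi> ` U)"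
    and chart_homeomorphism: "(U, \<phi>) \<in> A \<Longrightarrow> homeomorphism U (\<phi> ` U) \<phi> (inv_into U \<phi>)"
    and charts_cover: "\<Union> (fst ` A) = UNIV"
    and chart_transition_smooth:
      "(U, \<phi>) \<in> A \<Longrightarrow> (V, \<psi>) \<in> A \<Longrightarrow> smooth_on (\<phi> ` (U \<inter> V)) (\<psi> \<circ> inv_into U \<phi>)"

definition smooth_map_on ::
  "('m set \<times> ('m \<Rightarrow> 'b::real_normed_vector)) set \<Rightarrow> 'm set
    \<Rightarrow> ('m \<Rightarrow> 'c::real_normed_vector) \<Rightarrow> bool"
  where "smooth_map_on A W f \<longleftrightarrow>
    (\<forall>(U, \<phi>)\<in>A. smooth_on (\<phi> ` (U \<inter> W)) (f \<circ> inv_into U \<phi>))"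

definition C_inf :: "('m set \<times> ('m \<Rightarrow> 'b::real_normed_vector)) set \<Rightarrow> ('m \<Rightarrow> real) set"
  where "C_inf A = {f. smooth_map_on A UNIV f}"

text \<open>Tangent vectors at \<open>p\<close> are the derivations at \<open>p\<close> of the algebra of smooth functions. As
  derivations are total functions here, they are normalised to vanish on non-smooth functions.\<close>

definition tangent_space ::
  "('m set \<times> ('m \<Rightarrow> 'b::real_normed_vector)) set \<Rightarrow> 'm \<Rightarrow> (('m \<Rightarrow> real) \<Rightarrow> real) set"
  where "tangent_space A p = {v.
    (\<forall>f\<in>C_inf A. \<forall>h\<in>C_inf A. v (f + h) = v f + v h) \<and>
    (\<forall>c. \<forall>f\<in>C_inf A. v (c *\<^sub>R f) = c * v f) \<and>
    (\<forall>f\<in>C_inf A. \<forall>h\<in>C_inf A. v (f * h) = f p * v h + v f * h p) \<and>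
    (\<forall>f. f \<notin> C_inf A \<longrightarrow> v f = 0)}"

text \<open>Smooth vector fields on an open set \<open>W\<close>. Testing against globally defined smooth functions
  is enough, since coordinate functions can be extended from a neighbourhood of any point.\<close>

definition smooth_vector_field_on ::
  "('m set \<times> ('m \<Rightarrow> 'b::real_normed_vector)) set \<Rightarrow> 'm set
    \<Rightarrow> ('m \<Rightarrow> ('m \<Rightarrow> real) \<Rightarrow> real) \<Rightarrow> bool"
  where "smooth_vector_field_on A W V \<longleftrightarrow>
    (\<forall>p\<in>W. V p \<in> tangent_space A p) \<and>
    (\<forall>f\<in>C_inf A. smooth_map_on A W (\<lambda>p. V p f))"

definition lie_bracket ::
  "('m \<Rightarrow> ('m \<Rightarrow> real) \<Rightarrow> real) \<Rightarrow> ('m \<Rightarrow> ('m \<Rightarrow> real) \<Rightarrow> real) \<Rightarrow> 'm \<Rightarrow> ('m \<Rightarrow> real) \<Rightarrow> real"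
  where "lie_bracket V W = (\<lambda>p f. V p (\<lambda>q. W q f) - W p (\<lambda>q. V q f))"


section \<open>Smooth vector bundles\<close>

text \<open>A vector bundle is given by its fibres \<open>E p\<close> and a family \<open>T\<close> of local trivialisations
  with smooth transition functions. The fibres are linear subspaces of a real vector space
  \<open>'e\<close>, which is no restriction (embed all fibres in their direct sum); \<open>'e\<close> carries no topology,
  and fibres over distinct points are unrelated. An element \<open>(U, F)\<close> of \<open>T\<close> is the inverse of a
  local trivialisation over \<open>U\<close>: \<open>F p\<close> is a linear isomorphism from the model fibre
  \<open>'v\<close> onto \<open>E p\<close> for \<open>p \<in> U\<close>.\<close>

locale smooth_vector_bundle = smooth_manifold A
  for A :: "('m::{t2_space,second_countable_topology} set \<times> ('m \<Rightarrow> 'b::real_inner)) set" +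
  fixes E :: "'m \<Rightarrow> 'e::real_vector set"
    and T :: "('m set \<times> ('m \<Rightarrow> 'v::real_inner \<Rightarrow> 'e)) set"
  assumes finite_dim_fibre: "finite_dimensional TYPE('v)"
    and triv_open: "(U, F) \<in> T \<Longrightarrow> open U"
    and triv_linear: "(U, F) \<in> T \<Longrightarrow> p \<in> U \<Longrightarrow> linear (F p)"
    and triv_inj: "(U, F) \<in> T \<Longrightarrow> p \<in> U \<Longrightarrow> inj (F p)"
    and triv_range: "(U, F) \<in> T \<Longrightarrow> p \<in> U \<Longrightarrow> range (F p) = E p"
    and triv_cover: "\<Union> (fst ` T) = UNIV"
    and triv_transition_smooth:
      "(U, F) \<in> T \<Longrightarrow> (V, G) \<in> T \<Longrightarrow> smooth_map_on A (U \<inter> V) (\<lambda>p. inv (G p) (F p v))"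

definition smooth_section_on ::
  "('m set \<times> ('m \<Rightarrow> 'b::real_normed_vector)) set \<Rightarrow> ('m \<Rightarrow> 'e set)
    \<Rightarrow> ('m set \<times> ('m \<Rightarrow> 'v::real_normed_vector \<Rightarrow> 'e)) set \<Rightarrow> 'm set \<Rightarrow> ('m \<Rightarrow> 'e) \<Rightarrow> bool"
  where "smooth_section_on A E T W X \<longleftrightarrow>
    (\<forall>p\<in>W. X p \<in> E p) \<and>
    (\<forall>(U, F)\<in>T. smooth_map_on A (U \<inter> W) (\<lambda>p. inv (F p) (X p)))"

definition sections ::
  "('m set \<times> ('m \<Rightarrow> 'b::real_normed_vector)) set \<Rightarrow> ('m \<Rightarrow> 'e set)
    \<Rightarrow> ('m set \<times> ('m \<Rightarrow> 'v::real_normed_vector \<Rightarrow> 'e)) set \<Rightarrow> ('m \<Rightarrow> 'e) set"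
  where "sections A E T = {X. smooth_section_on A E T UNIV X}"

definition fscale :: "('m \<Rightarrow> real) \<Rightarrow> ('m \<Rightarrow> 'e::real_vector) \<Rightarrow> 'm \<Rightarrow> 'e"
  where "fscale f X = (\<lambda>p. f p *\<^sub>R X p)"

definition pair :: "('m \<Rightarrow> 'e \<Rightarrow> 'e \<Rightarrow> real) \<Rightarrow> ('m \<Rightarrow> 'e) \<Rightarrow> ('m \<Rightarrow> 'e) \<Rightarrow> 'm \<Rightarrow> real"
  where "pair g X Y = (\<lambda>p. g p (X p) (Y p))"

definition anchored ::
  "('m \<Rightarrow> 'e \<Rightarrow> ('m \<Rightarrow> real) \<Rightarrow> real) \<Rightarrow> ('m \<Rightarrow> 'e) \<Rightarrow> 'm \<Rightarrow> ('m \<Rightarrow> real) \<Rightarrow> real"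
  where "anchored rho X = (\<lambda>p. rho p (X p))"

definition act ::
  "('m \<Rightarrow> 'e \<Rightarrow> ('m \<Rightarrow> real) \<Rightarrow> real) \<Rightarrow> ('m \<Rightarrow> 'e) \<Rightarrow> ('m \<Rightarrow> real) \<Rightarrow> 'm \<Rightarrow> real"
  where "act rho X f = (\<lambda>p. anchored rho X p f)"


section \<open>Courant algebroids\<close>

text \<open>The three steps of the composite defining \<open>\<D>\<close>: the differential of a function, the
  dual of the anchor, and the identification of covectors on \<open>E p\<close> with elements of \<open>E p\<close>
  given by the pairing.\<close>

definition differential :: "('m \<Rightarrow> real) \<Rightarrow> 'm \<Rightarrow> (('m \<Rightarrow> real) \<Rightarrow> real) \<Rightarrow> real"
  where "differential f p v = v f"

definition dual_anchor ::
  "('m \<Rightarrow> 'e \<Rightarrow> ('m \<Rightarrow> real) \<Rightarrow> real) \<Rightarrow> ('m \<Rightarrow> (('m \<Rightarrow> real) \<Rightarrow> real) \<Rightarrow> real) \<Rightarrow> 'm \<Rightarrow> 'e \<Rightarrow> real"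
  where "dual_anchor rho \<alpha> p e = \<alpha> p (rho p e)"

definition sharp :: "('m \<Rightarrow> 'e set) \<Rightarrow> ('m \<Rightarrow> 'e \<Rightarrow> 'e \<Rightarrow> real) \<Rightarrow> ('m \<Rightarrow> 'e \<Rightarrow> real) \<Rightarrow> 'm \<Rightarrow> 'e"
  where "sharp E g \<alpha> p = (THE e. e \<in> E p \<and> (\<forall>v\<in>E p. g p e v = \<alpha> p v))"

definition courant_D ::
  "('m \<Rightarrow> 'e set) \<Rightarrow> ('m \<Rightarrow> 'e \<Rightarrow> 'e \<Rightarrow> real) \<Rightarrow> ('m \<Rightarrow> 'e \<Rightarrow> ('m \<Rightarrow> real) \<Rightarrow> real)
    \<Rightarrow> ('m \<Rightarrow> real) \<Rightarrow> 'm \<Rightarrow> 'e"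
  where "courant_D E g rho f = sharp E g (dual_anchor rho (differential f))"

locale courant_algebroid = smooth_vector_bundle A E T
  for A :: "('m::{t2_space,second_countable_topology} set \<times> ('m \<Rightarrow> 'b::real_inner)) set"
    and E :: "'m \<Rightarrow> 'e::real_vector set"
    and T :: "('m set \<times> ('m \<Rightarrow> 'v::real_inner \<Rightarrow> 'e)) set" +
  fixes g :: "'m \<Rightarrow> 'e \<Rightarrow> 'e \<Rightarrow> real"
    and br :: "('m \<Rightarrow> 'e) \<Rightarrow> ('m \<Rightarrow> 'e) \<Rightarrow> ('m \<Rightarrow> 'e)"
    and rho :: "'m \<Rightarrow> 'e \<Rightarrow> ('m \<Rightarrow> real) \<Rightarrow> real"
  assumes pairing_add:
      "x \<in> E p \<Longrightarrow> y \<in> E p \<Longrightarrow> z \<in> E p \<Longrightarrow> g p (x + y) z = g p x z + g p y z"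
    and pairing_scale: "x \<in> E p \<Longrightarrow> z \<in> E p \<Longrightarrow> g p (c *\<^sub>R x) z = c * g p x z"
    and pairing_sym: "x \<in> E p \<Longrightarrow> y \<in> E p \<Longrightarrow> g p x y = g p y x"
    and pairing_nondegenerate: "x \<in> E p \<Longrightarrow> (\<And>y. y \<in> E p \<Longrightarrow> g p x y = 0) \<Longrightarrow> x = 0"
    and pairing_smooth:
      "open W \<Longrightarrow> smooth_section_on A E T W X \<Longrightarrow> smooth_section_on A E T W Y
        \<Longrightarrow> smooth_map_on A W (pair g X Y)"
    and anchor_tangent: "x \<in> E p \<Longrightarrow> rho p x \<in> tangent_space A p"
    and anchor_add: "x \<in> E p \<Longrightarrow> y \<in> E p \<Longrightarrow> rho p (x + y) = rho p x + rho p y"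
    and anchor_scale: "x \<in> E p \<Longrightarrow> rho p (c *\<^sub>R x) = c *\<^sub>R rho p x"
    and anchor_smooth:
      "open W \<Longrightarrow> smooth_section_on A E T W X \<Longrightarrow> smooth_vector_field_on A W (anchored rho X)"
    and bracket_section:
      "X \<in> sections A E T \<Longrightarrow> Y \<in> sections A E T \<Longrightarrow> br X Y \<in> sections A E T"
    and bracket_add_left:
      "X \<in> sections A E T \<Longrightarrow> Y \<in> sections A E T \<Longrightarrow> Z \<in> sections A E T
        \<Longrightarrow> br (X + Y) Z = br X Z + br Y Z"
    and bracket_add_right:
      "X \<in> sections A E T \<Longrightarrow> Y \<in> sections A E T \<Longrightarrow> Z \<in> sections A E T
        \<Longrightarrow> br X (Y + Z) = br X Y + br X Z"
    and bracket_scale_left: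
      "X \<in> sections A E T \<Longrightarrow> Y \<in> sections A E T \<Longrightarrow> br (c *\<^sub>R X) Y = c *\<^sub>R br X Y"
    and bracket_scale_right:
      "X \<in> sections A E T \<Longrightarrow> Y \<in> sections A E T \<Longrightarrow> br X (c *\<^sub>R Y) = c *\<^sub>R br X Y"
    and bracket_jacobi:
      "X \<in> sections A E T \<Longrightarrow> Y \<in> sections A E T \<Longrightarrow> Z \<in> sections A E T
        \<Longrightarrow> br X (br Y Z) = br (br X Y) Z + br Y (br X Z)"
    and bracket_leibniz:
      "X \<in> sections A E T \<Longrightarrow> Y \<in> sections A E T \<Longrightarrow> f \<in> C_inf A
        \<Longrightarrow> br X (fscale f Y) = fscale f (br X Y) + fscale (act rho X f) Y"
    and anchor_bracket:
      "X \<in> sections A E T \<Longrightarrow> Y \<in> sections A E T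
        \<Longrightarrow> anchored rho (br X Y) = lie_bracket (anchored rho X) (anchored rho Y)"
    and bracket_self:
      "X \<in> sections A E T \<Longrightarrow> br X X = (1/2) *\<^sub>R courant_D E g rho (pair g X X)"
    and pairing_invariant:
      "X \<in> sections A E T \<Longrightarrow> Y \<in> sections A E T \<Longrightarrow> Z \<in> sections A E T
        \<Longrightarrow> act rho X (pair g Y Z) = pair g (br X Y) Z + pair g Y (br X Z)"

locale compatible_courant_algebroids =
  first: courant_algebroid A E T g br rho + second: courant_algebroid A E T g br' rho'
  for A :: "('m::{t2_space,second_countable_topology} set \<times> ('m \<Rightarrow> 'b::real_inner)) set"
    and E :: "'m \<Rightarrow> 'e::real_vector set"
    and T :: "('m set \<times> ('m \<Rightarrow> 'v::real_inner \<Rightarrow> 'e)) set"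
    and g :: "'m \<Rightarrow> 'e \<Rightarrow> 'e \<Rightarrow> real"
    and br :: "('m \<Rightarrow> 'e) \<Rightarrow> ('m \<Rightarrow> 'e) \<Rightarrow> ('m \<Rightarrow> 'e)"
    and rho :: "'m \<Rightarrow> 'e \<Rightarrow> ('m \<Rightarrow> real) \<Rightarrow> real"
    and br' :: "('m \<Rightarrow> 'e) \<Rightarrow> ('m \<Rightarrow> 'e) \<Rightarrow> ('m \<Rightarrow> 'e)"
    and rho' :: "'m \<Rightarrow> 'e \<Rightarrow> ('m \<Rightarrow> real) \<Rightarrow> real" +
  assumes compatible_jacobi:
      "X \<in> sections A E T \<Longrightarrow> Y \<in> sections A E T \<Longrightarrow> Z \<in> sections A E T
        \<Longrightarrow> br' X (br Y Z) + br X (br' Y Z) =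
            br' (br X Y) Z + br (br' X Y) Z + br' Y (br X Z) + br Y (br' X Z)"
    and compatible_anchor:
      "X \<in> sections A E T \<Longrightarrow> Y \<in> sections A E T
        \<Longrightarrow> anchored rho (br' X Y) + anchored rho' (br X Y) =
            lie_bracket (anchored rho X) (anchored rho' Y) +
            lie_bracket (anchored rho' X) (anchored rho Y)"


section \<open>L-infinity algebras\<close>

text \<open>A graded vector space is a family \<open>L\<close> of subspaces, indexed by the degree, of an ambient
  vector space, whose sum \<open>graded_total L\<close> is direct.\<close>

definition graded_vector_space :: "(int \<Rightarrow> 'a::real_vector set) \<Rightarrow> bool"
  where "graded_vector_space L \<longleftrightarrow>
    (\<forall>d. subspace (L d)) \<and>
    (\<forall>I x. finite I \<and> (\<forall>d\<in>I. x d \<in> L d) \<and> (\<Sum>d\<in>I. x d) = 0 \<longrightarrow> (\<forall>d\<in>I. x d = 0))"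

definition graded_total :: "(int \<Rightarrow> 'a::real_vector set) \<Rightarrow> 'a set"
  where "graded_total L = span (\<Union>d. L d)"

text \<open>The degrees are listed explicitly because 0 is homogeneous of every degree.\<close>

definition homogeneous :: "(int \<Rightarrow> 'a set) \<Rightarrow> int list \<Rightarrow> 'a list \<Rightarrow> bool"
  where "homogeneous L ds xs \<longleftrightarrow> list_all2 (\<lambda>d x. x \<in> L d) ds xs"

text \<open>The Koszul sign is determined by \<open>x\<^sub>1 \<cdots> x\<^sub>n = \<epsilon>(\<sigma>) x\<^bsub>\<sigma>(1)\<^esub> \<cdots> x\<^bsub>\<sigma>(n)\<^esub>\<close> in the free
  graded commutative algebra, which gives one factor for each inversion of \<open>\<sigma>\<close>. Permutations
  act on \<open>{..<n}\<close>, i.e. all indices are shifted down by one.\<close>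

definition koszul_sign :: "int list \<Rightarrow> (nat \<Rightarrow> nat) \<Rightarrow> real"
  where "koszul_sign ds \<sigma> =
    (\<Prod>(a, b)\<in>{(a, b). a < b \<and> b < length ds \<and> \<sigma> b < \<sigma> a}. (-1) powi (ds ! \<sigma> a * ds ! \<sigma> b))"

definition chi :: "int list \<Rightarrow> (nat \<Rightarrow> nat) \<Rightarrow> real"
  where "chi ds \<sigma> = of_int (sign \<sigma>) * koszul_sign ds \<sigma>"

definition shuffle_perms :: "nat \<Rightarrow> nat \<Rightarrow> (nat \<Rightarrow> nat) set"
  where "shuffle_perms i n =
    {\<sigma>. \<sigma> permutes {..<n} \<and> strict_mono_on {..<i} \<sigma> \<and> strict_mono_on {i..<n} \<sigma>}"

text \<open>\<open>l k [x\<^sub>1, \<dots>, x\<^sub>k]\<close> is the value of the \<open>k\<close>-ary operation.\<close>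

definition multilinear_on :: "'a::real_vector set \<Rightarrow> nat \<Rightarrow> ('a list \<Rightarrow> 'a) \<Rightarrow> bool"
  where "multilinear_on V k m \<longleftrightarrow>
    (\<forall>xs i x y c. length xs = k \<and> set xs \<subseteq> V \<and> i < k \<and> x \<in> V \<and> y \<in> V \<longrightarrow>
      m (xs[i := x + y]) = m (xs[i := x]) + m (xs[i := y]) \<and>
      m (xs[i := c *\<^sub>R x]) = c *\<^sub>R m (xs[i := x]))"

definition graded_skew_symmetric ::
  "(int \<Rightarrow> 'a::real_vector set) \<Rightarrow> nat \<Rightarrow> ('a list \<Rightarrow> 'a) \<Rightarrow> bool"
  where "graded_skew_symmetric L k m \<longleftrightarrow>
    (\<forall>ds xs \<sigma>. length xs = k \<and> homogeneous L ds xs \<and> \<sigma> permutes {..<k} \<longrightarrow>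
      m (map (\<lambda>a. xs ! \<sigma> a) [0..<k]) = chi ds \<sigma> *\<^sub>R m xs)"

definition nested ::
  "(nat \<Rightarrow> 'a list \<Rightarrow> 'a) \<Rightarrow> (nat \<Rightarrow> 'a list \<Rightarrow> 'a) \<Rightarrow> nat \<Rightarrow> nat \<Rightarrow> (nat \<Rightarrow> nat) \<Rightarrow> 'a list \<Rightarrow> 'a"
  where "nested l l' j i \<sigma> xs =
    l j (l' i (map (\<lambda>a. xs ! \<sigma> a) [0..<i]) # map (\<lambda>a. xs ! \<sigma> a) [i..<length xs])"

definition L_infinity_algebra ::
  "(int \<Rightarrow> 'a::real_vector set) \<Rightarrow> (nat \<Rightarrow> 'a list \<Rightarrow> 'a) \<Rightarrow> bool"
  where "L_infinity_algebra L l \<longleftrightarrow>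
    graded_vector_space L \<and>
    (\<forall>k\<ge>1. multilinear_on (graded_total L) k (l k) \<and>
      graded_skew_symmetric L k (l k) \<and>
      (\<forall>ds xs. length xs = k \<and> homogeneous L ds xs \<longrightarrow>
        l k xs \<in> L (sum_list ds + 2 - int k))) \<and>
    (\<forall>n\<ge>1. \<forall>ds xs. length xs = n \<and> homogeneous L ds xs \<longrightarrow>
      (\<Sum>(i, j)\<in>{(i, j). i \<ge> 1 \<and> j \<ge> 1 \<and> i + j = n + 1}. \<Sum>\<sigma>\<in>shuffle_perms i n.
        (chi ds \<sigma> * (-1) ^ (i * (j - 1))) *\<^sub>R nested l l j i \<sigma> xs) = 0)"

definition compatible_L_infinity_algebra ::
  "(int \<Rightarrow> 'a::real_vector set) \<Rightarrow> (nat \<Rightarrow> 'a list \<Rightarrow> 'a) \<Rightarrow> (nat \<Rightarrow> 'a list \<Rightarrow> 'a) \<Rightarrow> bool"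
  where "compatible_L_infinity_algebra L l l' \<longleftrightarrow>
    L_infinity_algebra L l \<and> L_infinity_algebra L l' \<and>
    (\<forall>n\<ge>1. \<forall>ds xs. length xs = n \<and> homogeneous L ds xs \<longrightarrow>
      (\<Sum>(i, j)\<in>{(i, j). i \<ge> 1 \<and> j \<ge> 1 \<and> i + j = n + 1}. \<Sum>\<sigma>\<in>shuffle_perms i n.
        (chi ds \<sigma> * (-1) ^ (i * (j - 1))) *\<^sub>R
          (nested l l' j i \<sigma> xs + nested l' l j i \<sigma> xs)) = 0)"


section \<open>The L-infinity algebra of a Courant algebroid\<close>

text \<open>\<open>L(E)\<close> is realised inside the space of pairs of a function and a section.\<close>

definition courant_L ::
  "('m set \<times> ('m \<Rightarrow> 'b::real_normed_vector)) set \<Rightarrow> ('m \<Rightarrow> 'e::real_vector set)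
    \<Rightarrow> ('m set \<times> ('m \<Rightarrow> 'v::real_normed_vector \<Rightarrow> 'e)) set
    \<Rightarrow> int \<Rightarrow> (('m \<Rightarrow> real) \<times> ('m \<Rightarrow> 'e)) set"
  where "courant_L A E T d =
    (if d = -1 then C_inf A \<times> {0} else if d = 0 then {0} \<times> sections A E T else {0})"

definition skew_bracket ::
  "('m \<Rightarrow> 'e::real_vector set) \<Rightarrow> ('m \<Rightarrow> 'e \<Rightarrow> 'e \<Rightarrow> real)
    \<Rightarrow> (('m \<Rightarrow> 'e) \<Rightarrow> ('m \<Rightarrow> 'e) \<Rightarrow> ('m \<Rightarrow> 'e)) \<Rightarrow> ('m \<Rightarrow> 'e \<Rightarrow> ('m \<Rightarrow> real) \<Rightarrow> real)
    \<Rightarrow> ('m \<Rightarrow> 'e) \<Rightarrow> ('m \<Rightarrow> 'e) \<Rightarrow> 'm \<Rightarrow> 'e"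
  where "skew_bracket E g br rho X Y = br X Y - (1/2) *\<^sub>R courant_D E g rho (pair g X Y)"

definition courant_l1 ::
  "('m \<Rightarrow> 'e::real_vector set) \<Rightarrow> ('m \<Rightarrow> 'e \<Rightarrow> 'e \<Rightarrow> real) \<Rightarrow> ('m \<Rightarrow> 'e \<Rightarrow> ('m \<Rightarrow> real) \<Rightarrow> real)
    \<Rightarrow> ('m \<Rightarrow> real) \<times> ('m \<Rightarrow> 'e) \<Rightarrow> ('m \<Rightarrow> real) \<times> ('m \<Rightarrow> 'e)"
  where "courant_l1 E g rho = (\<lambda>(f, X). (0, courant_D E g rho f))"

text \<open>The bilinear extension of the given values on pairs of homogeneous elements; in
  particular \<open>l\<^sub>2\<close> vanishes on two functions.\<close>

definition courant_l2 ::
  "('m \<Rightarrow> 'e::real_vector set) \<Rightarrow> ('m \<Rightarrow> 'e \<Rightarrow> 'e \<Rightarrow> real)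
    \<Rightarrow> (('m \<Rightarrow> 'e) \<Rightarrow> ('m \<Rightarrow> 'e) \<Rightarrow> ('m \<Rightarrow> 'e)) \<Rightarrow> ('m \<Rightarrow> 'e \<Rightarrow> ('m \<Rightarrow> real) \<Rightarrow> real)
    \<Rightarrow> ('m \<Rightarrow> real) \<times> ('m \<Rightarrow> 'e) \<Rightarrow> ('m \<Rightarrow> real) \<times> ('m \<Rightarrow> 'e)
    \<Rightarrow> ('m \<Rightarrow> real) \<times> ('m \<Rightarrow> 'e)"
  where "courant_l2 E g br rho = (\<lambda>(f, X) (h, Y).
    ((1/2) *\<^sub>R pair g X (courant_D E g rho h) - (1/2) *\<^sub>R pair g Y (courant_D E g rho f),
     skew_bracket E g br rho X Y))"

definition courant_l3 ::
  "('m \<Rightarrow> 'e::real_vector set) \<Rightarrow> ('m \<Rightarrow> 'e \<Rightarrow> 'e \<Rightarrow> real)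
    \<Rightarrow> (('m \<Rightarrow> 'e) \<Rightarrow> ('m \<Rightarrow> 'e) \<Rightarrow> ('m \<Rightarrow> 'e)) \<Rightarrow> ('m \<Rightarrow> 'e \<Rightarrow> ('m \<Rightarrow> real) \<Rightarrow> real)
    \<Rightarrow> ('m \<Rightarrow> real) \<times> ('m \<Rightarrow> 'e) \<Rightarrow> ('m \<Rightarrow> real) \<times> ('m \<Rightarrow> 'e)
    \<Rightarrow> ('m \<Rightarrow> real) \<times> ('m \<Rightarrow> 'e) \<Rightarrow> ('m \<Rightarrow> real) \<times> ('m \<Rightarrow> 'e)"
  where "courant_l3 E g br rho = (\<lambda>(f, X) (h, Y) (k, Z).
    ((-1/6) *\<^sub>R (pair g (skew_bracket E g br rho X Y) Z
               + pair g (skew_bracket E g br rho Y Z) X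
               + pair g (skew_bracket E g br rho Z X) Y), 0))"

definition courant_l ::
  "('m \<Rightarrow> 'e::real_vector set) \<Rightarrow> ('m \<Rightarrow> 'e \<Rightarrow> 'e \<Rightarrow> real)
    \<Rightarrow> (('m \<Rightarrow> 'e) \<Rightarrow> ('m \<Rightarrow> 'e) \<Rightarrow> ('m \<Rightarrow> 'e)) \<Rightarrow> ('m \<Rightarrow> 'e \<Rightarrow> ('m \<Rightarrow> real) \<Rightarrow> real)
    \<Rightarrow> nat \<Rightarrow> (('m \<Rightarrow> real) \<times> ('m \<Rightarrow> 'e)) list \<Rightarrow> ('m \<Rightarrow> real) \<times> ('m \<Rightarrow> 'e)"
  where "courant_l E g br rho k xs =
    (if k = 1 then courant_l1 E g rho (xs ! 0)
     else if k = 2 then courant_l2 E g br rho (xs ! 0) (xs ! 1)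
     else if k = 3 then courant_l3 E g br rho (xs ! 0) (xs ! 1) (xs ! 2)
     else 0)"

end

theory Submission
  imports Defs "HOL-Real_Asymp.Real_Asymp" "Jordan_Normal_Form.Determinant"
begin

text \<open>
  Compatibility of two Courant algebroids means precisely that \<open>([\<cdot>,\<cdot>] + [\<cdot>,\<cdot>]', \<rho> + \<rho>')\<close> is again a
  Courant algebroid for the same pairing. The operations \<open>l\<^sub>k\<close> depend additively on the bracket and
  the anchor, and the generalised Jacobi expressions are quadratic in them, so the mixed expression
  for \<open>l\<close> and \<open>l'\<close> is the one for \<open>l + l'\<close> minus those for \<open>l\<close> and \<open>l'\<close>. Everything therefore reduces
  to the theorem of Roytenberg and Weinstein for a single Courant algebroid. There, degree reasons
  leave few identities to check; they follow from \<open>[\<D>f, X] = 0\<close>, \<open>\<rho> \<circ> \<D> = 0\<close> and the Jacobi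
  identity of the skew bracket up to \<open>\<D>\<close> of the cyclic sum \<open>\<langle>\<lfloor>X, Y\<rfloor>, Z\<rangle> + \<dots>\<close>. The identity
  \<open>[X, \<D>f] = \<D>(\<rho>(X)f)\<close> holds after pairing with any global section; bump functions provide enough
  global sections to conclude.
\<close>

section \<open>Calculus of smooth functions\<close>

text \<open>The analytic obstacle is that \<open>courant_D\<close> is a definite description in each
  single fibre. Before any identity can be used, the vector it describes must exist and vary
  smoothly with the point. Model space and model fibre are merely inner product spaces with a finite
  spanning set, dimension 0 included, so coordinates, Cramer's rule and compactness of closed balls
  are derived from such a set. Compactness is what allows a function living in one chart to be
  extended by zero to the whole manifold. The algebraic obstacle is that 0 is homogeneous of every
  degree, so degree arguments say nothing about lists containing 0; multilinearity disposes of these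
  separately. For nonzero arguments only the degrees -1 and 0 occur, and at most four arguments
  matter. The hardest identity is the one for four sections. It is obtained by computing
  \<open>pair g (\<S> (\<S> X Y) Z) W\<close> in two ways, which trades nested brackets for pairings
  of two brackets and derivatives of functions; what remains is linear arithmetic at a
  point.\<close>

lemma Ck_on_subset: "Ck_on k S f \<Longrightarrow> S' \<subseteq> S \<Longrightarrow> Ck_on k S' f"
  by (induction k arbitrary: f) (auto intro: continuous_on_subset)

text \<open>On an open set the two functions agree near every point of \<open>S\<close>, so they
  have the same derivatives there and the induction can pass to directional derivatives.\<close>

lemma Ck_on_cong:
  assumes "open S" "Ck_on k S f" "\<And>x. x \<in> S \<Longrightarrow> f x = h x"
  shows "Ck_on k S h"
  using assms(2,3)
proof (induction k arbitrary: f h)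
  case 0
  then show ?case by (auto cong: continuous_on_cong)
next
  case (Suc k)
  have d: "(h has_derivative frechet_derivative f (at x)) (at x)" if "x \<in> S" for x
  proof (rule has_derivative_transform_within_open[OF _ \<open>open S\<close> that])
    show "(f has_derivative frechet_derivative f (at x)) (at x)"
      using Suc.prems that by (auto simp: frechet_derivative_works)
  qed (use Suc.prems in auto)
  then have e: "frechet_derivative f (at x) = frechet_derivative h (at x)" if "x \<in> S" for x
    using that by (auto intro: frechet_derivative_at)
  have "Ck_on k S (\<lambda>x. frechet_derivative h (at x) v)" for v
    by (rule Suc.IH[of "\<lambda>x. frechet_derivative f (at x) v"]) (use Suc.prems e in auto)
  with d show ?case by (auto simp: differentiable_def)
qed

lemma Ck_on_local:
  assumes "\<And>x. x \<in> S \<Longrightarrow> \<exists>V. open V \<and> x \<in> V \<and> Ck_on k V f"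
  shows "Ck_on k S f"
  using assms
proof (induction k arbitrary: f)
  case 0
  then show ?case
    by (auto intro!: continuous_at_imp_continuous_on) (meson continuous_on_eq_continuous_at)
next
  case (Suc k)
  have "Ck_on k S (\<lambda>x. frechet_derivative f (at x) v)" for v
    by (rule Suc.IH) (use Suc.prems in fastforce)
  moreover have "f differentiable (at x)" if "x \<in> S" for x
    using Suc.prems[OF that] by auto
  ultimately show ?case by auto
qed

lemma Ck_on_SucD: "Ck_on (Suc k) S f \<Longrightarrow> Ck_on k S f"
proof (induction k arbitrary: f)
  case 0
  then show ?case
    by (auto intro!: continuous_at_imp_continuous_on differentiable_imp_continuous_within)
next
  case (Suc k)
  have "\<forall>x\<in>S. f differentiable (at x)" "\<And>v. Ck_on (Suc k) S (\<lambda>x. frechet_derivative f (at x) v)"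
    using Suc.prems Ck_on.simps(2)[of "Suc k" S f] by blast+
  then show ?case
    unfolding Ck_on.simps(2)[of k S f] by (intro conjI allI Suc.IH)
qed

text \<open>Allows the closure properties below to be proved with an explicit derivative
  \<open>f'\<close> from the differentiation rules instead of with
  \<open>frechet_derivative\<close>.\<close>

lemma Ck_on_SucI:
  assumes "open S" "\<And>x. x \<in> S \<Longrightarrow> (f has_derivative f' x) (at x)"
    and "\<And>v. Ck_on k S (\<lambda>x. f' x v)"
  shows "Ck_on (Suc k) S f"
proof -
  have "Ck_on k S (\<lambda>x. frechet_derivative f (at x) v)" for v
    by (rule Ck_on_cong[OF assms(1) assms(3)[of v]]) (simp add: frechet_derivative_at[OF assms(2)])
  with assms(2) show ?thesis by (auto simp: differentiable_def)
qed

lemma Ck_on_has_derivative: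
  "Ck_on (Suc k) S f \<Longrightarrow> x \<in> S \<Longrightarrow> (f has_derivative frechet_derivative f (at x)) (at x)"
  by (auto simp: frechet_derivative_works)

lemma Ck_on_const: "open S \<Longrightarrow> Ck_on k S (\<lambda>_. c)"
proof (induction k arbitrary: c)
  case (Suc k)
  show ?case by (rule Ck_on_SucI[where f' = "\<lambda>_ _. 0"]) (use Suc in auto)
qed auto

lemma (in bounded_linear) Ck_on_compose:
  "open S \<Longrightarrow> Ck_on k S h \<Longrightarrow> Ck_on k S (\<lambda>x. f (h x))"
proof (induction k arbitrary: h)
  case 0
  then show ?case by (auto intro: continuous_on)
next
  case (Suc k)
  show ?case
    by (rule Ck_on_SucI[OF Suc.prems(1) has_derivative[OF Ck_on_has_derivative[OF Suc.prems(2)]]])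
      (use Suc in auto)
qed

lemma Ck_on_add: "open S \<Longrightarrow> Ck_on k S f \<Longrightarrow> Ck_on k S h \<Longrightarrow> Ck_on k S (\<lambda>x. f x + h x)"
proof (induction k arbitrary: f h)
  case 0
  then show ?case by (auto intro: continuous_on_add)
next
  case (Suc k)
  show ?case
    by (rule Ck_on_SucI[OF Suc.prems(1) has_derivative_add[OF
          Ck_on_has_derivative[OF Suc.prems(2)] Ck_on_has_derivative[OF Suc.prems(3)]]])
      (use Suc in auto)
qed

lemma (in bounded_bilinear) Ck_on_prod:
  "open S \<Longrightarrow> Ck_on k S f \<Longrightarrow> Ck_on k S h \<Longrightarrow> Ck_on k S (\<lambda>x. prod (f x) (h x))"
proof (induction k arbitrary: f h)
  case 0
  then show ?case by (auto intro: continuous_on)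
next
  case (Suc k)
  show ?case
    by (rule Ck_on_SucI[OF Suc.prems(1) FDERIV[OF
          Ck_on_has_derivative[OF Suc.prems(2)] Ck_on_has_derivative[OF Suc.prems(3)]]])
      \<comment> \<open>The product rule brings back \<open>f\<close> and \<open>h\<close>
        undifferentiated; these are needed to order \<open>k\<close> only.\<close>
      (use Suc Suc.prems(2,3)[THEN Ck_on_SucD] in \<open>auto intro!: Ck_on_add\<close>)
qed

lemma Ck_on_inverse:
  fixes f :: "'a::real_normed_vector \<Rightarrow> real"
  shows "open S \<Longrightarrow> Ck_on k S f \<Longrightarrow> (\<And>x. x \<in> S \<Longrightarrow> f x \<noteq> 0) \<Longrightarrow> Ck_on k S (\<lambda>x. inverse (f x))"
proof (induction k)
  case 0
  then show ?case by (auto intro: continuous_on_inverse)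
next
  case (Suc k)
  then have IH: "Ck_on k S (\<lambda>x. inverse (f x))"
    using Ck_on_SucD by blast
  have "Ck_on k S (\<lambda>x. frechet_derivative f (at x) v)" for v
    using Suc.prems by auto
  then have "Ck_on k S (\<lambda>x. - (inverse (f x) * frechet_derivative f (at x) v * inverse (f x)))" for v
    using Suc.prems(1) IH
    by (intro bounded_linear.Ck_on_compose[OF bounded_linear_minus[OF bounded_linear_ident]]
        bounded_bilinear.Ck_on_prod[OF bounded_bilinear_mult]) auto
  then show ?case
    by (intro Ck_on_SucI[OF Suc.prems(1) Deriv.has_derivative_inverse[OF Suc.prems(3)
          Ck_on_has_derivative[OF Suc.prems(2)]]]) auto
qed

text \<open>These functions with \<open>n \<ge> 0\<close> are closed under differentiation up to linear combinations,
  so that \<open>flat_exp 0\<close> is smooth.\<close>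

definition flat_exp :: "nat \<Rightarrow> real \<Rightarrow> real"
  where "flat_exp n t = (if t > 0 then exp (- (1 / t)) / t ^ n else 0)"

text \<open>Away from 0 this is the quotient rule. At 0 the right-hand side is 0, and the difference
  quotient tends to 0 because \<open>exp (- (1 / t))\<close> decays faster than every power of
  \<open>t\<close> as \<open>t\<close> decreases to 0.\<close>

lemma has_field_derivative_flat_exp:
  "(flat_exp n has_field_derivative flat_exp (n + 2) t - real n * flat_exp (n + 1) t) (at t)"
proof -
  consider "t < 0" | "t > 0" | "t = 0" by linarith
  then show ?thesis
  proof cases
    case 1
    have "((\<lambda>_. 0) has_field_derivative 0) (at t)"
      by simp
    then have "(flat_exp n has_field_derivative 0) (at t)"
      by (rule has_field_derivative_transform_within_open[of _ _ _ "{..<0}"])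
        (use 1 in \<open>auto simp: flat_exp_def\<close>)
    with 1 show ?thesis by (simp add: flat_exp_def)
  next
    case 2
    have "((\<lambda>t. exp (- (1 / t)) / t ^ n) has_field_derivative
        (exp (- (1 / t)) / t\<^sup>2 * t ^ n - exp (- (1 / t)) * (real n * t ^ (n - 1))) / (t ^ n * t ^ n)) (at t)"
      using 2 by (auto intro!: derivative_eq_intros simp: power2_eq_square)
    also have "(exp (- (1 / t)) / t\<^sup>2 * t ^ n - exp (- (1 / t)) * (real n * t ^ (n - 1))) / (t ^ n * t ^ n)
        = flat_exp (n + 2) t - real n * flat_exp (n + 1) t"
      using 2 by (cases n) (auto simp: flat_exp_def field_simps power2_eq_square)
    finally show ?thesis
      by (rule has_field_derivative_transform_within_open[of _ _ _ "{0<..}"])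
        (use 2 in \<open>auto simp: flat_exp_def\<close>)
  next
    case 3
    have "((\<lambda>t. flat_exp n t / t) \<longlongrightarrow> 0) (at 0)"
      unfolding filterlim_at_split
    proof
      show "((\<lambda>t. flat_exp n t / t) \<longlongrightarrow> 0) (at_left 0)"
        by (rule tendsto_eventually) (auto simp: eventually_at_left_field flat_exp_def intro: exI[of _ "-1"])
      have "((\<lambda>t::real. exp (- (1 / t)) / t ^ n / t) \<longlongrightarrow> 0) (at_right 0)"
        by real_asymp
      then show "((\<lambda>t. flat_exp n t / t) \<longlongrightarrow> 0) (at_right 0)"
        by (rule Lim_transform_eventually)
          (auto simp: eventually_at_right_field flat_exp_def intro: exI[of _ 1])
    qed
    with 3 show ?thesis by (simp add: has_field_derivative_iff flat_exp_def)
  qed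
qed

text \<open>Differentiation lowers the order but raises the exponent, so the induction on
  \<open>k\<close> must leave \<open>n\<close> arbitrary.\<close>

lemma Ck_on_flat_exp:
  "open S \<Longrightarrow> Ck_on k S q \<Longrightarrow> Ck_on k S (\<lambda>x. flat_exp n (q x))"
proof (induction k arbitrary: n)
  case 0
  have "continuous_on UNIV (flat_exp n)"
    using has_field_derivative_flat_exp DERIV_isCont continuous_at_imp_continuous_on by blast
  with 0 show ?case by (auto intro: continuous_on_compose2)
next
  case (Suc k)
  have "Ck_on k S (\<lambda>x. flat_exp n (q x))" for n
    using Suc Ck_on_SucD by blast
  moreover have "Ck_on k S (\<lambda>x. frechet_derivative q (at x) v)" for v
    using Suc.prems by auto
  ultimately have "Ck_on k S (\<lambda>x. frechet_derivative q (at x) v *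
      (flat_exp (n + 2) (q x) + (- real n) * flat_exp (n + 1) (q x)))" for v
    by (intro bounded_bilinear.Ck_on_prod[OF bounded_bilinear_mult] Ck_on_add Ck_on_const Suc.prems)
  then show ?case
    by (intro Ck_on_SucI[OF Suc.prems(1) DERIV_compose_FDERIV[OF has_field_derivative_flat_exp
          Ck_on_has_derivative[OF Suc.prems(2)]]]) auto
qed

section \<open>Finite-dimensional linear algebra\<close>

text \<open>The set is a continuous image of a product of compact intervals, built up one vector of
  \<open>B\<close> at a time.\<close>

lemma compact_coefficient_box:
  fixes B :: "'b::real_normed_vector set"
  assumes "finite B"
  shows "compact {\<Sum>b\<in>B. c b *\<^sub>R b | c. \<forall>b\<in>B. \<bar>c b\<bar> \<le> m b}"
  using assms
proof (induction B)
  case empty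
  then show ?case by simp
next
  case (insert a B)
  let ?S = "{\<Sum>b\<in>B. c b *\<^sub>R b | c. \<forall>b\<in>B. \<bar>c b\<bar> \<le> m b}"
  have "{\<Sum>b\<in>insert a B. c b *\<^sub>R b | c. \<forall>b\<in>insert a B. \<bar>c b\<bar> \<le> m b}
      = (\<lambda>(t, x). t *\<^sub>R a + x) ` ({- m a..m a} \<times> ?S)"
    (is "?L = ?R")
  proof
    show "?L \<subseteq> ?R"
    proof
      fix x assume "x \<in> ?L"
      then obtain c where c: "x = (\<Sum>b\<in>insert a B. c b *\<^sub>R b)" "\<forall>b\<in>insert a B. \<bar>c b\<bar> \<le> m b"
        by auto
      then have "x = (\<lambda>(t, x). t *\<^sub>R a + x) (c a, \<Sum>b\<in>B. c b *\<^sub>R b)"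
        using insert.hyps by simp
      moreover have "(c a, \<Sum>b\<in>B. c b *\<^sub>R b) \<in> {- m a..m a} \<times> ?S"
        using c(2) by (auto simp: abs_le_iff minus_le_iff)
      ultimately show "x \<in> ?R" by (rule image_eqI)
    qed
    show "?R \<subseteq> ?L"
    proof
      fix x assume "x \<in> ?R"
      then obtain t c where *: "x = t *\<^sub>R a + (\<Sum>b\<in>B. c b *\<^sub>R b)" "\<forall>b\<in>B. \<bar>c b\<bar> \<le> m b"
        "- m a \<le> t" "t \<le> m a"
        by auto
      have "(\<Sum>b\<in>B. (c(a := t)) b *\<^sub>R b) = (\<Sum>b\<in>B. c b *\<^sub>R b)"
        by (rule sum.cong) (use insert.hyps in auto)
      then have "x = (\<Sum>b\<in>insert a B. (c(a := t)) b *\<^sub>R b)"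
        using * insert.hyps by simp
      moreover have "\<forall>b\<in>insert a B. \<bar>(c(a := t)) b\<bar> \<le> m b"
        using * by auto
      ultimately show "x \<in> ?L" by blast
    qed
  qed
  moreover have "compact ?R"
    using insert.IH
    by (intro compact_continuous_image compact_Times)
      (auto simp: case_prod_unfold intro!: continuous_intros)
  ultimately show ?case by simp
qed

text \<open>With an orthogonal spanning set, the Cauchy-Schwarz inequality bounds each coefficient
  of a point of the ball, so the ball is a closed part of a compact coefficient box.\<close>

lemma compact_cball_finite_dimensional:
  fixes x :: "'b::real_inner"
  assumes "finite_dimensional TYPE('b)"
  shows "compact (cball x r)"
proof -
  obtain B :: "'b set" where "finite B" "span B = UNIV"
    using assms by (auto simp: finite_dimensional_def)
  with basis_orthogonal[of B] obtain C :: "'b set"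
    where C: "finite C" "span C = UNIV" "pairwise (\<lambda>a b. a \<bullet> b = 0) C"
    unfolding Linear_Algebra.orthogonal_def by metis
  let ?S = "{\<Sum>b\<in>C. c b *\<^sub>R b | c. \<forall>b\<in>C. \<bar>c b\<bar> \<le> r / norm b}"
  have "cball 0 r \<subseteq> ?S"
  proof
    fix y :: 'b assume "y \<in> cball 0 r"
    then have y: "norm y \<le> r" by simp
    have "y \<in> span C" by (simp add: C(2))
    then obtain u where u: "y = (\<Sum>b\<in>C. u b *\<^sub>R b)"
      unfolding span_finite[OF C(1)] by blast
    \<comment> \<open>The spanning set may contain 0, whose coefficient is arbitrary. It is reset to
      0, which satisfies the bound because \<open>r / norm 0\<close> is 0.\<close>
    define c where "c b = (if b = 0 then 0 else u b)" for b
    have "y = (\<Sum>b\<in>C. c b *\<^sub>R b)"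
      unfolding u c_def by (rule sum.cong) auto
    moreover have "\<bar>c b\<bar> \<le> r / norm b" if b: "b \<in> C" for b
    proof (cases "b = 0")
      case True
      then show ?thesis by (simp add: c_def)
    next
      case False
      have "y \<bullet> b = (\<Sum>a\<in>C. if a = b then u b * (b \<bullet> b) else 0)"
        unfolding u inner_sum_left
        by (rule sum.cong) (use C(3) b in \<open>auto simp: pairwise_def\<close>)
      then have "y \<bullet> b = u b * (norm b)\<^sup>2"
        using C(1) b by (simp add: dot_square_norm)
      then have "\<bar>u b\<bar> * (norm b)\<^sup>2 = \<bar>y \<bullet> b\<bar>"
        by (simp add: abs_mult)
      also have "\<dots> \<le> norm y * norm b"
        by (rule Cauchy_Schwarz_ineq2)
      also have "\<dots> \<le> r * norm b"
        using y by (rule mult_right_mono) simp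
      finally show ?thesis
        using False by (simp add: c_def power2_eq_square pos_le_divide_eq flip: mult.assoc)
    qed
    ultimately show "y \<in> ?S" by blast
  qed
  then have "cball 0 r \<inter> ?S = cball 0 r" by (rule Int_absorb2)
  moreover have "compact (cball 0 r \<inter> ?S)"
    by (rule closed_Int_compact[OF closed_cball compact_coefficient_box[OF C(1)]])
  ultimately have "compact (cball (0::'b) r)" by (simp only:)
  then have "compact ((+) x ` cball 0 r)"
    by (rule compact_translation)
  then show ?thesis by (simp add: image_add_cball)
qed

text \<open>Indexing the basis by natural numbers below \<open>n\<close> makes its coordinates fit
  matrices and determinants; \<open>n = 0\<close> is allowed.\<close>

lemma finite_dimensional_basis:
  fixes t :: "'v::real_vector itself"
  assumes "finite_dimensional t"
  obtains n and b :: "nat \<Rightarrow> 'v"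
  where "\<And>v. \<exists>c. v = (\<Sum>i<n. c i *\<^sub>R b i)"
    and "\<And>c i. (\<Sum>i<n. c i *\<^sub>R b i) = 0 \<Longrightarrow> i < n \<Longrightarrow> c i = 0"
proof -
  obtain S :: "'v set" where S: "finite S" "span S = UNIV"
    using assms by (auto simp: finite_dimensional_def)
  obtain B where B: "B \<subseteq> S" "independent B" "S \<subseteq> span B"
    using maximal_independent_subset[of S] by blast
  have fin: "finite B" using B(1) S(1) by (rule finite_subset)
  have "span S \<subseteq> span B" using B(3) by (simp add: span_minimal)
  then have span: "span B = UNIV" using S(2) by auto
  obtain b where b: "bij_betw b {..<card B} B"
    using ex_bij_betw_nat_finite[OF fin] by (auto simp: atLeast0LessThan)
  show ?thesis
  proof
    fix v :: 'v
    have "v \<in> span B" by (simp add: span)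
    then obtain u where "v = (\<Sum>x\<in>B. u x *\<^sub>R x)"
      unfolding span_finite[OF fin] by blast
    also have "\<dots> = (\<Sum>i<card B. u (b i) *\<^sub>R b i)"
      by (rule sum.reindex_bij_betw[OF b, symmetric])
    finally show "\<exists>c. v = (\<Sum>i<card B. c i *\<^sub>R b i)" by (rule exI[where x = "\<lambda>i. u (b i)"])
  next
    fix c i assume c: "(\<Sum>i<card B. c i *\<^sub>R b i) = 0" and i: "i < card B"
    let ?u = "\<lambda>x. c (inv_into {..<card B} b x)"
    have inv: "inv_into {..<card B} b (b j) = j" if "j < card B" for j
      using b that by (simp add: bij_betw_def)
    have "(\<Sum>x\<in>B. ?u x *\<^sub>R x) = (\<Sum>i<card B. ?u (b i) *\<^sub>R b i)"
      by (rule sum.reindex_bij_betw[OF b, symmetric])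
    also have "\<dots> = (\<Sum>i<card B. c i *\<^sub>R b i)"
      by (rule sum.cong) (auto simp: inv)
    finally have "(\<Sum>x\<in>B. ?u x *\<^sub>R x) = 0" using c by simp
    moreover have "b i \<in> B" using b i by (auto simp: bij_betw_def)
    ultimately have "?u (b i) = 0"
      by (rule independentD[OF B(2) fin subset_refl])
    then show "c i = 0" by (simp add: inv i)
  qed
qed

text \<open>The adjugate exhibits the solution as a rational expression in the entries of
  \<open>M\<close> and \<open>a\<close>. Hence it inherits smoothness when these depend on a point,
  which an abstract existence statement would not give.\<close>

lemma Cramer_solution:
  fixes M :: "nat \<Rightarrow> nat \<Rightarrow> real" and n a
  defines "N \<equiv> Matrix.mat n n (\<lambda>(i, j). M i j)"
  assumes ker: "\<And>x. (\<And>i. i < n \<Longrightarrow> (\<Sum>j<n. M i j * x j) = 0) \<Longrightarrow> (\<And>j. j < n \<Longrightarrow> x j = 0)"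
  shows "Determinant.det N \<noteq> 0"
    and "i < n \<Longrightarrow>
      (\<Sum>j<n. M i j * (inverse (Determinant.det N) * (\<Sum>k<n. cofactor N k j * a k))) = a i"
proof -
  have N: "N \<in> carrier_mat n n" by (simp add: N_def)
  show d: "Determinant.det N \<noteq> 0"
  proof
    assume "Determinant.det N = 0"
    then obtain v where v: "v \<in> carrier_vec n" "v \<noteq> 0\<^sub>v n" "N *\<^sub>v v = 0\<^sub>v n"
      using det_0_iff_vec_prod_zero[OF N] by auto
    have "(\<Sum>j<n. M i j * vec_index v j) = 0" if "i < n" for i
    proof -
      have "vec_index (N *\<^sub>v v) i = (\<Sum>j<n. M i j * vec_index v j)"
        using that v(1) by (simp add: N_def scalar_prod_def atLeast0LessThan)
      with v(3) that show ?thesis by simp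
    qed
    then have "vec_index v j = 0" if "j < n" for j
      using ker[of "vec_index v"] that by blast
    then have "v = 0\<^sub>v n" using v(1) by auto
    with v(2) show False by simp
  qed
  show "(\<Sum>j<n. M i j * (inverse (Determinant.det N) * (\<Sum>k<n. cofactor N k j * a k))) = a i"
    if i: "i < n"
  proof -
    have adj: "(\<Sum>j<n. M i j * cofactor N k j) = (if i = k then Determinant.det N else 0)"
      if k: "k < n" for k
    proof -
      have "(N * adj_mat N) $$ (i, k) = (\<Sum>j<n. M i j * cofactor N k j)"
        using i k by (simp add: N_def adj_mat_def scalar_prod_def atLeast0LessThan)
      then show ?thesis using i k by (auto simp: adj_mat(2)[OF N])
    qed
    have "(\<Sum>j<n. M i j * (inverse (Determinant.det N) * (\<Sum>k<n. cofactor N k j * a k)))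
        = inverse (Determinant.det N) * (\<Sum>j<n. \<Sum>k<n. M i j * cofactor N k j * a k)"
      by (simp add: sum_distrib_left mult_ac)
    also have "(\<Sum>j<n. \<Sum>k<n. M i j * cofactor N k j * a k)
        = (\<Sum>k<n. (\<Sum>j<n. M i j * cofactor N k j) * a k)"
      by (subst sum.swap) (simp add: sum_distrib_right)
    also have "\<dots> = (\<Sum>k<n. if i = k then Determinant.det N * a i else 0)"
      by (rule sum.cong) (auto simp: adj)
    also have "\<dots> = Determinant.det N * a i"
      using i by simp
    finally show ?thesis using d by simp
  qed
qed


section \<open>Smooth functions on manifolds\<close>

context smooth_manifold
begin

lemma open_chart_image_Int:
  assumes "(U, \<phi>) \<in> A" "open W"
  shows "open (\<phi> ` (U \<inter> W))"
proof -
  have "openin (top_of_set (\<phi> ` U)) (\<phi> ` (U \<inter> W))"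
    using homeomorphism_imp_open_map[OF chart_homeomorphism[OF assms(1)]] assms(2)
    by (simp add: openin_open_Int)
  then show ?thesis
    using chart_open_image[OF assms(1)] openin_open_trans by blast
qed

lemma inv_into_chart: "(U, \<phi>) \<in> A \<Longrightarrow> p \<in> U \<Longrightarrow> inv_into U \<phi> (\<phi> p) = p"
  by (rule homeomorphism_apply1[OF chart_homeomorphism])

lemma smooth_map_on_iff:
  "smooth_map_on A W f \<longleftrightarrow>
    (\<forall>U \<phi> k. (U, \<phi>) \<in> A \<longrightarrow> Ck_on k (\<phi> ` (U \<inter> W)) (\<lambda>x. f (inv_into U \<phi> x)))"
  by (auto simp: smooth_map_on_def smooth_on_def comp_def)

lemma smooth_map_on_subset: "smooth_map_on A W f \<Longrightarrow> W' \<subseteq> W \<Longrightarrow> smooth_map_on A W' f"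
  unfolding smooth_map_on_iff by (blast intro: Ck_on_subset)

lemma smooth_map_on_cong:
  assumes "open W" "smooth_map_on A W f" "\<And>p. p \<in> W \<Longrightarrow> f p = h p"
  shows "smooth_map_on A W h"
  unfolding smooth_map_on_iff
proof (intro allI impI)
  fix U \<phi> k assume c: "(U, \<phi>) \<in> A"
  show "Ck_on k (\<phi> ` (U \<inter> W)) (\<lambda>x. h (inv_into U \<phi> x))"
    by (rule Ck_on_cong[OF open_chart_image_Int[OF c assms(1)], where f = "\<lambda>x. f (inv_into U \<phi> x)"])
      (use assms c in \<open>auto simp: smooth_map_on_iff inv_into_chart\<close>)
qed

lemma smooth_map_on_local:
  assumes "\<And>p. p \<in> W \<Longrightarrow> \<exists>W'. open W' \<and> p \<in> W' \<and> smooth_map_on A W' f"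
  shows "smooth_map_on A W f"
  unfolding smooth_map_on_iff
proof (intro allI impI)
  fix U \<phi> k assume c: "(U, \<phi>) \<in> A"
  show "Ck_on k (\<phi> ` (U \<inter> W)) (\<lambda>x. f (inv_into U \<phi> x))"
  proof (rule Ck_on_local)
    fix x assume "x \<in> \<phi> ` (U \<inter> W)"
    then obtain p where p: "p \<in> U" "p \<in> W" "x = \<phi> p" by auto
    with assms obtain W' where W': "open W'" "p \<in> W'" "smooth_map_on A W' f" by blast
    have "open (\<phi> ` (U \<inter> W'))" "x \<in> \<phi> ` (U \<inter> W')"
      "Ck_on k (\<phi> ` (U \<inter> W')) (\<lambda>x. f (inv_into U \<phi> x))"
      using c p W' by (auto simp: smooth_map_on_iff intro: open_chart_image_Int)
    then show "\<exists>V. open V \<and> x \<in> V \<and> Ck_on k V (\<lambda>x. f (inv_into U \<phi> x))" by blast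
  qed
qed

lemma smooth_map_on_const: "open W \<Longrightarrow> smooth_map_on A W (\<lambda>_. c)"
  unfolding smooth_map_on_iff by (auto intro: Ck_on_const open_chart_image_Int)

lemma smooth_map_on_bounded_linear:
  "bounded_linear L \<Longrightarrow> open W \<Longrightarrow> smooth_map_on A W f \<Longrightarrow> smooth_map_on A W (\<lambda>p. L (f p))"
  unfolding smooth_map_on_iff
  by (auto intro!: bounded_linear.Ck_on_compose[where f = L] open_chart_image_Int)

lemma smooth_map_on_add:
  "open W \<Longrightarrow> smooth_map_on A W f \<Longrightarrow> smooth_map_on A W h \<Longrightarrow> smooth_map_on A W (\<lambda>p. f p + h p)"
  unfolding smooth_map_on_iff by (auto intro: Ck_on_add open_chart_image_Int)

lemma smooth_map_on_bounded_bilinear: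
  "bounded_bilinear P \<Longrightarrow> open W \<Longrightarrow> smooth_map_on A W f \<Longrightarrow> smooth_map_on A W h
    \<Longrightarrow> smooth_map_on A W (\<lambda>p. P (f p) (h p))"
  unfolding smooth_map_on_iff
  by (auto intro!: bounded_bilinear.Ck_on_prod[where prod = P] open_chart_image_Int)

lemmas smooth_map_on_mult = smooth_map_on_bounded_bilinear[OF bounded_bilinear_mult]
lemmas smooth_map_on_scaleR = smooth_map_on_bounded_bilinear[OF bounded_bilinear_scaleR]
lemmas smooth_map_on_inner = smooth_map_on_bounded_bilinear[OF bounded_bilinear_inner]

lemma smooth_map_on_diff:
  assumes "open W" "smooth_map_on A W f" "smooth_map_on A W h"
  shows "smooth_map_on A W (\<lambda>p. f p - h p)"
  using smooth_map_on_add[OF assms(1,2) smooth_map_on_bounded_linear[OF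
        bounded_linear_minus[OF bounded_linear_ident] assms(1,3)]]
  by simp

lemma smooth_map_on_sum:
  "open W \<Longrightarrow> (\<And>i. i \<in> I \<Longrightarrow> smooth_map_on A W (f i)) \<Longrightarrow> smooth_map_on A W (\<lambda>p. \<Sum>i\<in>I. f i p)"
  by (induction I rule: infinite_finite_induct) (auto intro: smooth_map_on_const smooth_map_on_add)

lemma smooth_map_on_prod:
  fixes f :: "'i \<Rightarrow> 'm \<Rightarrow> real"
  shows "open W \<Longrightarrow> (\<And>i. i \<in> I \<Longrightarrow> smooth_map_on A W (f i))
    \<Longrightarrow> smooth_map_on A W (\<lambda>p. \<Prod>i\<in>I. f i p)"
  by (induction I rule: infinite_finite_induct) (auto intro: smooth_map_on_const smooth_map_on_mult)

lemma smooth_map_on_inverse: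
  fixes f :: "'m \<Rightarrow> real"
  assumes "open W" "smooth_map_on A W f" "\<And>p. p \<in> W \<Longrightarrow> f p \<noteq> 0"
  shows "smooth_map_on A W (\<lambda>p. inverse (f p))"
  using assms unfolding smooth_map_on_iff
  by (auto intro!: Ck_on_inverse open_chart_image_Int simp: inv_into_chart)

lemma smooth_map_on_flat_exp:
  "open W \<Longrightarrow> smooth_map_on A W f \<Longrightarrow> smooth_map_on A W (\<lambda>p. flat_exp n (f p))"
  unfolding smooth_map_on_iff by (auto intro: Ck_on_flat_exp open_chart_image_Int)

text \<open>Read in another chart, this is the smoothness of the transition maps.\<close>

lemma smooth_map_on_chart: "(U, \<phi>) \<in> A \<Longrightarrow> smooth_map_on A U \<phi>"
  using chart_transition_smooth by (fastforce simp: smooth_map_on_def Int_commute)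

text \<open>By the Leibniz formula the determinant is a polynomial in the entries.\<close>

lemma smooth_map_on_det:
  fixes G :: "nat \<Rightarrow> nat \<Rightarrow> 'm \<Rightarrow> real"
  assumes "open W" "\<And>i j. i < n \<Longrightarrow> j < n \<Longrightarrow> smooth_map_on A W (G i j)"
  shows "smooth_map_on A W (\<lambda>p. Determinant.det (Matrix.mat n n (\<lambda>(i, j). G i j p)))"
proof -
  have less: "\<sigma> i < n" if "\<sigma> permutes {0..<n}" "i < n" for \<sigma> i
    using permutes_in_image[OF that(1), of i] that(2) by simp
  have "smooth_map_on A W (\<lambda>p. \<Sum>\<sigma>\<in>{\<sigma>. \<sigma> permutes {0..<n}}.
      signof \<sigma> * (\<Prod>i = 0..<n. G i (\<sigma> i) p))"
    by (intro smooth_map_on_sum smooth_map_on_mult smooth_map_on_prod smooth_map_on_const assms)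
      (auto simp: less)
  moreover have "Determinant.det (Matrix.mat n n (\<lambda>(i, j). G i j p))
      = (\<Sum>\<sigma>\<in>{\<sigma>. \<sigma> permutes {0..<n}}. signof \<sigma> * (\<Prod>i = 0..<n. G i (\<sigma> i) p))" for p
    by (subst det_def'[of _ n]) (auto intro!: sum.cong prod.cong simp: less)
  ultimately show ?thesis by simp
qed

lemma smooth_map_on_cofactor:
  fixes G :: "nat \<Rightarrow> nat \<Rightarrow> 'm \<Rightarrow> real"
  assumes "open W" "\<And>i j. i < n \<Longrightarrow> j < n \<Longrightarrow> smooth_map_on A W (G i j)"
  shows "smooth_map_on A W (\<lambda>p. cofactor (Matrix.mat n n (\<lambda>(i, j). G i j p)) k l)"
proof -
  \<comment> \<open>\<open>?s k\<close> enumerates the indices other than \<open>k\<close>, so the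
    minor is again a matrix of entries of \<open>G\<close>.\<close>
  let ?s = "\<lambda>k i. if i < k then i else Suc i"
  have "mat_delete (Matrix.mat n n (\<lambda>(i, j). G i j p)) k l
      = Matrix.mat (n - 1) (n - 1) (\<lambda>(i, j). G (?s k i) (?s l j) p)" for p
    by (rule eq_matI) (auto simp: mat_delete_def)
  moreover have "smooth_map_on A W (\<lambda>p.
      Determinant.det (Matrix.mat (n - 1) (n - 1) (\<lambda>(i, j). G (?s k i) (?s l j) p)))"
    by (rule smooth_map_on_det[where G = "\<lambda>i j. G (?s k i) (?s l j)"]) (auto intro!: assms)
  then have "smooth_map_on A W (\<lambda>p. (-1) ^ (k + l) *
      Determinant.det (Matrix.mat (n - 1) (n - 1) (\<lambda>(i, j). G (?s k i) (?s l j) p)))"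
    by (rule smooth_map_on_mult[OF assms(1) smooth_map_on_const[OF assms(1)]])
  ultimately show ?thesis by (simp add: cofactor_def)
qed

lemma smooth_linear_system:
  fixes G :: "nat \<Rightarrow> nat \<Rightarrow> 'm \<Rightarrow> real"
  assumes "open W" "\<And>i j. i < n \<Longrightarrow> j < n \<Longrightarrow> smooth_map_on A W (G i j)"
    and "\<And>i. i < n \<Longrightarrow> smooth_map_on A W (a i)"
    and ker: "\<And>p x j. p \<in> W \<Longrightarrow> (\<And>i. i < n \<Longrightarrow> (\<Sum>j<n. G i j p * x j) = 0) \<Longrightarrow> j < n \<Longrightarrow> x j = 0"
  obtains y where "\<And>j. j < n \<Longrightarrow> smooth_map_on A W (y j)"
    and "\<And>p i. p \<in> W \<Longrightarrow> i < n \<Longrightarrow> (\<Sum>j<n. G i j p * y j p) = a i p"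
proof
  let ?N = "\<lambda>p. Matrix.mat n n (\<lambda>(i, j). G i j p)"
  let ?y = "\<lambda>j p. inverse (Determinant.det (?N p)) * (\<Sum>k<n. cofactor (?N p) k j * a k p)"
  have "Determinant.det (?N p) \<noteq> 0" if "p \<in> W" for p
    by (rule Cramer_solution(1)) (use ker[OF that] in blast)
  then show "smooth_map_on A W (?y j)" for j
    by (intro smooth_map_on_mult smooth_map_on_inverse smooth_map_on_sum smooth_map_on_det
        smooth_map_on_cofactor assms(1-3)) auto
  show "(\<Sum>j<n. G i j p * ?y j p) = a i p" if "p \<in> W" "i < n" for p i
    by (rule Cramer_solution(2)[OF _ that(2)]) (use ker[OF that(1)] in blast)
qed

text \<open>In a chart, \<open>flat_exp 0\<close> of \<open>r\<close> squared minus the squared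
  distance to the centre is positive at the centre and zero outside the ball. It extends by zero
  because the preimage of the ball is closed in the whole manifold.\<close>

lemma bump_function:
  assumes "open W" "p \<in> W"
  obtains h K where "h p > (0::real)" "closed K" "K \<subseteq> W" "\<And>q. q \<notin> K \<Longrightarrow> h q = 0"
    "smooth_map_on A UNIV h"
proof -
  obtain U \<phi> where c: "(U, \<phi>) \<in> A" "p \<in> U"
  proof -
    have "p \<in> \<Union> (fst ` A)" by (simp add: charts_cover)
    then show ?thesis using that by auto
  qed
  have "open (\<phi> ` (U \<inter> W))" "\<phi> p \<in> \<phi> ` (U \<inter> W)"
    using c assms by (auto intro: open_chart_image_Int)
  then obtain r where r: "r > 0" "cball (\<phi> p) r \<subseteq> \<phi> ` (U \<inter> W)"
    using open_contains_cball by blast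
  define K where "K = inv_into U \<phi> ` cball (\<phi> p) r"
  have "continuous_on (\<phi> ` U) (inv_into U \<phi>)"
    using chart_homeomorphism[OF c(1)] by (auto simp: homeomorphism_def)
  then have "continuous_on (cball (\<phi> p) r) (inv_into U \<phi>)"
    by (rule continuous_on_subset) (use r in blast)
  then have "compact K"
    unfolding K_def
    using compact_cball_finite_dimensional[OF finite_dim_model] by (rule compact_continuous_image)
  \<comment> \<open>Here the Hausdorff property of the manifold enters.\<close>
  then have K: "closed K" by (rule compact_imp_closed)
  have "K \<subseteq> U \<inter> W"
    unfolding K_def
  proof
    fix q assume "q \<in> inv_into U \<phi> ` cball (\<phi> p) r"
    then obtain q' where "q' \<in> U \<inter> W" "q = inv_into U \<phi> (\<phi> q')"
      using r(2) by blast
    with inv_into_chart[OF c(1)] show "q \<in> U \<inter> W" by simp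
  qed
  define h where "h q = (if q \<in> U then flat_exp 0 (r\<^sup>2 - (\<phi> q - \<phi> p) \<bullet> (\<phi> q - \<phi> p)) else 0)" for q
  have h0: "h q = 0" if "q \<notin> K" for q
  proof (cases "q \<in> U")
    case True
    have "\<phi> q \<notin> cball (\<phi> p) r"
      using that inv_into_chart[OF c(1) True] by (force simp: K_def)
    then have "r < norm (\<phi> q - \<phi> p)"
      by (simp add: dist_norm norm_minus_commute)
    then have "r\<^sup>2 \<le> (norm (\<phi> q - \<phi> p))\<^sup>2"
      using r(1) by (intro power_mono) auto
    then show ?thesis
      by (simp add: h_def flat_exp_def dot_square_norm)
  qed (simp add: h_def)
  have "smooth_map_on A U (\<lambda>q. flat_exp 0 (r\<^sup>2 - (\<phi> q - \<phi> p) \<bullet> (\<phi> q - \<phi> p)))"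
    by (intro smooth_map_on_flat_exp smooth_map_on_diff smooth_map_on_const smooth_map_on_inner
        smooth_map_on_chart chart_open[OF c(1)] c(1))
  then have U: "smooth_map_on A U h"
    by (rule smooth_map_on_cong[OF chart_open[OF c(1)]]) (simp add: h_def)
  have "open (- K)" using K by blast
  then have nK: "smooth_map_on A (- K) h"
    by (rule smooth_map_on_cong[OF _ smooth_map_on_const[of _ 0]]) (use h0 \<open>open (- K)\<close> in auto)
  \<comment> \<open>\<open>U\<close> and the complement of \<open>K\<close> form an open cover; on
    the latter \<open>h\<close> is constantly zero.\<close>
  have "smooth_map_on A UNIV h"
  proof (rule smooth_map_on_local)
    fix q
    show "\<exists>W'. open W' \<and> q \<in> W' \<and> smooth_map_on A W' h"
      using U nK \<open>open (- K)\<close> \<open>K \<subseteq> U \<inter> W\<close> chart_open[OF c(1)] by (cases "q \<in> K") blast+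
  qed
  moreover have "h p > 0"
    using c(2) r(1) by (simp add: h_def flat_exp_def)
  ultimately show ?thesis
    using that[of h K] K \<open>K \<subseteq> U \<inter> W\<close> h0 by blast
qed

lemma subspace_C_inf: "subspace (C_inf A)"
  unfolding subspace_def C_inf_def
  by (auto simp: zero_fun_def plus_fun_def scaleR_fun_def
      intro!: smooth_map_on_const smooth_map_on_add smooth_map_on_mult)

end


section \<open>Sections of vector bundles\<close>

context smooth_vector_bundle
begin

lemma triv_at:
  obtains U F where "(U, F) \<in> T" "p \<in> U"
proof -
  have "p \<in> \<Union> (fst ` T)" by (simp add: triv_cover)
  then show ?thesis using that by auto
qed

text \<open>Linearity of a fibre is inherited from the model fibre, of which it is a linear image
  under a trivialisation.\<close>

lemma subspace_fibre: "subspace (E p)"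
proof -
  obtain U F where "(U, F) \<in> T" "p \<in> U" by (rule triv_at)
  then show ?thesis
    using linear_subspace_image[OF triv_linear subspace_UNIV, of U F p] triv_range by metis
qed

lemma inv_triv: "(U, F) \<in> T \<Longrightarrow> p \<in> U \<Longrightarrow> inv_into UNIV (F p) (F p v) = v"
  using triv_inj by (simp add: inv_f_f)

lemma triv_in_fibre: "(U, F) \<in> T \<Longrightarrow> p \<in> U \<Longrightarrow> F p v \<in> E p"
  using triv_range by blast

lemma fibre_cases:
  assumes "(U, F) \<in> T" "p \<in> U" "e \<in> E p"
  obtains v where "e = F p v"
  using assms triv_range by blast

text \<open>Outside the range of \<open>F p\<close> the inverse takes unspecified values, so
  additivity can hold only on the fibre.\<close>

lemma inv_triv_add:
  assumes "(U, F) \<in> T" "p \<in> U" "e \<in> E p" "e' \<in> E p"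
  shows "inv_into UNIV (F p) (e + e') = inv_into UNIV (F p) e + inv_into UNIV (F p) e'"
proof -
  obtain v v' where "e = F p v" "e' = F p v'"
    using assms fibre_cases by metis
  then show ?thesis
    using assms(1,2) by (simp add: inv_triv flip: linear_add[OF triv_linear])
qed

lemma inv_triv_scale:
  assumes "(U, F) \<in> T" "p \<in> U" "e \<in> E p"
  shows "inv_into UNIV (F p) (c *\<^sub>R e) = c *\<^sub>R inv_into UNIV (F p) e"
proof -
  obtain v where "e = F p v"
    using assms by (rule fibre_cases)
  then show ?thesis
    using assms(1,2) by (simp add: inv_triv flip: linear_scale[OF triv_linear])
qed

lemma inv_triv_zero: "(U, F) \<in> T \<Longrightarrow> p \<in> U \<Longrightarrow> inv_into UNIV (F p) 0 = 0"
  by (metis inv_triv linear_0 triv_linear)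

lemma sections_iff:
  "X \<in> sections A E T \<longleftrightarrow>
    (\<forall>p. X p \<in> E p) \<and> (\<forall>U F. (U, F) \<in> T \<longrightarrow> smooth_map_on A U (\<lambda>p. inv_into UNIV (F p) (X p)))"
  by (auto simp: sections_def smooth_section_on_def)

text \<open>Seen through another trivialisation, these are the transition functions applied to a
  fixed vector.\<close>

lemma smooth_section_on_frame: "(U, F) \<in> T \<Longrightarrow> smooth_section_on A E T U (\<lambda>p. F p v)"
  using triv_transition_smooth[of U F _ _ v]
  by (fastforce simp: smooth_section_on_def triv_in_fibre Int_commute)

lemma section_in_fibre: "X \<in> sections A E T \<Longrightarrow> X p \<in> E p"
  by (simp add: sections_iff)

lemma fscale_section:
  assumes "f \<in> C_inf A" "X \<in> sections A E T"
  shows "fscale f X \<in> sections A E T"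
  unfolding sections_iff
proof (intro conjI allI impI)
  show "fscale f X p \<in> E p" for p
    using assms(2) by (simp add: fscale_def sections_iff subspace_scale[OF subspace_fibre])
  fix U F assume UF: "(U, F) \<in> T"
  have "smooth_map_on A U (\<lambda>p. f p *\<^sub>R inv_into UNIV (F p) (X p))"
  proof (rule smooth_map_on_scaleR[OF triv_open[OF UF]])
    show "smooth_map_on A U f"
      by (rule smooth_map_on_subset[of UNIV]) (use assms(1) in \<open>auto simp: C_inf_def\<close>)
    show "smooth_map_on A U (\<lambda>p. inv_into UNIV (F p) (X p))"
      using assms(2) UF by (auto simp: sections_iff)
  qed
  then show "smooth_map_on A U (\<lambda>p. inv_into UNIV (F p) (fscale f X p))"
    by (rule smooth_map_on_cong[OF triv_open[OF UF]])
      (use UF assms in \<open>auto simp: fscale_def sections_iff inv_triv_scale\<close>)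
qed

lemma subspace_sections: "subspace (sections A E T)"
  unfolding subspace_def
proof (intro conjI ballI allI)
  show "0 \<in> sections A E T"
    unfolding sections_iff
  proof (intro conjI allI impI)
    show "0 p \<in> E p" for p by (simp add: subspace_0[OF subspace_fibre])
    fix U F assume UF: "(U, F) \<in> T"
    show "smooth_map_on A U (\<lambda>p. inv_into UNIV (F p) (0 p))"
      by (rule smooth_map_on_cong[OF triv_open[OF UF] smooth_map_on_const[OF triv_open[OF UF], of 0]])
        (simp add: inv_triv_zero[OF UF])
  qed
  show "X + Y \<in> sections A E T" if X: "X \<in> sections A E T" and Y: "Y \<in> sections A E T" for X Y
    unfolding sections_iff
  proof (intro conjI allI impI)
    show "(X + Y) p \<in> E p" for p
      using X Y by (simp add: sections_iff subspace_add[OF subspace_fibre])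
    fix U F assume UF: "(U, F) \<in> T"
    have "smooth_map_on A U (\<lambda>p. inv_into UNIV (F p) (X p) + inv_into UNIV (F p) (Y p))"
      using X Y UF by (intro smooth_map_on_add triv_open[OF UF]) (auto simp: sections_iff)
    then show "smooth_map_on A U (\<lambda>p. inv_into UNIV (F p) ((X + Y) p))"
      by (rule smooth_map_on_cong[OF triv_open[OF UF]])
        (use UF X Y in \<open>auto simp: sections_iff inv_triv_add\<close>)
  qed
  show "c *\<^sub>R X \<in> sections A E T" if X: "X \<in> sections A E T" for c X
  proof -
    have "c *\<^sub>R X = fscale (\<lambda>_. c) X" by (simp add: fscale_def scaleR_fun_def)
    then show ?thesis
      using fscale_section[of "\<lambda>_. c" X] X by (simp add: C_inf_def smooth_map_on_const)
  qed
qed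

text \<open>A local frame section is multiplied by a bump function and extended by zero. The bump
  function is not normalised, so \<open>e\<close> is met only up to a positive factor, which is
  enough for testing linear identities.\<close>

lemma section_through:
  assumes "e \<in> E p"
  obtains Z c where "Z \<in> sections A E T" "c > 0" "Z p = c *\<^sub>R e"
proof -
  obtain U F where UF: "(U, F) \<in> T" "p \<in> U" by (rule triv_at)
  obtain v where v: "e = F p v" using UF assms by (rule fibre_cases)
  obtain h K where h: "h p > (0::real)" "closed K" "K \<subseteq> U" "\<And>q. q \<notin> K \<Longrightarrow> h q = 0"
    "smooth_map_on A UNIV h"
    by (rule bump_function[OF triv_open[OF UF(1)] UF(2)]) blast
  define Z where "Z q = (if q \<in> U then h q *\<^sub>R F q v else 0)" for q
  have ZE: "Z q \<in> E q" for q
    using UF(1)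
    by (auto simp: Z_def subspace_0[OF subspace_fibre] triv_in_fibre
        intro: subspace_scale[OF subspace_fibre])
  have "Z \<in> sections A E T"
    unfolding sections_iff
  proof (intro conjI allI impI ZE)
    fix V G assume VG: "(V, G) \<in> T"
    show "smooth_map_on A V (\<lambda>q. inv_into UNIV (G q) (Z q))"
    proof (rule smooth_map_on_local)
      fix q assume q: "q \<in> V"
      show "\<exists>W'. open W' \<and> q \<in> W' \<and> smooth_map_on A W' (\<lambda>q. inv_into UNIV (G q) (Z q))"
      \<comment> \<open>Near a point of \<open>K\<close> the defining formula over \<open>U\<close>
        applies; near any other point \<open>Z\<close> is identically zero.\<close>
      proof (cases "q \<in> K")
        case True
        have op: "open (U \<inter> V)" using triv_open UF(1) VG by blast
        have "smooth_map_on A (U \<inter> V) (\<lambda>q. h q *\<^sub>R inv_into UNIV (G q) (F q v))"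
          by (rule smooth_map_on_scaleR[OF op smooth_map_on_subset[OF h(5) subset_UNIV]
                triv_transition_smooth[OF UF(1) VG]])
        then have "smooth_map_on A (U \<inter> V) (\<lambda>q. inv_into UNIV (G q) (Z q))"
          by (rule smooth_map_on_cong[OF op])
            (use UF(1) VG in \<open>auto simp: Z_def inv_triv_scale triv_in_fibre\<close>)
        with op True q h(3) show ?thesis by blast
      next
        case False
        have op: "open (V - K)" using triv_open[OF VG] h(2) by (rule open_Diff)
        have "smooth_map_on A (V - K) (\<lambda>q. inv_into UNIV (G q) (Z q))"
          by (rule smooth_map_on_cong[OF op smooth_map_on_const[OF op, of 0]])
            (use VG h(4) in \<open>auto simp: Z_def inv_triv_zero\<close>)
        with op False q show ?thesis by blast
      qed
    qed
  qed
  moreover have "Z p = h p *\<^sub>R e" using UF(2) by (simp add: Z_def v)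
  ultimately show ?thesis using h(1) that by blast
qed

end

lemma scaleR_fun_apply: "(c *\<^sub>R f) x = c *\<^sub>R f x"
  by (simp add: scaleR_fun_def)


section \<open>Courant algebroids\<close>

context courant_algebroid
begin

section \<open>Existence and smoothness of \<open>courant_D\<close>\<close>

lemma pairing_scale_right: "x \<in> E p \<Longrightarrow> z \<in> E p \<Longrightarrow> g p z (c *\<^sub>R x) = c * g p z x"
  by (metis pairing_scale pairing_sym subspace_scale subspace_fibre)

lemma pairing_frame_sum:
  assumes "(U, F) \<in> T" "p \<in> U" "e \<in> E p"
  shows "g p (F p (\<Sum>j<n. x j *\<^sub>R b j)) e = (\<Sum>j<n. x j * g p (F p (b j)) e)"
proof -
  have "linear (\<lambda>v. g p (F p v) e)"
    using assms
    by (intro linearI)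
      (simp_all add: linear_add[OF triv_linear] linear_scale[OF triv_linear] triv_in_fibre
        pairing_add pairing_scale)
  then show ?thesis by (simp add: Real_Vector_Spaces.linear_sum[of "\<lambda>v. g p (F p v) e"]
        Real_Vector_Spaces.linear_scale[of "\<lambda>v. g p (F p v) e"])
qed

lemma anchor_frame_sum:
  assumes "(U, F) \<in> T" "p \<in> U"
  shows "rho p (F p (\<Sum>j<n. x j *\<^sub>R b j)) f = (\<Sum>j<n. x j * rho p (F p (b j)) f)"
proof -
  have "linear (\<lambda>v. rho p (F p v) f)"
    using assms
    by (intro linearI)
      (simp_all add: linear_add[OF triv_linear] linear_scale[OF triv_linear] triv_in_fibre
        anchor_add anchor_scale scaleR_fun_def)
  then show ?thesis by (simp add: Real_Vector_Spaces.linear_sum[of "\<lambda>v. rho p (F p v) f"]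
        Real_Vector_Spaces.linear_scale[of "\<lambda>v. rho p (F p v) f"])
qed

text \<open>Locally, \<open>\<D> f\<close> is the solution of a linear system with smooth coefficients, hence smooth by
  Cramer's rule.\<close>

lemma courant_D_local:
  assumes f: "f \<in> C_inf A" and UF: "(U, F) \<in> T"
  obtains y where "smooth_map_on A U y"
    and "\<And>p e. p \<in> U \<Longrightarrow> e \<in> E p \<Longrightarrow> g p (F p (y p)) e = rho p e f"
proof -
  have op: "open U" using UF by (rule triv_open)
  obtain n and b :: "nat \<Rightarrow> 'v" where b: "\<And>v. \<exists>c. v = (\<Sum>i<n. c i *\<^sub>R b i)"
    "\<And>c i. (\<Sum>i<n. c i *\<^sub>R b i) = 0 \<Longrightarrow> i < n \<Longrightarrow> c i = 0"
    by (rule finite_dimensional_basis[OF finite_dim_fibre]) blast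
  \<comment> \<open>By linearity, \<open>w\<close> represents the functional \<open>a\<close> as
    soon as it does so on the frame. This serves twice: with \<open>a = 0\<close> for the kernel of
    the system and with the anchor for its solution.\<close>
  have ext: "g p w e = a e"
    if p: "p \<in> U" and w: "w \<in> E p" and e: "e \<in> E p"
      and eq: "\<And>i. i < n \<Longrightarrow> g p w (F p (b i)) = a (F p (b i))"
      and lin: "\<And>x. a (F p (\<Sum>j<n. x j *\<^sub>R b j)) = (\<Sum>j<n. x j * a (F p (b j)))"
    for p w e a
  proof -
    obtain v where "e = F p v" using UF p e by (rule fibre_cases)
    moreover obtain c where "v = (\<Sum>i<n. c i *\<^sub>R b i)" using b(1) by blast
    ultimately have e': "e = F p (\<Sum>i<n. c i *\<^sub>R b i)" by simp
    have "g p w e = g p e w" using w e by (rule pairing_sym)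
    also have "\<dots> = (\<Sum>j<n. c j * g p (F p (b j)) w)"
      unfolding e' by (rule pairing_frame_sum[OF UF p w])
    also have "\<dots> = (\<Sum>j<n. c j * a (F p (b j)))"
      using eq pairing_sym[OF w triv_in_fibre[OF UF p]] by (intro sum.cong) auto
    also have "\<dots> = a e" unfolding e' by (rule lin[symmetric])
    finally show ?thesis .
  qed
  obtain y where y: "\<And>j. j < n \<Longrightarrow> smooth_map_on A U (y j)"
    "\<And>p i. p \<in> U \<Longrightarrow> i < n \<Longrightarrow> (\<Sum>j<n. g p (F p (b j)) (F p (b i)) * y j p) = rho p (F p (b i)) f"
  \<comment> \<open>The coefficients are the Gram matrix of the pairing in the local frame, the
    unknowns are the coordinates of \<open>\<D> f\<close>. The kernel is trivial because the pairing
    is nondegenerate.\<close>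
  proof (rule smooth_linear_system[OF op, where n = n
        and G = "\<lambda>i j p. g p (F p (b j)) (F p (b i))" and a = "\<lambda>i p. rho p (F p (b i)) f"])
    show "smooth_map_on A U (\<lambda>p. g p (F p (b j)) (F p (b i)))" for i j
      using pairing_smooth[OF op smooth_section_on_frame[OF UF, of "b j"]
          smooth_section_on_frame[OF UF, of "b i"]]
      by (simp add: pair_def)
    show "smooth_map_on A U (\<lambda>p. rho p (F p (b i)) f)" for i
      using anchor_smooth[OF op smooth_section_on_frame[OF UF, of "b i"]] f
      by (simp add: smooth_vector_field_on_def anchored_def)
    show "x j = 0"
      if p: "p \<in> U" and x: "\<And>i. i < n \<Longrightarrow> (\<Sum>j<n. g p (F p (b j)) (F p (b i)) * x j) = 0"
        and j: "j < n" for p x j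
    proof -
      let ?w = "F p (\<Sum>j<n. x j *\<^sub>R b j)"
      have "g p ?w (F p (b i)) = 0" if "i < n" for i
        using x[OF that] by (simp add: pairing_frame_sum[OF UF p triv_in_fibre[OF UF p]] mult.commute)
      then have "g p ?w e = 0" if "e \<in> E p" for e
        using ext[OF p triv_in_fibre[OF UF p] that, of _ "\<lambda>_. 0"] by simp
      then have "?w = 0"
        using triv_in_fibre[OF UF p] pairing_nondegenerate by blast
      then have "(\<Sum>j<n. x j *\<^sub>R b j) = 0"
        using inv_triv[OF UF p] inv_triv_zero[OF UF p] by metis
      then show "x j = 0" using b(2) j by blast
    qed
  qed blast
  show ?thesis
  proof
    show "smooth_map_on A U (\<lambda>p. \<Sum>j<n. y j p *\<^sub>R b j)"
      by (rule smooth_map_on_sum[OF op])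
        (auto intro: smooth_map_on_scaleR[OF op y(1) smooth_map_on_const[OF op]])
    show "g p (F p (\<Sum>j<n. y j p *\<^sub>R b j)) e = rho p e f" if p: "p \<in> U" and e: "e \<in> E p" for p e
    proof (rule ext[OF p triv_in_fibre[OF UF p] e])
      show "rho p (F p (\<Sum>j<n. x j *\<^sub>R b j)) f = (\<Sum>j<n. x j * rho p (F p (b j)) f)" for x
        by (rule anchor_frame_sum[OF UF p])
      show "g p (F p (\<Sum>j<n. y j p *\<^sub>R b j)) (F p (b i)) = rho p (F p (b i)) f" if "i < n" for i
        using y(2)[OF p that]
        by (simp add: pairing_frame_sum[OF UF p triv_in_fibre[OF UF p]] mult.commute)
    qed
  qed
qed

lemma pairing_eqI:
  assumes "x \<in> E p" "y \<in> E p" "\<And>e. e \<in> E p \<Longrightarrow> g p x e = g p y e"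
  shows "x = y"
proof -
  have m: "- y = (-1) *\<^sub>R y" by simp
  have "- y \<in> E p" unfolding m using assms(2) by (rule subspace_scale[OF subspace_fibre])
  moreover have "g p (- y) e = - g p y e" if "e \<in> E p" for e
    unfolding m using assms(2) that by (simp only: pairing_scale)
  ultimately have "g p (x + - y) e = 0" if "e \<in> E p" for e
    using assms that by (simp add: pairing_add del: add_uminus_conv_diff)
  then have "x + - y = 0"
    using subspace_add[OF subspace_fibre assms(1) \<open>- y \<in> E p\<close>] by (rule pairing_nondegenerate[rotated])
  then show ?thesis by simp
qed

text \<open>Nondegeneracy makes the description in \<open>sharp\<close> unique, so any vector
  representing the functional identifies \<open>courant_D\<close>.\<close>

lemma courant_D_eqI:
  assumes "e \<in> E p" "\<And>v. v \<in> E p \<Longrightarrow> g p e v = rho p v f"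
  shows "courant_D E g rho f p = e"
  unfolding courant_D_def sharp_def dual_anchor_def differential_def
  by (rule the_equality) (use assms pairing_eqI in auto)

text \<open>The local solution of the linear system supplies the existence part of the definite
  description.\<close>

lemma courant_D:
  assumes "f \<in> C_inf A"
  shows courant_D_in_fibre: "courant_D E g rho f p \<in> E p"
    and pairing_courant_D: "e \<in> E p \<Longrightarrow> g p (courant_D E g rho f p) e = rho p e f"
proof -
  obtain U F where UF: "(U, F) \<in> T" "p \<in> U" by (rule triv_at)
  obtain y where y: "\<And>p e. p \<in> U \<Longrightarrow> e \<in> E p \<Longrightarrow> g p (F p (y p)) e = rho p e f"
    using courant_D_local[OF assms UF(1)] by metis
  have "courant_D E g rho f p = F p (y p)"
    by (rule courant_D_eqI) (use UF y in \<open>auto simp: triv_in_fibre\<close>)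
  with UF y show "courant_D E g rho f p \<in> E p"
    "e \<in> E p \<Longrightarrow> g p (courant_D E g rho f p) e = rho p e f"
    by (auto simp: triv_in_fibre)
qed

lemma courant_D_section:
  assumes "f \<in> C_inf A"
  shows "courant_D E g rho f \<in> sections A E T"
  unfolding sections_iff
proof (intro conjI allI impI courant_D_in_fibre[OF assms])
  fix U F assume UF: "(U, F) \<in> T"
  obtain y where y: "smooth_map_on A U y"
    "\<And>p e. p \<in> U \<Longrightarrow> e \<in> E p \<Longrightarrow> g p (F p (y p)) e = rho p e f"
    by (rule courant_D_local[OF assms UF]) blast
  have "inv_into UNIV (F p) (courant_D E g rho f p) = y p" if "p \<in> U" for p
  proof -
    have "courant_D E g rho f p = F p (y p)"
      by (rule courant_D_eqI) (use UF that y in \<open>auto simp: triv_in_fibre\<close>)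
    then show ?thesis by (simp add: inv_triv[OF UF that])
  qed
  then show "smooth_map_on A U (\<lambda>p. inv_into UNIV (F p) (courant_D E g rho f p))"
    using smooth_map_on_cong[OF triv_open[OF UF] y(1)] by simp
qed

section \<open>Linear calculus of functions and global sections\<close>

abbreviation "\<Gamma> \<equiv> sections A E T"
abbreviation "\<D> \<equiv> courant_D E g rho"
abbreviation "\<S> \<equiv> skew_bracket E g br rho"

lemma pair_closed: "X \<in> \<Gamma> \<Longrightarrow> Y \<in> \<Gamma> \<Longrightarrow> pair g X Y \<in> C_inf A"
  using pairing_smooth[of UNIV X Y] by (simp add: sections_def C_inf_def)

lemma act_closed: "X \<in> \<Gamma> \<Longrightarrow> f \<in> C_inf A \<Longrightarrow> act rho X f \<in> C_inf A"
  using anchor_smooth[of UNIV X]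
  by (simp add: sections_def C_inf_def smooth_vector_field_on_def act_def)

lemmas section_add = subspace_add[OF subspace_sections]
lemmas section_diff = subspace_diff[OF subspace_sections]
lemmas section_scale = subspace_scale[OF subspace_sections]
lemmas section_zero = subspace_0[OF subspace_sections]
lemmas C_inf_add = subspace_add[OF subspace_C_inf]
lemmas C_inf_diff = subspace_diff[OF subspace_C_inf]
lemmas C_inf_scale = subspace_scale[OF subspace_C_inf]
lemmas C_inf_zero = subspace_0[OF subspace_C_inf]

lemma skew_bracket_closed: "X \<in> \<Gamma> \<Longrightarrow> Y \<in> \<Gamma> \<Longrightarrow> \<S> X Y \<in> \<Gamma>"
  unfolding skew_bracket_def
  by (intro section_diff section_scale bracket_section courant_D_section pair_closed)

lemmas closure_rules = pair_closed act_closed section_add section_diff section_scale section_zero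
  C_inf_add C_inf_diff C_inf_scale C_inf_zero skew_bracket_closed courant_D_section bracket_section

lemma pair_commute: "X \<in> \<Gamma> \<Longrightarrow> Y \<in> \<Gamma> \<Longrightarrow> pair g X Y = pair g Y X"
  by (auto simp: pair_def fun_eq_iff section_in_fibre intro: pairing_sym)

lemma pair_add_left:
  "X \<in> \<Gamma> \<Longrightarrow> Y \<in> \<Gamma> \<Longrightarrow> Z \<in> \<Gamma> \<Longrightarrow> pair g (X + Y) Z = pair g X Z + pair g Y Z"
  by (auto simp: pair_def fun_eq_iff section_in_fibre pairing_add)

lemma pair_scale_left:
  "X \<in> \<Gamma> \<Longrightarrow> Z \<in> \<Gamma> \<Longrightarrow> pair g (c *\<^sub>R X) Z = c *\<^sub>R pair g X Z"
  by (auto simp: pair_def fun_eq_iff section_in_fibre pairing_scale scaleR_fun_apply)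

lemma pair_diff_left:
  assumes "X \<in> \<Gamma>" "Y \<in> \<Gamma>" "Z \<in> \<Gamma>"
  shows "pair g (X - Y) Z = pair g X Z - pair g Y Z"
  using pair_add_left[of "X - Y" Y Z] assms by (simp add: section_diff)

lemma pair_add_right:
  "X \<in> \<Gamma> \<Longrightarrow> Y \<in> \<Gamma> \<Longrightarrow> Z \<in> \<Gamma> \<Longrightarrow> pair g Z (X + Y) = pair g Z X + pair g Z Y"
  by (simp add: pair_commute[of Z] pair_add_left section_add)

lemma pair_scale_right:
  "X \<in> \<Gamma> \<Longrightarrow> Z \<in> \<Gamma> \<Longrightarrow> pair g Z (c *\<^sub>R X) = c *\<^sub>R pair g Z X"
  by (simp add: pair_commute[of Z] pair_scale_left section_scale)

lemma pair_zero_left: "X \<in> \<Gamma> \<Longrightarrow> pair g 0 X = 0"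
  using pair_scale_left[of 0 X 0] by (simp add: section_zero)

lemma pair_zero_right: "X \<in> \<Gamma> \<Longrightarrow> pair g X 0 = 0"
  using pair_scale_right[of 0 X 0] by (simp add: section_zero)

text \<open>Every vector of a fibre is, up to a positive factor, the value of a global section, so
  global test sections detect pointwise equality.\<close>

lemma section_eqI:
  assumes "X \<in> \<Gamma>" "Y \<in> \<Gamma>" "\<And>Z. Z \<in> \<Gamma> \<Longrightarrow> pair g X Z = pair g Y Z"
  shows "X = Y"
proof
  fix p
  show "X p = Y p"
  proof (rule pairing_eqI)
    show "X p \<in> E p" "Y p \<in> E p" using assms by (simp_all add: section_in_fibre)
    fix e assume e: "e \<in> E p"
    obtain Z c where Z: "Z \<in> \<Gamma>" "c > 0" "Z p = c *\<^sub>R e"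
      using e by (rule section_through)
    have "pair g X Z p = pair g Y Z p" using assms(3)[OF Z(1)] by simp
    then have "g p (X p) (c *\<^sub>R e) = g p (Y p) (c *\<^sub>R e)"
      by (simp add: pair_def Z(3))
    then show "g p (X p) e = g p (Y p) e"
      using Z(2) e assms(1,2) by (simp add: pairing_scale_right section_in_fibre)
  qed
qed

lemma act_add_left:
  "X \<in> \<Gamma> \<Longrightarrow> Y \<in> \<Gamma> \<Longrightarrow> act rho (X + Y) f = act rho X f + act rho Y f"
  by (auto simp: act_def anchored_def fun_eq_iff section_in_fibre anchor_add)

lemma act_scale_left: "X \<in> \<Gamma> \<Longrightarrow> act rho (c *\<^sub>R X) f = c *\<^sub>R act rho X f"
  by (auto simp: act_def anchored_def fun_eq_iff section_in_fibre anchor_scale scaleR_fun_apply)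

lemma act_diff_left:
  "X \<in> \<Gamma> \<Longrightarrow> Y \<in> \<Gamma> \<Longrightarrow> act rho (X - Y) f = act rho X f - act rho Y f"
  using act_add_left[of "X - Y" Y f] by (simp add: section_diff)

lemma anchor_derivation:
  assumes "e \<in> E p" "f \<in> C_inf A" "h \<in> C_inf A"
  shows "rho p e (f + h) = rho p e f + rho p e h"
    and "rho p e (c *\<^sub>R f) = c * rho p e f"
  using anchor_tangent[OF assms(1)] assms(2,3) by (auto simp: tangent_space_def)

lemma act_add_right:
  "X \<in> \<Gamma> \<Longrightarrow> f \<in> C_inf A \<Longrightarrow> h \<in> C_inf A \<Longrightarrow> act rho X (f + h) = act rho X f + act rho X h"
  by (auto simp: act_def anchored_def fun_eq_iff section_in_fibre anchor_derivation(1))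

lemma act_scale_right:
  "X \<in> \<Gamma> \<Longrightarrow> f \<in> C_inf A \<Longrightarrow> act rho X (c *\<^sub>R f) = c *\<^sub>R act rho X f"
  by (auto simp: act_def anchored_def fun_eq_iff section_in_fibre anchor_derivation(2) scaleR_fun_apply)

lemma act_diff_right:
  "X \<in> \<Gamma> \<Longrightarrow> f \<in> C_inf A \<Longrightarrow> h \<in> C_inf A \<Longrightarrow> act rho X (f - h) = act rho X f - act rho X h"
  using act_add_right[of X "f - h" h] by (simp add: C_inf_diff)

lemma act_bracket:
  "X \<in> \<Gamma> \<Longrightarrow> Y \<in> \<Gamma> \<Longrightarrow> act rho (br X Y) f = act rho X (act rho Y f) - act rho Y (act rho X f)"
  by (auto simp: act_def anchor_bracket lie_bracket_def fun_eq_iff)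

lemma courant_D_add:
  "f \<in> C_inf A \<Longrightarrow> h \<in> C_inf A \<Longrightarrow> \<D> (f + h) = \<D> f + \<D> h"
  by (rule ext, rule courant_D_eqI)
    (auto simp: anchor_derivation(1) courant_D_in_fibre pairing_add pairing_courant_D
      intro: subspace_add[OF subspace_fibre])

lemma courant_D_scale: "f \<in> C_inf A \<Longrightarrow> \<D> (c *\<^sub>R f) = c *\<^sub>R \<D> f"
  by (rule ext, rule courant_D_eqI)
    (auto simp: anchor_derivation(2) courant_D_in_fibre pairing_scale pairing_courant_D
      scaleR_fun_apply intro: subspace_scale[OF subspace_fibre])

lemma courant_D_diff: "f \<in> C_inf A \<Longrightarrow> h \<in> C_inf A \<Longrightarrow> \<D> (f - h) = \<D> f - \<D> h"
  using courant_D_add[of "f - h" h] by (simp add: C_inf_diff)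

lemma courant_D_zero: "\<D> 0 = 0"
  using courant_D_scale[of 0 0] by (simp add: C_inf_zero)

lemma pair_courant_D_left: "f \<in> C_inf A \<Longrightarrow> X \<in> \<Gamma> \<Longrightarrow> pair g (\<D> f) X = act rho X f"
  by (auto simp: pair_def act_def anchored_def fun_eq_iff section_in_fibre pairing_courant_D)

lemma pair_courant_D_right: "f \<in> C_inf A \<Longrightarrow> X \<in> \<Gamma> \<Longrightarrow> pair g X (\<D> f) = act rho X f"
  by (simp add: pair_commute[of X] pair_courant_D_left courant_D_section)

lemma bracket_diff_left:
  "X \<in> \<Gamma> \<Longrightarrow> Y \<in> \<Gamma> \<Longrightarrow> Z \<in> \<Gamma> \<Longrightarrow> br (X - Y) Z = br X Z - br Y Z"
  using bracket_add_left[of "X - Y" Y Z] by (simp add: section_diff)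

lemma bracket_diff_right:
  "X \<in> \<Gamma> \<Longrightarrow> Y \<in> \<Gamma> \<Longrightarrow> Z \<in> \<Gamma> \<Longrightarrow> br Z (X - Y) = br Z X - br Z Y"
  using bracket_add_right[of Z "X - Y" Y] by (simp add: section_diff)

section \<open>Consequences of the Courant algebroid axioms\<close>

text \<open>Polarisation of \<open>bracket_self\<close>, applied to \<open>X + Y\<close>.\<close>

lemma bracket_swap:
  assumes X: "X \<in> \<Gamma>" and Y: "Y \<in> \<Gamma>"
  shows "br Y X = \<D> (pair g X Y) - br X Y"
proof -
  have "br (X + Y) (X + Y) = (1/2) *\<^sub>R \<D> (pair g X X + pair g Y Y + 2 *\<^sub>R pair g X Y)"
    using X Y
    by (simp add: bracket_self section_add pair_add_left pair_add_right pair_commute[of Y X]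
        scaleR_2 algebra_simps)
  also have "\<dots> = br X X + br Y Y + \<D> (pair g X Y)"
    using X Y by (simp add: courant_D_add courant_D_scale closure_rules bracket_self scaleR_add_right)
  finally have "br X X + br Y X + (br X Y + br Y Y) = br X X + br Y Y + \<D> (pair g X Y)"
    using X Y by (simp add: bracket_add_left bracket_add_right section_add)
  then show ?thesis by (simp add: algebra_simps)
qed

text \<open>Paired with \<open>Z\<close>, invariance turns the left-hand side into
  \<open>X (Z f) - [X, Z] f\<close>. As the anchor preserves brackets, this is
  \<open>Z (X f)\<close>, the pairing of the right-hand side with \<open>Z\<close>.\<close>

lemma bracket_courant_D:
  assumes X: "X \<in> \<Gamma>" and f: "f \<in> C_inf A"
  shows "br X (\<D> f) = \<D> (act rho X f)"
proof (rule section_eqI)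
  show "br X (\<D> f) \<in> \<Gamma>" "\<D> (act rho X f) \<in> \<Gamma>"
    using X f by (auto intro: closure_rules)
  fix Z assume Z: "Z \<in> \<Gamma>"
  have "act rho X (pair g (\<D> f) Z) = pair g (br X (\<D> f)) Z + pair g (\<D> f) (br X Z)"
    using X f Z by (intro pairing_invariant closure_rules)
  then show "pair g (br X (\<D> f)) Z = pair g (\<D> (act rho X f)) Z"
    using X f Z by (simp add: pair_courant_D_left act_bracket closure_rules algebra_simps)
qed

text \<open>Exchanging the arguments of \<open>br X (\<D> f)\<close> produces the symmetric term
  \<open>\<D> (act rho X f)\<close>, which is exactly that bracket and cancels it.\<close>

lemma courant_D_bracket:
  assumes X: "X \<in> \<Gamma>" and f: "f \<in> C_inf A"
  shows "br (\<D> f) X = 0"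
  using assms
  by (simp add: bracket_swap[of X "\<D> f"] bracket_courant_D pair_courant_D_right closure_rules)

text \<open>Brackets with \<open>\<D> f\<close> on the left vanish, so the Leibniz rule for
  \<open>h\<close> times \<open>\<D> f\<close> leaves \<open>act rho (\<D> f) h\<close> times
  \<open>\<D> f\<close> equal to zero. Pointwise one factor vanishes, and where
  \<open>\<D> f\<close> vanishes so does its anchor.\<close>

lemma act_courant_D:
  assumes f: "f \<in> C_inf A" and h: "h \<in> C_inf A"
  shows "act rho (\<D> f) h = 0"
proof
  fix p
  have "br (\<D> f) (fscale h (\<D> f)) = fscale h (br (\<D> f) (\<D> f)) + fscale (act rho (\<D> f) h) (\<D> f)"
    using assms by (intro bracket_leibniz closure_rules)
  moreover have "br (\<D> f) (fscale h (\<D> f)) = 0" "br (\<D> f) (\<D> f) = 0"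
    using assms by (simp_all add: courant_D_bracket closure_rules fscale_section)
  moreover have "fscale h 0 = (0 :: 'm \<Rightarrow> 'e)"
    by (simp add: fscale_def zero_fun_def)
  ultimately have "fscale (act rho (\<D> f) h) (\<D> f) p = 0"
    by simp
  then have "act rho (\<D> f) h p = 0 \<or> \<D> f p = 0"
    by (simp add: fscale_def)
  moreover have "act rho (\<D> f) h p = 0" if "\<D> f p = 0"
    using that anchor_scale[of 0 p 0]
    by (simp add: act_def anchored_def subspace_0[OF subspace_fibre])
  ultimately show "act rho (\<D> f) h p = 0 p" by auto
qed

lemma skew_bracket_swap: "X \<in> \<Gamma> \<Longrightarrow> Y \<in> \<Gamma> \<Longrightarrow> \<S> Y X = - \<S> X Y"
  using scaleR_left_diff_distrib[of 1 "1/2" "\<D> (pair g X Y)"]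
  by (simp add: skew_bracket_def bracket_swap[of X Y] pair_commute[of Y X])

lemma skew_bracket_courant_D:
  assumes X: "X \<in> \<Gamma>" and f: "f \<in> C_inf A"
  shows "\<S> (\<D> f) X = - (1/2) *\<^sub>R \<D> (act rho X f)"
  using assms by (simp add: skew_bracket_def courant_D_bracket pair_courant_D_left)

lemma skew_bracket_add_left:
  "X \<in> \<Gamma> \<Longrightarrow> Y \<in> \<Gamma> \<Longrightarrow> Z \<in> \<Gamma> \<Longrightarrow> \<S> (X + Y) Z = \<S> X Z + \<S> Y Z"
  by (simp add: skew_bracket_def bracket_add_left pair_add_left courant_D_add closure_rules algebra_simps)

lemma skew_bracket_scale_left: "X \<in> \<Gamma> \<Longrightarrow> Z \<in> \<Gamma> \<Longrightarrow> \<S> (c *\<^sub>R X) Z = c *\<^sub>R \<S> X Z"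
  by (simp add: skew_bracket_def bracket_scale_left pair_scale_left courant_D_scale closure_rules
      algebra_simps)

lemma act_skew_bracket:
  "X \<in> \<Gamma> \<Longrightarrow> Y \<in> \<Gamma> \<Longrightarrow> f \<in> C_inf A
    \<Longrightarrow> act rho (\<S> X Y) f = act rho X (act rho Y f) - act rho Y (act rho X f)"
  by (simp add: skew_bracket_def act_diff_left act_scale_left act_courant_D act_bracket closure_rules)

lemma pair_skew_bracket:
  assumes "X \<in> \<Gamma>" "Y \<in> \<Gamma>" "Z \<in> \<Gamma>"
  shows "pair g (\<S> X Y) Z = pair g (br X Y) Z - (1/2) *\<^sub>R act rho Z (pair g X Y)"
  using assms
  by (simp add: skew_bracket_def pair_diff_left pair_scale_left pair_courant_D_left closure_rules)

text \<open>On sections, \<open>l_3\<close> is \<open>-1/6\<close> times this function.\<close>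

abbreviation "cyc X Y Z \<equiv> pair g (\<S> X Y) Z + pair g (\<S> Y Z) X + pair g (\<S> Z X) Y"

text \<open>The first equation exchanges the arguments of the bracket, the second exchanges
  \<open>Y\<close> with \<open>Z\<close> by invariance. Together they reduce all six arrangements to
  \<open>pair g (br X Y) Z\<close> and derivatives of pairings.\<close>

lemma pair_bracket_swap:
  assumes "X \<in> \<Gamma>" "Y \<in> \<Gamma>" "Z \<in> \<Gamma>"
  shows "pair g (br Y X) Z = act rho Z (pair g X Y) - pair g (br X Y) Z"
    and "pair g (br X Z) Y = act rho X (pair g Y Z) - pair g (br X Y) Z"
  using assms pairing_invariant[of X Y Z]
  by (simp_all add: bracket_swap[of X Y] pair_diff_left pair_courant_D_left closure_rules
      pair_commute[of Y "br X Z"])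

text \<open>Each of the three cyclic terms contributes one copy of \<open>pair g (br X Y) Z\<close>,
  whence the factor 3; the derivatives collected on the way give the rest.\<close>

lemma cyc_pair_bracket:
  assumes "X \<in> \<Gamma>" "Y \<in> \<Gamma>" "Z \<in> \<Gamma>"
  shows "cyc X Y Z = 3 *\<^sub>R pair g (br X Y) Z
    + (3/2) *\<^sub>R (act rho Y (pair g X Z) - act rho Z (pair g X Y) - act rho X (pair g Y Z))"
proof
  fix p
  have a: "pair g (br Y Z) X = act rho Y (pair g X Z) - pair g (br Y X) Z"
    using pair_bracket_swap(2)[of Y X Z] assms by simp
  have b: "pair g (br Z X) Y = act rho Y (pair g X Z) - pair g (br X Z) Y"
    using pair_bracket_swap(1)[of X Z Y] assms by simp
  show "cyc X Y Z p = (3 *\<^sub>R pair g (br X Y) Z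
    + (3/2) *\<^sub>R (act rho Y (pair g X Z) - act rho Z (pair g X Y) - act rho X (pair g Y Z))) p"
    using assms
    by (simp add: pair_skew_bracket a b pair_bracket_swap[of X Y Z] scaleR_fun_apply
        pair_commute[of Z X] field_simps)
qed

text \<open>The term \<open>- (3/2) *\<^sub>R act rho Z (pair g X Y)\<close> is absorbed by passing
  from \<open>br\<close> to \<open>\<S>\<close>.\<close>

lemma cyc_eq:
  assumes "X \<in> \<Gamma>" "Y \<in> \<Gamma>" "Z \<in> \<Gamma>"
  shows "cyc X Y Z = 3 *\<^sub>R pair g (\<S> X Y) Z
    + (3/2) *\<^sub>R (act rho Y (pair g X Z) - act rho X (pair g Y Z))"
  unfolding cyc_pair_bracket[OF assms]
  unfolding pair_skew_bracket[OF assms]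
  by (simp add: algebra_simps)

text \<open>Swapping the outer brackets of the second and third summand, and the inner one of the
  third, produces the terms of the Jacobi identity, which cancel. Only values of \<open>\<D>\<close>
  survive.\<close>

lemma bracket_cyclic_sum:
  assumes XYZ: "X \<in> \<Gamma>" "Y \<in> \<Gamma>" "Z \<in> \<Gamma>"
  shows "br (br X Y) Z + br (br Y Z) X + br (br Z X) Y = (2/3) *\<^sub>R \<D> (cyc X Y Z)"
proof -
  have "br (br Y Z) X = \<D> (pair g (br Y Z) X) - br X (br Y Z)"
    using XYZ bracket_swap[of X "br Y Z"] by (simp add: closure_rules pair_commute[of X])
  moreover have "br (br Z X) Y = \<D> (pair g (br Z X) Y) - \<D> (act rho Y (pair g X Z)) + br Y (br X Z)"
    using XYZ bracket_swap[of Y "br Z X"]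
    by (simp add: closure_rules pair_commute[of Y] bracket_swap[of X Z] bracket_diff_right
        bracket_courant_D)
  moreover have "br X (br Y Z) = br (br X Y) Z + br Y (br X Z)"
    using XYZ by (rule bracket_jacobi)
  ultimately have "br (br X Y) Z + br (br Y Z) X + br (br Z X) Y
      = \<D> (pair g (br Y Z) X) + \<D> (pair g (br Z X) Y) - \<D> (act rho Y (pair g X Z))"
    by (simp add: algebra_simps)
  also have "\<dots> = \<D> (pair g (br Y Z) X + pair g (br Z X) Y - act rho Y (pair g X Z))"
    using XYZ by (simp add: courant_D_add courant_D_diff closure_rules)
  also have "pair g (br Y Z) X + pair g (br Z X) Y - act rho Y (pair g X Z) = (2/3) *\<^sub>R cyc X Y Z"
  proof
    fix p
    have a: "pair g (br Y Z) X = act rho Y (pair g X Z) - pair g (br Y X) Z"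
      using pair_bracket_swap(2)[of Y X Z] assms by simp
    have b: "pair g (br Z X) Y = act rho Y (pair g X Z) - pair g (br X Z) Y"
      using pair_bracket_swap(1)[of X Z Y] assms by simp
    show "(pair g (br Y Z) X + pair g (br Z X) Y - act rho Y (pair g X Z)) p = ((2/3) *\<^sub>R cyc X Y Z) p"
      unfolding cyc_pair_bracket[OF XYZ]
      using XYZ by (simp add: a b pair_bracket_swap[of X Y Z] scaleR_fun_apply field_simps)
  qed
  also have "\<D> ((2/3) *\<^sub>R cyc X Y Z) = (2/3) *\<^sub>R \<D> (cyc X Y Z)"
    using XYZ by (intro courant_D_scale closure_rules)
  finally show ?thesis .
qed

text \<open>The correction inside the inner bracket is a value of \<open>\<D>\<close>, which
  brackets to zero from the left; only the outer correction remains.\<close>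

lemma skew_bracket_skew_bracket:
  assumes "X \<in> \<Gamma>" "Y \<in> \<Gamma>" "Z \<in> \<Gamma>"
  shows "\<S> (\<S> X Y) Z = br (br X Y) Z - (1/2) *\<^sub>R \<D> (pair g (\<S> X Y) Z)"
  using assms
  by (simp add: skew_bracket_def bracket_diff_left bracket_scale_left courant_D_bracket closure_rules)

text \<open>The plain brackets contribute \<open>2/3\<close> and the outer corrections
  \<open>-1/2\<close>. The difference \<open>1/6\<close> is the constant that \<open>l_3\<close>
  compensates.\<close>

lemma skew_bracket_jacobi:
  assumes XYZ: "X \<in> \<Gamma>" "Y \<in> \<Gamma>" "Z \<in> \<Gamma>"
  shows "\<S> (\<S> X Y) Z + \<S> (\<S> Y Z) X + \<S> (\<S> Z X) Y = (1/6) *\<^sub>R \<D> (cyc X Y Z)"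
proof -
  have "\<S> (\<S> X Y) Z + \<S> (\<S> Y Z) X + \<S> (\<S> Z X) Y
      = (br (br X Y) Z + br (br Y Z) X + br (br Z X) Y) - (1/2) *\<^sub>R \<D> (cyc X Y Z)"
    using XYZ
    by (simp add: skew_bracket_skew_bracket courant_D_add closure_rules algebra_simps)
  also have "\<dots> = (1/6) *\<^sub>R \<D> (cyc X Y Z)"
    unfolding bracket_cyclic_sum[OF XYZ] by (simp flip: scaleR_left_diff_distrib)
  finally show ?thesis .
qed

text \<open>In the expansion around \<open>br (\<D> f) X\<close>, this bracket and the derivative
  along \<open>\<D> f\<close> vanish; two of the three derivative terms remain.\<close>

lemma cyc_courant_D:
  assumes f: "f \<in> C_inf A" and XY: "X \<in> \<Gamma>" "Y \<in> \<Gamma>"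
  shows "cyc (\<D> f) X Y = (3/2) *\<^sub>R (act rho X (act rho Y f) - act rho Y (act rho X f))"
  using assms
  by (simp add: cyc_pair_bracket pair_courant_D_left courant_D_bracket act_courant_D closure_rules
      pair_zero_left)

end

section \<open>Shuffles of at most four elements\<close>

abbreviation swp :: "nat \<Rightarrow> nat \<Rightarrow> nat \<Rightarrow> nat"
  where "swp \<equiv> Transposition.transpose"

lemma permutes_lessThan_eqI:
  assumes "\<sigma> permutes {..<n}" "\<tau> permutes {..<n}" "\<And>k. k < n \<Longrightarrow> \<sigma> k = \<tau> k"
  shows "\<sigma> = \<tau>"
proof
  fix k show "\<sigma> k = \<tau> k"
    using assms(3) permutes_not_in[OF assms(1), of k] permutes_not_in[OF assms(2), of k]
    by (cases "k < n") auto
qed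

lemma permutes_lessThan_less: "\<sigma> permutes {..<n} \<Longrightarrow> k < n \<Longrightarrow> \<sigma> k < (n::nat)"
  using permutes_in_image[of \<sigma> "{..<n}" k] by simp

lemma upt_small:
  "[0..<1] = [0]" "[0..<2] = [0, 1]" "[0..<3] = [0, 1, 2]" "[0..<4] = [0, 1, 2, 3]"
  "[Suc 0..<2] = [1]" "[Suc 0..<3] = [1, 2]" "[Suc 0..<4] = [1, 2, 3]" "[2..<3] = [2]" "[2..<4] = [2, 3]"
  "[3..<4] = [3]"
  by (simp_all add: upt_rec)

text \<open>Reduces the classification of permutations to comparing finite lists of values, which
  simplification can evaluate.\<close>

lemma in_perms_of_values:
  assumes "\<sigma> permutes {..<n}" "\<And>\<tau>. \<tau> \<in> set \<tau>s \<Longrightarrow> \<tau> permutes {..<n}"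
    and "map \<sigma> [0..<n] \<in> set (map (\<lambda>\<tau>. map \<tau> [0..<n]) \<tau>s)"
  shows "\<sigma> \<in> set \<tau>s"
proof -
  obtain \<tau> where \<tau>: "\<tau> \<in> set \<tau>s" "map \<sigma> [0..<n] = map \<tau> [0..<n]"
    using assms(3) by auto
  then have "\<sigma> = \<tau>"
    by (intro permutes_lessThan_eqI[OF assms(1) assms(2)[OF \<tau>(1)]]) auto
  with \<tau>(1) show ?thesis by simp
qed

lemmas permutes_rules = permutes_id permutes_swap_id permutes_compose

text \<open>Sorted lists unfold to finitely many inequalities between values, unlike monotonicity on
  an interval.\<close>

lemma shuffle_perms_iff:
  assumes "i \<le> n"
  shows "\<sigma> \<in> shuffle_perms i n \<longleftrightarrow> \<sigma> permutes {..<n} \<and>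
    sorted_wrt (<) (map \<sigma> [0..<i]) \<and> sorted_wrt (<) (map \<sigma> [i..<n])"
proof -
  have "sorted_wrt (<) (map \<sigma> [a..<b]) \<longleftrightarrow> strict_mono_on {a..<b} \<sigma>" for a b
  proof
    assume *: "sorted_wrt (<) (map \<sigma> [a..<b])"
    show "strict_mono_on {a..<b} \<sigma>"
    proof (rule strict_mono_onI)
      fix x y assume "x \<in> {a..<b}" "y \<in> {a..<b}" "x < y"
      then show "\<sigma> x < \<sigma> y"
        using sorted_wrt_nth_less[OF *, of "x - a" "y - a"] by simp
    qed
  next
    assume "strict_mono_on {a..<b} \<sigma>"
    then show "sorted_wrt (<) (map \<sigma> [a..<b])"
      by (simp add: sorted_wrt_iff_nth_less strict_mono_onD)
  qed
  then show ?thesis by (simp add: shuffle_perms_def lessThan_atLeast0)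
qed

lemma permutes_lessThan_values:
  shows "\<sigma> permutes {..<2::nat} \<Longrightarrow> map \<sigma> [0..<2] \<in> {[0, 1], [1, 0]}"
    and "\<sigma> permutes {..<3::nat} \<Longrightarrow> map \<sigma> [0..<3] \<in>
      {[0, 1, 2], [1, 0, 2], [0, 2, 1], [2, 1, 0], [1, 2, 0], [2, 0, 1]}"
proof -
  have d: "distinct (map \<sigma> [0..<n])" if "\<sigma> permutes {..<n}" for n \<sigma>
    using permutes_inj[OF that] by (auto simp: distinct_map inj_def inj_on_def)
  show "map \<sigma> [0..<2] \<in> {[0, 1], [1, 0]}" if "\<sigma> permutes {..<2::nat}"
    using permutes_lessThan_less[OF that, of 0] permutes_lessThan_less[OF that, of 1] d[OF that]
    by (auto simp: upt_small less_2_cases_iff)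
  have less_3: "k < 3 \<longleftrightarrow> k = 0 \<or> k = 1 \<or> k = 2" for k :: nat by linarith
  show "map \<sigma> [0..<3] \<in>
      {[0, 1, 2], [1, 0, 2], [0, 2, 1], [2, 1, 0], [1, 2, 0], [2, 0, 1]}" if "\<sigma> permutes {..<3::nat}"
  proof -
    have "\<sigma> 0 < 3" "\<sigma> 1 < 3" "\<sigma> 2 < 3" using permutes_lessThan_less[OF that] by auto
    with d[OF that] show ?thesis
      unfolding less_3 upt_small by (elim disjE) simp_all
  qed
qed

lemma permutes_lessThan_2: "\<sigma> permutes {..<2} \<Longrightarrow> \<sigma> \<in> set [id, swp 0 1]"
  by (rule in_perms_of_values, assumption, use permutes_lessThan_values(1)[of \<sigma>] in
      \<open>auto simp: permutes_rules upt_small Transposition.transpose_def\<close>)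

lemma permutes_lessThan_3:
  "\<sigma> permutes {..<3} \<Longrightarrow> \<sigma> \<in> set [id, swp 0 1, swp 1 2, swp 0 2, swp 0 1 \<circ> swp 1 2, swp 1 2 \<circ> swp 0 1]"
  by (rule in_perms_of_values, assumption, use permutes_lessThan_values(2)[of \<sigma>] in
      \<open>auto simp: permutes_rules upt_small Transposition.transpose_def\<close>)

text \<open>By strong induction: the preimage of \<open>k\<close> cannot be smaller, as smaller
  points are fixed, nor larger, as then \<open>k\<close> would be mapped below itself to a point
  that is already fixed.\<close>

lemma shuffle_perms_n_n: "shuffle_perms n n = {id}"
proof -
  have "\<sigma> = id" if \<sigma>: "\<sigma> permutes {..<n}" "strict_mono_on {..<n} \<sigma>" for \<sigma>
  proof (rule permutes_lessThan_eqI[OF \<sigma>(1) permutes_id])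
    fix k assume k: "k < n"
    then show "\<sigma> k = id k"
    proof (induction k rule: less_induct)
      case (less k)
      have "\<sigma> ` {..<n} = {..<n}" using \<sigma>(1) by (rule permutes_image)
      with less.prems obtain j where j: "j < n" "\<sigma> j = k" by (metis image_iff lessThan_iff)
      have "\<not> j < k"
        using less.IH[of j] j by auto
      moreover have "\<not> k < j"
      proof
        assume "k < j"
        then have "\<sigma> k < k" using strict_mono_onD[OF \<sigma>(2), of k j] j less.prems by auto
        then have "\<sigma> (\<sigma> k) = \<sigma> k" using less.IH[of "\<sigma> k"] less.prems by auto
        then have "\<sigma> k = k" using permutes_inj[OF \<sigma>(1)] by (auto dest: injD)
        with \<open>\<sigma> k < k\<close> show False by simp
      qed
      ultimately show ?case using j by (simp add: not_less)
    qed
  qed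
  then show ?thesis
    by (auto simp: shuffle_perms_def permutes_id strict_mono_on_def)
qed

text \<open>Distinctness is asked of the lists of values because it is decidable there; it implies
  distinctness of the functions.\<close>

lemma sum_explicit_perms:
  assumes "S = set \<tau>s" "distinct (map (\<lambda>\<sigma>. map \<sigma> [0..<n]) \<tau>s)"
  shows "sum F S = (\<Sum>\<sigma>\<leftarrow>\<tau>s. F \<sigma>)"
  using assms sum.distinct_set_conv_list[of \<tau>s F] by (auto simp: distinct_map)

text \<open>Here and below, shuffles are written as products of transpositions so that their signs
  can be read off.\<close>

lemma shuffle_perms_1_2:
  "shuffle_perms 1 2 = set [id, swp 0 1]"
    (is "_ = set ?\<tau>s")
proof
  show "shuffle_perms 1 2 \<subseteq> set ?\<tau>s"
  proof
    fix \<sigma> :: "nat \<Rightarrow> nat" assume "\<sigma> \<in> shuffle_perms 1 2"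
    then have \<sigma>: "\<sigma> permutes {..<2}" "sorted_wrt (<) (map \<sigma> [0..<1])" "sorted_wrt (<) (map \<sigma> [1..<2])"
      by (simp_all add: shuffle_perms_iff)
    have "map \<sigma> [0..<2] \<in> {[0, 1], [1, 0]}"
      using permutes_lessThan_values(1)[OF \<sigma>(1)] \<sigma>(2,3)
      by (auto simp: upt_small)
    then show "\<sigma> \<in> set ?\<tau>s"
      by (intro in_perms_of_values[OF \<sigma>(1)])
        (auto simp: permutes_rules upt_small Transposition.transpose_def)
  qed
  show "set ?\<tau>s \<subseteq> shuffle_perms 1 2"
    by (auto simp: shuffle_perms_iff permutes_rules upt_small Transposition.transpose_def)
qed

lemma shuffle_perms_1_3:
  "shuffle_perms 1 3 = set [id, swp 0 1, swp 1 2 \<circ> swp 0 1]"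
    (is "_ = set ?\<tau>s")
proof
  show "shuffle_perms 1 3 \<subseteq> set ?\<tau>s"
  proof
    fix \<sigma> :: "nat \<Rightarrow> nat" assume "\<sigma> \<in> shuffle_perms 1 3"
    then have \<sigma>: "\<sigma> permutes {..<3}" "sorted_wrt (<) (map \<sigma> [0..<1])" "sorted_wrt (<) (map \<sigma> [1..<3])"
      by (simp_all add: shuffle_perms_iff)
    have "map \<sigma> [0..<3] \<in> {[0, 1, 2], [1, 0, 2], [2, 0, 1]}"
      using permutes_lessThan_values(2)[OF \<sigma>(1)] \<sigma>(2,3)
      by (auto simp: upt_small)
    then show "\<sigma> \<in> set ?\<tau>s"
      by (intro in_perms_of_values[OF \<sigma>(1)])
        (auto simp: permutes_rules upt_small Transposition.transpose_def)
  qed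
  show "set ?\<tau>s \<subseteq> shuffle_perms 1 3"
    by (auto simp: shuffle_perms_iff permutes_rules upt_small Transposition.transpose_def)
qed

lemma shuffle_perms_2_3:
  "shuffle_perms 2 3 = set [id, swp 1 2, swp 0 1 \<circ> swp 1 2]"
    (is "_ = set ?\<tau>s")
proof
  show "shuffle_perms 2 3 \<subseteq> set ?\<tau>s"
  proof
    fix \<sigma> :: "nat \<Rightarrow> nat" assume "\<sigma> \<in> shuffle_perms 2 3"
    then have \<sigma>: "\<sigma> permutes {..<3}" "sorted_wrt (<) (map \<sigma> [0..<2])" "sorted_wrt (<) (map \<sigma> [2..<3])"
      by (simp_all add: shuffle_perms_iff)
    have "map \<sigma> [0..<3] \<in> {[0, 1, 2], [0, 2, 1], [1, 2, 0]}"
      using permutes_lessThan_values(2)[OF \<sigma>(1)] \<sigma>(2,3)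
      by (auto simp: upt_small)
    then show "\<sigma> \<in> set ?\<tau>s"
      by (intro in_perms_of_values[OF \<sigma>(1)])
        (auto simp: permutes_rules upt_small Transposition.transpose_def)
  qed
  show "set ?\<tau>s \<subseteq> shuffle_perms 2 3"
    by (auto simp: shuffle_perms_iff permutes_rules upt_small Transposition.transpose_def)
qed

lemma less_le_3_cases:
  fixes a b :: nat
  assumes "a < b" "b \<le> 3"
  shows "a = 0 \<and> b = 1 \<or> a = 0 \<and> b = 2 \<or> a = 1 \<and> b = 2 \<or> a = 0 \<and> b = 3 \<or> a = 1 \<and> b = 3 \<or> a = 2 \<and> b = 3"
  using assms by presburger

lemma shuffle_perms_2_4:
  "shuffle_perms 2 4 = set [id, swp 1 2, swp 2 3 \<circ> swp 1 2, swp 0 1 \<circ> swp 1 2, swp 0 1 \<circ> swp 2 3 \<circ> swp 1 2, swp 0 2 \<circ> swp 1 3]"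
    (is "_ = set ?\<tau>s")
proof
  show "shuffle_perms 2 4 \<subseteq> set ?\<tau>s"
  proof
    fix \<sigma> :: "nat \<Rightarrow> nat" assume "\<sigma> \<in> shuffle_perms 2 4"
    then have \<sigma>: "\<sigma> permutes {..<4}" "sorted_wrt (<) (map \<sigma> [0..<2])" "sorted_wrt (<) (map \<sigma> [2..<4])"
      by (simp_all add: shuffle_perms_iff)
    have "map \<sigma> [0..<4] \<in> {[0, 1, 2, 3], [0, 2, 1, 3], [0, 3, 1, 2], [1, 2, 0, 3], [1, 3, 0, 2], [2, 3, 0, 1]}"
    proof -
      \<comment> \<open>Instead of running through all 24 permutations, the two increasing pairs are
        enumerated and overlapping ones are discarded.\<close>
      have ne: "\<sigma> a \<noteq> \<sigma> b" if "a \<noteq> b" for a b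
        using permutes_inj[OF \<sigma>(1)] that by (auto dest: injD)
      have le: "\<sigma> k \<le> 3" if "k \<le> 3" for k
        using permutes_lessThan_less[OF \<sigma>(1), of k] that by simp
      have lt: "\<sigma> 0 < \<sigma> 1" "\<sigma> 2 < \<sigma> 3"
        using \<sigma>(2,3) by (simp_all add: upt_small)
      show ?thesis
        using less_le_3_cases[OF lt(1) le[of 1]] less_le_3_cases[OF lt(2) le[of 3]]
          ne[of 0 2] ne[of 0 3] ne[of 1 2] ne[of 1 3]
        unfolding upt_small by (simp, elim disjE) simp_all
    qed
    then show "\<sigma> \<in> set ?\<tau>s"
      by (intro in_perms_of_values[OF \<sigma>(1)])
        (auto simp: permutes_rules upt_small Transposition.transpose_def)
  qed
  show "set ?\<tau>s \<subseteq> shuffle_perms 2 4"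
    by (auto simp: shuffle_perms_iff permutes_rules upt_small Transposition.transpose_def)
qed

lemma shuffle_perms_3_4:
  "shuffle_perms 3 4 = set [id, swp 2 3, swp 1 2 \<circ> swp 2 3, swp 0 1 \<circ> swp 1 2 \<circ> swp 2 3]"
    (is "_ = set ?\<tau>s")
proof
  show "shuffle_perms 3 4 \<subseteq> set ?\<tau>s"
  proof
    fix \<sigma> :: "nat \<Rightarrow> nat" assume "\<sigma> \<in> shuffle_perms 3 4"
    then have \<sigma>: "\<sigma> permutes {..<4}" "sorted_wrt (<) (map \<sigma> [0..<3])" "sorted_wrt (<) (map \<sigma> [3..<4])"
      by (simp_all add: shuffle_perms_iff)
    have "map \<sigma> [0..<4] \<in> {[0, 1, 2, 3], [0, 1, 3, 2], [0, 2, 3, 1], [1, 2, 3, 0]}"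
    proof -
      have ne: "\<sigma> a \<noteq> \<sigma> b" if "a \<noteq> b" for a b
        using permutes_inj[OF \<sigma>(1)] that by (auto dest: injD)
      have le: "\<sigma> k \<le> 3" if "k \<le> 3" for k
        using permutes_lessThan_less[OF \<sigma>(1), of k] that by simp
      have lt: "\<sigma> 0 < \<sigma> 1" "\<sigma> 1 < \<sigma> 2"
        using \<sigma>(2,3) by (simp_all add: upt_small)
      have "\<sigma> 3 = 0 \<or> \<sigma> 3 = 1 \<or> \<sigma> 3 = 2 \<or> \<sigma> 3 = 3"
        using le[of 3] by linarith
      then show ?thesis
        using less_le_3_cases[OF lt(1) le[of 1]] less_le_3_cases[OF lt(2) le[of 2]] ne[of 0 3] ne[of 1 3] ne[of 2 3]
        unfolding upt_small by (simp, elim disjE) simp_all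
    qed
    then show "\<sigma> \<in> set ?\<tau>s"
      by (intro in_perms_of_values[OF \<sigma>(1)])
        (auto simp: permutes_rules upt_small Transposition.transpose_def)
  qed
  show "set ?\<tau>s \<subseteq> shuffle_perms 3 4"
    by (auto simp: shuffle_perms_iff permutes_rules upt_small Transposition.transpose_def)
qed

lemma sum_shuffle_perms:
  fixes F :: "(nat \<Rightarrow> nat) \<Rightarrow> 'a::comm_monoid_add"
  shows "sum F (shuffle_perms 1 2) = F id + F (swp 0 1)"
    and "sum F (shuffle_perms 1 3) = F id + (F (swp 0 1) + F (swp 1 2 \<circ> swp 0 1))"
    and "sum F (shuffle_perms 2 3) = F id + (F (swp 1 2) + F (swp 0 1 \<circ> swp 1 2))"
    and "sum F (shuffle_perms 2 4) = F id + (F (swp 1 2) + (F (swp 2 3 \<circ> swp 1 2) + (F (swp 0 1 \<circ> swp 1 2) + (F (swp 0 1 \<circ> swp 2 3 \<circ> swp 1 2) + F (swp 0 2 \<circ> swp 1 3)))))"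
    and "sum F (shuffle_perms 3 4) = F id + (F (swp 2 3) + (F (swp 1 2 \<circ> swp 2 3) + F (swp 0 1 \<circ> swp 1 2 \<circ> swp 2 3)))"
proof -
  show "sum F (shuffle_perms 1 2) = F id + F (swp 0 1)"
    by (subst sum_explicit_perms[OF shuffle_perms_1_2, of 2])
      (simp_all add: upt_small Transposition.transpose_def)
  show "sum F (shuffle_perms 1 3) = F id + (F (swp 0 1) + F (swp 1 2 \<circ> swp 0 1))"
    by (subst sum_explicit_perms[OF shuffle_perms_1_3, of 3])
      (simp_all add: upt_small Transposition.transpose_def)
  show "sum F (shuffle_perms 2 3) = F id + (F (swp 1 2) + F (swp 0 1 \<circ> swp 1 2))"
    by (subst sum_explicit_perms[OF shuffle_perms_2_3, of 3])
      (simp_all add: upt_small Transposition.transpose_def)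
  show "sum F (shuffle_perms 2 4) = F id + (F (swp 1 2) + (F (swp 2 3 \<circ> swp 1 2) + (F (swp 0 1 \<circ> swp 1 2) + (F (swp 0 1 \<circ> swp 2 3 \<circ> swp 1 2) + F (swp 0 2 \<circ> swp 1 3)))))"
    by (subst sum_explicit_perms[OF shuffle_perms_2_4, of 4])
      (simp_all add: upt_small Transposition.transpose_def)
  show "sum F (shuffle_perms 3 4) = F id + (F (swp 2 3) + (F (swp 1 2 \<circ> swp 2 3) + F (swp 0 1 \<circ> swp 1 2 \<circ> swp 2 3)))"
    by (subst sum_explicit_perms[OF shuffle_perms_3_4, of 4])
      (simp_all add: upt_small Transposition.transpose_def)
qed

text \<open>The hypothesis on products says that at most one degree is nonzero, so every inversion
  contributes \<open>(-1) powi 0\<close>.\<close>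

lemma koszul_sign_eq_1:
  assumes "\<sigma> permutes {..<length ds}"
    and "\<And>a b. a < length ds \<Longrightarrow> b < length ds \<Longrightarrow> a \<noteq> b \<Longrightarrow> ds ! a * ds ! b = 0"
  shows "koszul_sign ds \<sigma> = 1"
  unfolding koszul_sign_def
proof (rule prod.neutral, safe)
  fix a b assume ab: "a < b" "b < length ds" "\<sigma> b < \<sigma> a"
  have "ds ! \<sigma> a * ds ! \<sigma> b = 0"
    using ab by (intro assms(2) permutes_lessThan_less[OF assms(1)]) auto
  then show "(- 1) powi (ds ! \<sigma> a * ds ! \<sigma> b) = (1::real)" by (simp only: power_int_0_right)
qed

lemma chi_eq_sign:
  assumes "\<sigma> permutes {..<length ds}"
    and "\<And>a b. a < length ds \<Longrightarrow> b < length ds \<Longrightarrow> a \<noteq> b \<Longrightarrow> ds ! a * ds ! b = 0"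
  shows "chi ds \<sigma> = of_int (sign \<sigma>)"
  using assms by (simp add: chi_def koszul_sign_eq_1)

lemmas sign_simps = sign_id sign_compose sign_swap_id permutation_swap_id permutation_compose
  permutation_id


section \<open>L-infinity algebras\<close>

lemma homogeneous_permuted:
  assumes "homogeneous L ds xs" "\<sigma> permutes {..<length xs}" "b \<le> length xs"
  shows "homogeneous L (map (\<lambda>k. ds ! \<sigma> k) [a..<b]) (map (\<lambda>k. xs ! \<sigma> k) [a..<b])"
  using assms permutes_lessThan_less[OF assms(2)]
  by (auto simp: homogeneous_def list_all2_conv_all_nth)

lemma sum_list_permuted:
  fixes ds :: "int list"
  assumes "\<sigma> permutes {..<length ds}"
  shows "(\<Sum>k\<leftarrow>[0..<length ds]. ds ! \<sigma> k) = sum_list ds"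
  using sum.permute[OF assms, of "(!) ds"]
  by (simp add: sum_list_sum_nth interv_sum_list_conv_sum_set_nat atLeast0LessThan)

text \<open>The two operations have degrees \<open>2 - i\<close> and \<open>2 - j\<close>, which add
  up to \<open>3 - n\<close> since \<open>i + j = n + 1\<close>.\<close>

lemma nested_in_degree:
  assumes l: "\<And>k ds xs. k \<ge> 1 \<Longrightarrow> length xs = k \<Longrightarrow> homogeneous L ds xs
      \<Longrightarrow> l k xs \<in> L (sum_list ds + 2 - int k)"
    and l': "\<And>k ds xs. k \<ge> 1 \<Longrightarrow> length xs = k \<Longrightarrow> homogeneous L ds xs
      \<Longrightarrow> l' k xs \<in> L (sum_list ds + 2 - int k)"
    and hom: "homogeneous L ds xs" and \<sigma>: "\<sigma> permutes {..<length xs}"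
    and ij: "i \<ge> 1" "j \<ge> 1" "i + j = length xs + 1"
  shows "nested l l' j i \<sigma> xs \<in> L (sum_list ds + 3 - int (length xs))"
proof -
  let ?d = "\<lambda>a b. map (\<lambda>k. ds ! \<sigma> k) [a..<b]" and ?x = "\<lambda>a b. map (\<lambda>k. xs ! \<sigma> k) [a..<b]"
  let ?n = "length xs"
  have len: "length ds = ?n" using hom by (auto simp: homogeneous_def list_all2_lengthD)
  have "l' i (?x 0 i) \<in> L (sum_list (?d 0 i) + 2 - int i)"
    using ij by (intro l' homogeneous_permuted[OF hom \<sigma>]) auto
  then have "homogeneous L ((sum_list (?d 0 i) + 2 - int i) # ?d i ?n) (l' i (?x 0 i) # ?x i ?n)"
    using homogeneous_permuted[OF hom \<sigma>, of ?n i] by (simp add: homogeneous_def)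
  then have "nested l l' j i \<sigma> xs
      \<in> L (sum_list ((sum_list (?d 0 i) + 2 - int i) # ?d i ?n) + 2 - int j)"
    unfolding nested_def by (rule l[rotated 2]) (use ij in auto)
  also have "sum_list ((sum_list (?d 0 i) + 2 - int i) # ?d i ?n) + 2 - int j
      = sum_list (?d 0 i @ ?d i ?n) + 3 - int ?n"
    using ij by simp
  also have "?d 0 i @ ?d i ?n = ?d 0 ?n"
    using ij upt_add_eq_append[of 0 i "?n - i"] by (simp flip: map_append)
  also have "sum_list (?d 0 ?n) = sum_list ds"
    using sum_list_permuted[of \<sigma> ds] \<sigma> len by simp
  finally show ?thesis .
qed

lemma multilinear_on_zero:
  assumes "multilinear_on V k m" "length xs = k" "set xs \<subseteq> V" "0 \<in> set xs"
  shows "m xs = 0"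
proof -
  obtain i where i: "i < k" "xs ! i = 0" using assms(2,4) by (auto simp: in_set_conv_nth)
  have "m (xs[i := 0 *\<^sub>R xs ! i]) = 0 *\<^sub>R m (xs[i := xs ! i])"
    using assms i nth_mem[of i xs] unfolding multilinear_on_def by blast
  then show ?thesis using i(2) by (metis list_update_id scaleR_zero_left)
qed

lemma multilinear_on_add:
  "multilinear_on V k m \<Longrightarrow> length xs = k \<Longrightarrow> set xs \<subseteq> V \<Longrightarrow> i < k \<Longrightarrow> x \<in> V \<Longrightarrow> y \<in> V
    \<Longrightarrow> m (xs[i := x + y]) = m (xs[i := x]) + m (xs[i := y])"
  unfolding multilinear_on_def by blast

lemma homogeneous_subset_graded_total: "homogeneous L ds xs \<Longrightarrow> set xs \<subseteq> graded_total L"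
proof
  fix x assume "homogeneous L ds xs" "x \<in> set xs"
  then obtain d where "x \<in> L d"
    by (auto simp: homogeneous_def list_all2_conv_all_nth in_set_conv_nth)
  then show "x \<in> graded_total L"
    by (auto simp: graded_total_def intro: span_base)
qed

text \<open>A zero entry makes either the inner value or an outer argument vanish. This treats the
  lists whose prescribed degrees carry no information.\<close>

lemma nested_eq_zero:
  assumes l: "multilinear_on (graded_total L) j (l j)"
    and l': "multilinear_on (graded_total L) i (l' i)"
    and deg: "\<And>k ds xs. k \<ge> 1 \<Longrightarrow> length xs = k \<Longrightarrow> homogeneous L ds xs
      \<Longrightarrow> l' k xs \<in> L (sum_list ds + 2 - int k)"
    and hom: "homogeneous L ds xs" and \<sigma>: "\<sigma> permutes {..<length xs}"
    and ij: "i \<ge> 1" "j \<ge> 1" "i + j = length xs + 1" and zero: "0 \<in> set xs"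
  shows "nested l l' j i \<sigma> xs = 0"
proof -
  let ?d = "\<lambda>a b. map (\<lambda>k. ds ! \<sigma> k) [a..<b]" and ?x = "\<lambda>a b. map (\<lambda>k. xs ! \<sigma> k) [a..<b]"
  let ?n = "length xs"
  have hom0: "homogeneous L (?d 0 i) (?x 0 i)" and hom1: "homogeneous L (?d i ?n) (?x i ?n)"
    using ij by (auto intro: homogeneous_permuted[OF hom \<sigma>])
  have "l' i (?x 0 i) \<in> L (sum_list (?d 0 i) + 2 - int i)"
    using ij by (intro deg hom0) auto
  then have in_V: "set (l' i (?x 0 i) # ?x i ?n) \<subseteq> graded_total L"
    using homogeneous_subset_graded_total[OF hom1] by (auto simp: graded_total_def intro: span_base)
  obtain a where a: "a < ?n" "xs ! a = 0" using zero by (auto simp: in_set_conv_nth)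
  obtain b where b: "b < ?n" "\<sigma> b = a"
    using permutes_image[OF \<sigma>] a(1) by (metis image_iff lessThan_iff)
  have "0 \<in> set (l' i (?x 0 i) # ?x i ?n)"
  proof (cases "b < i")
    case True
    then have "0 \<in> set (?x 0 i)" using a b by force
    then have "l' i (?x 0 i) = 0"
      using homogeneous_subset_graded_total[OF hom0] by (intro multilinear_on_zero[OF l']) auto
    then show ?thesis by simp
  next
    case False
    then show ?thesis using a b by force
  qed
  then show ?thesis
    unfolding nested_def by (intro multilinear_on_zero[OF l _ in_V]) (use ij in auto)
qed

text \<open>Leaves the generalised Jacobi identities only for nonzero arguments whose nested values
  fall into a nontrivial component.\<close>

lemma L_infinity_algebraI:
  assumes gvs: "graded_vector_space L"
    and lin: "\<And>k. k \<ge> 1 \<Longrightarrow> multilinear_on (graded_total L) k (l k)"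
    and skew: "\<And>k. k \<ge> 1 \<Longrightarrow> graded_skew_symmetric L k (l k)"
    and deg: "\<And>k ds xs. k \<ge> 1 \<Longrightarrow> length xs = k \<Longrightarrow> homogeneous L ds xs
      \<Longrightarrow> l k xs \<in> L (sum_list ds + 2 - int k)"
    and jacobi: "\<And>n ds xs. n \<ge> 1 \<Longrightarrow> length xs = n \<Longrightarrow> homogeneous L ds xs \<Longrightarrow> 0 \<notin> set xs
      \<Longrightarrow> L (sum_list ds + 3 - int n) \<noteq> {0} \<Longrightarrow>
      (\<Sum>(i, j)\<in>{(i, j). i \<ge> 1 \<and> j \<ge> 1 \<and> i + j = n + 1}. \<Sum>\<sigma>\<in>shuffle_perms i n.
        (chi ds \<sigma> * (-1) ^ (i * (j - 1))) *\<^sub>R nested l l j i \<sigma> xs) = 0"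
  shows "L_infinity_algebra L l"
proof -
  have "(\<Sum>(i, j)\<in>{(i, j). i \<ge> 1 \<and> j \<ge> 1 \<and> i + j = n + 1}. \<Sum>\<sigma>\<in>shuffle_perms i n.
        (chi ds \<sigma> * (-1) ^ (i * (j - 1))) *\<^sub>R nested l l j i \<sigma> xs) = 0"
    if n: "n \<ge> 1" "length xs = n" and hom: "homogeneous L ds xs" for n ds xs
  proof (cases "0 \<in> set xs \<or> L (sum_list ds + 3 - int n) = {0}")
    case True
    have "nested l l j i \<sigma> xs = 0"
      if "i \<ge> 1" "j \<ge> 1" "i + j = n + 1" "\<sigma> \<in> shuffle_perms i n" for i j \<sigma>
    proof -
      have \<sigma>: "\<sigma> permutes {..<length xs}" using that(4) n(2) by (simp add: shuffle_perms_def)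
      show ?thesis
        using True
      proof
        assume "0 \<in> set xs"
        then show ?thesis
          by (intro nested_eq_zero[OF lin lin deg hom \<sigma>]) (use that n in auto)
      next
        assume "L (sum_list ds + 3 - int n) = {0}"
        then show ?thesis
          using nested_in_degree[OF deg deg hom \<sigma> that(1,2)] that(3) n by simp
      qed
    qed
    then show ?thesis by (auto intro!: sum.neutral)
  next
    case False
    then show ?thesis using jacobi[OF n hom] by blast
  qed
  with gvs lin skew deg show ?thesis
    unfolding L_infinity_algebra_def by blast
qed

text \<open>The compatibility condition is the polarisation of the generalised Jacobi identities.\<close>

lemma compatible_L_infinity_algebraI:
  assumes l: "L_infinity_algebra L l" and l': "L_infinity_algebra L l'"
    and m: "L_infinity_algebra L m"
    and add: "\<And>k ds xs. k \<ge> 1 \<Longrightarrow> length xs = k \<Longrightarrow> homogeneous L ds xs \<Longrightarrow> m k xs = l k xs + l' k xs"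
  shows "compatible_L_infinity_algebra L l l'"
proof -
  have deg: "\<And>k ds xs. k \<ge> 1 \<Longrightarrow> length xs = k \<Longrightarrow> homogeneous L ds xs
      \<Longrightarrow> h k xs \<in> L (sum_list ds + 2 - int k)"
    and lin: "\<And>k. k \<ge> 1 \<Longrightarrow> multilinear_on (graded_total L) k (h k)"
    and jac: "\<And>n ds xs. n \<ge> 1 \<Longrightarrow> length xs = n \<Longrightarrow> homogeneous L ds xs \<Longrightarrow>
      (\<Sum>(i, j)\<in>{(i, j). i \<ge> 1 \<and> j \<ge> 1 \<and> i + j = n + 1}. \<Sum>\<sigma>\<in>shuffle_perms i n.
        (chi ds \<sigma> * (-1) ^ (i * (j - 1))) *\<^sub>R nested h h j i \<sigma> xs) = 0"
    if "L_infinity_algebra L h" for h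
    using that unfolding L_infinity_algebra_def by blast+
  have nested_m: "nested l l' j i \<sigma> xs + nested l' l j i \<sigma> xs
      = nested m m j i \<sigma> xs - nested l l j i \<sigma> xs - nested l' l' j i \<sigma> xs"
    if hom: "homogeneous L ds xs" and \<sigma>: "\<sigma> permutes {..<length xs}"
      and ij: "i \<ge> 1" "j \<ge> 1" "i + j = length xs + 1" for ds xs \<sigma> i j
  proof -
    let ?d = "\<lambda>a b. map (\<lambda>k. ds ! \<sigma> k) [a..<b]" and ?x = "\<lambda>a b. map (\<lambda>k. xs ! \<sigma> k) [a..<b]"
    let ?n = "length xs"
    let ?y = "?x 0 i" and ?z = "?x i ?n"
    let ?e = "sum_list (?d 0 i) + 2 - int i"
    have hom0: "homogeneous L (?d 0 i) ?y" and hom1: "homogeneous L (?d i ?n) ?z"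
      using ij by (auto intro: homogeneous_permuted[OF hom \<sigma>])
    have len: "length (w # ?z) = j" for w using ij by simp
    have in_L: "h i ?y \<in> L ?e" if "L_infinity_algebra L h" for h
      using ij by (intro deg[OF that] hom0) auto
    have in_V: "h i ?y \<in> graded_total L" if "L_infinity_algebra L h" for h
      using in_L[OF that] by (auto simp: graded_total_def intro: span_base)
    have split: "h j ((l i ?y + l' i ?y) # ?z) = h j (l i ?y # ?z) + h j (l' i ?y # ?z)"
      if h: "L_infinity_algebra L h" for h
    proof -
      have "set (l i ?y # ?z) \<subseteq> graded_total L"
        using in_V[OF l] homogeneous_subset_graded_total[OF hom1] by auto
      then have "h j ((l i ?y # ?z)[0 := l i ?y + l' i ?y])
          = h j ((l i ?y # ?z)[0 := l i ?y]) + h j ((l i ?y # ?z)[0 := l' i ?y])"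
        using ij(2) by (intro multilinear_on_add[OF lin[OF h ij(2)] len _ _ in_V[OF l] in_V[OF l']]) auto
      then show ?thesis by simp
    qed
    have my: "m i ?y = l i ?y + l' i ?y"
      using ij hom0 by (intro add) auto
    \<comment> \<open>Additivity of \<open>m\<close> is known on homogeneous lists only; the inner
      value qualifies because it has the definite degree \<open>?e\<close>.\<close>
    have "homogeneous L (?e # ?d i ?n) (m i ?y # ?z)"
      using in_L[OF m] hom1 by (simp add: homogeneous_def)
    then have "m j (m i ?y # ?z) = l j (m i ?y # ?z) + l' j (m i ?y # ?z)"
      using len ij by (intro add) auto
    then show ?thesis
      unfolding nested_def my split[OF l] split[OF l'] by simp
  qed
  have "(\<Sum>(i, j)\<in>{(i, j). i \<ge> 1 \<and> j \<ge> 1 \<and> i + j = n + 1}. \<Sum>\<sigma>\<in>shuffle_perms i n.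
        (chi ds \<sigma> * (-1) ^ (i * (j - 1))) *\<^sub>R
          (nested l l' j i \<sigma> xs + nested l' l j i \<sigma> xs)) = 0"
    if n: "n \<ge> 1" "length xs = n" and hom: "homogeneous L ds xs" for n ds xs
  proof -
    let ?I = "{(i, j). i \<ge> 1 \<and> j \<ge> 1 \<and> i + j = n + 1}"
    let ?S = "\<lambda>h. \<Sum>(i, j)\<in>?I. \<Sum>\<sigma>\<in>shuffle_perms i n.
        (chi ds \<sigma> * (-1) ^ (i * (j - 1))) *\<^sub>R nested h h j i \<sigma> xs"
    have "(\<Sum>(i, j)\<in>?I. \<Sum>\<sigma>\<in>shuffle_perms i n. (chi ds \<sigma> * (-1) ^ (i * (j - 1))) *\<^sub>R
          (nested l l' j i \<sigma> xs + nested l' l j i \<sigma> xs))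
        = (\<Sum>(i, j)\<in>?I. \<Sum>\<sigma>\<in>shuffle_perms i n. (chi ds \<sigma> * (-1) ^ (i * (j - 1))) *\<^sub>R
          (nested m m j i \<sigma> xs - nested l l j i \<sigma> xs - nested l' l' j i \<sigma> xs))"
      using n hom
      by (intro sum.cong refl) (auto intro!: sum.cong simp: nested_m shuffle_perms_def)
    also have "\<dots> = ?S m - ?S l - ?S l'"
      by (simp add: scaleR_diff_right sum_subtractf case_prod_unfold)
    also have "\<dots> = 0"
      using jac[OF l n hom] jac[OF l' n hom] jac[OF m n hom] by simp
    finally show ?thesis .
  qed
  with l l' show ?thesis
    unfolding compatible_L_infinity_algebra_def by blast
qed

lemma chi_id: "chi ds id = 1"
proof -
  have "{(a, b). a < b \<and> b < length ds \<and> id b < id a} = {}" by auto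
  then show ?thesis by (simp only: chi_def koszul_sign_def prod.empty sign_id of_int_1 mult_1)
qed

text \<open>For two odd elements the sign of the transposition and the Koszul sign cancel. In
  \<open>L(E)\<close> this concerns pairs of functions.\<close>

lemma chi_swap_odd: "chi [-1, -1] (swp 0 1) = 1"
proof -
  have "{(a, b). a < b \<and> b < length [-1, -1::int] \<and> swp 0 1 b < swp 0 1 a} = {(0, 1)}"
    by (auto simp: Transposition.transpose_def less_Suc_eq split: if_splits)
  then show ?thesis by (simp add: chi_def koszul_sign_def sign_swap_id)
qed

text \<open>The bounds stay in the form \<open>2 + 1\<close> to match the instances of
  \<open>n + 1\<close> in the generalised Jacobi identities.\<close>

lemma sum_index_pairs:
  fixes F :: "nat \<times> nat \<Rightarrow> 'a::comm_monoid_add"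
  shows "sum F {(i, j). i \<ge> 1 \<and> j \<ge> 1 \<and> i + j = 2 + 1} = F (1, 2) + F (2, 1)"
    and "sum F {(i, j). i \<ge> 1 \<and> j \<ge> 1 \<and> i + j = 3 + 1} = F (1, 3) + (F (2, 2) + F (3, 1))"
    and "sum F {(i, j). i \<ge> 1 \<and> j \<ge> 1 \<and> i + j = 4 + 1}
      = F (1, 4) + (F (2, 3) + (F (3, 2) + F (4, 1)))"
proof -
  have "{(i, j). i \<ge> 1 \<and> j \<ge> 1 \<and> i + j = 2 + 1} = {(1, 2), (2, 1::nat)}" by auto
  then show "sum F {(i, j). i \<ge> 1 \<and> j \<ge> 1 \<and> i + j = 2 + 1} = F (1, 2) + F (2, 1)" by simp
  have "{(i, j). i \<ge> 1 \<and> j \<ge> 1 \<and> i + j = 3 + 1} = {(1, 3), (2, 2), (3, 1::nat)}" by auto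
  then show "sum F {(i, j). i \<ge> 1 \<and> j \<ge> 1 \<and> i + j = 3 + 1} = F (1, 3) + (F (2, 2) + F (3, 1))"
    by simp
  have "{(i, j). i \<ge> 1 \<and> j \<ge> 1 \<and> i + j = 4 + 1} = {(1, 4), (2, 3), (3, 2), (4, 1::nat)}" by auto
  then show "sum F {(i, j). i \<ge> 1 \<and> j \<ge> 1 \<and> i + j = 4 + 1}
      = F (1, 4) + (F (2, 3) + (F (3, 2) + F (4, 1)))" by simp
qed

text \<open>The sign \<open>chi\<close> stays symbolic because with two arguments both may be
  functions.\<close>

lemma jacobi_sum_2:
  fixes l :: "nat \<Rightarrow> 'a::real_vector list \<Rightarrow> 'a"
  shows "(\<Sum>(i, j)\<in>{(i, j). i \<ge> 1 \<and> j \<ge> 1 \<and> i + j = 2 + 1}. \<Sum>\<sigma>\<in>shuffle_perms i 2.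
      (chi ds \<sigma> * (-1) ^ (i * (j - 1))) *\<^sub>R nested l l j i \<sigma> [a, b])
    = l 1 [l 2 [a, b]] - l 2 [l 1 [a], b] - chi ds (swp 0 1) *\<^sub>R l 2 [l 1 [b], a]"
  unfolding sum_index_pairs prod.case sum_shuffle_perms shuffle_perms_n_n
  by (simp add: nested_def chi_id upt_small Transposition.transpose_def)

text \<open>At most one degree is nonzero, so \<open>chi\<close> is the plain sign; the factors
  \<open>(-1) ^ (i * (j - 1))\<close> are all 1 here.\<close>

lemma jacobi_sum_3:
  fixes l :: "nat \<Rightarrow> 'a::real_vector list \<Rightarrow> 'a"
  assumes "length ds = 3"
    and "\<forall>a<3. \<forall>b<3. a \<noteq> b \<longrightarrow> ds ! a * ds ! b = 0"
  shows "(\<Sum>(i, j)\<in>{(i, j). i \<ge> 1 \<and> j \<ge> 1 \<and> i + j = 3 + 1}. \<Sum>\<sigma>\<in>shuffle_perms i 3.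
      (chi ds \<sigma> * (-1) ^ (i * (j - 1))) *\<^sub>R nested l l j i \<sigma> [a, b, c])
    = (l 3 [l 1 [a], b, c] - l 3 [l 1 [b], a, c] + l 3 [l 1 [c], a, b])
      + (l 2 [l 2 [a, b], c] - l 2 [l 2 [a, c], b] + l 2 [l 2 [b, c], a]) + l 1 [l 3 [a, b, c]]"
proof -
  have chi: "chi ds \<sigma> = of_int (sign \<sigma>)" if "\<sigma> permutes {..<3}" for \<sigma>
    using chi_eq_sign[of \<sigma> ds] assms that by simp
  show ?thesis
    unfolding sum_index_pairs prod.case sum_shuffle_perms shuffle_perms_n_n
    by (simp add: chi permutes_rules sign_simps nested_def upt_small Transposition.transpose_def)
qed

text \<open>The pairs \<open>(1, 4)\<close> and \<open>(4, 1)\<close> drop out with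
  \<open>l 4\<close>. The factor \<open>(-1) ^ (i * (j - 1))\<close> is 1 for \<open>(2, 3)\<close>
  and -1 for \<open>(3, 2)\<close>, whence the minus sign between the two groups.\<close>

lemma jacobi_sum_4:
  fixes l :: "nat \<Rightarrow> 'a::real_vector list \<Rightarrow> 'a"
  assumes "length ds = 4"
    and "\<forall>a<4. \<forall>b<4. a \<noteq> b \<longrightarrow> ds ! a * ds ! b = 0"
    and "\<And>xs. l 4 xs = 0" "l 1 [0] = 0"
  shows "(\<Sum>(i, j)\<in>{(i, j). i \<ge> 1 \<and> j \<ge> 1 \<and> i + j = 4 + 1}. \<Sum>\<sigma>\<in>shuffle_perms i 4.
      (chi ds \<sigma> * (-1) ^ (i * (j - 1))) *\<^sub>R nested l l j i \<sigma> [a, b, c, d])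
    = (l 3 [l 2 [a, b], c, d] - l 3 [l 2 [a, c], b, d] + l 3 [l 2 [a, d], b, c]
        + l 3 [l 2 [b, c], a, d] - l 3 [l 2 [b, d], a, c] + l 3 [l 2 [c, d], a, b])
      - (l 2 [l 3 [a, b, c], d] - l 2 [l 3 [a, b, d], c] + l 2 [l 3 [a, c, d], b] - l 2 [l 3 [b, c, d], a])"
proof -
  have chi: "chi ds \<sigma> = of_int (sign \<sigma>)" if "\<sigma> permutes {..<4}" for \<sigma>
    using chi_eq_sign[of \<sigma> ds] assms that by simp
  have "nested l l 4 1 \<sigma> [a, b, c, d] = 0" for \<sigma>
    by (simp add: nested_def assms(3))
  moreover have "nested l l 1 4 id [a, b, c, d] = 0"
    using assms(3,4) by (simp add: nested_def)
  ultimately show ?thesis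
    unfolding sum_index_pairs prod.case sum_shuffle_perms shuffle_perms_n_n
    by (simp add: chi permutes_rules sign_simps)
      (simp add: nested_def upt_small Transposition.transpose_def)
qed

lemma chi_swap:
  assumes "length ds = 2" "ds ! 0 * ds ! 1 = 0"
  shows "chi ds (swp 0 1) = -1"
proof -
  have "chi ds (swp 0 1) = of_int (sign (swp 0 1))"
  proof (rule chi_eq_sign)
    show "swp 0 1 permutes {..<length ds}" using assms(1) by (simp add: permutes_swap_id)
    show "ds ! a * ds ! b = 0" if "a < length ds" "b < length ds" "a \<noteq> b" for a b
      using that assms by (auto simp: less_2_cases_iff)
  qed
  then show ?thesis by (simp add: sign_swap_id)
qed

lemma length_2_cases: "length xs = 2 \<Longrightarrow> \<exists>a b. xs = [a, b]"
  by (auto simp: numeral_2_eq_2 length_Suc_conv)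

lemma length_3_cases: "length xs = 3 \<Longrightarrow> \<exists>a b c. xs = [a, b, c]"
  by (auto simp: numeral_3_eq_3 length_Suc_conv)

lemma length_4_cases: "length xs = 4 \<Longrightarrow> \<exists>a b c d. xs = [a, b, c, d]"
  by (auto simp: numeral_eq_Suc length_Suc_conv)


section \<open>The L-infinity algebra of a Courant algebroid\<close>

context courant_algebroid
begin

lemma skew_bracket_add_right:
  "X \<in> \<Gamma> \<Longrightarrow> Y \<in> \<Gamma> \<Longrightarrow> Z \<in> \<Gamma> \<Longrightarrow> \<S> Z (X + Y) = \<S> Z X + \<S> Z Y"
  by (simp add: skew_bracket_def bracket_add_right pair_add_right courant_D_add closure_rules algebra_simps)

lemma skew_bracket_scale_right: "X \<in> \<Gamma> \<Longrightarrow> Z \<in> \<Gamma> \<Longrightarrow> \<S> Z (c *\<^sub>R X) = c *\<^sub>R \<S> Z X"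
  by (simp add: skew_bracket_def bracket_scale_right pair_scale_right courant_D_scale closure_rules
      algebra_simps)

lemma zero_rules:
  shows "X \<in> \<Gamma> \<Longrightarrow> \<S> 0 X = 0" "X \<in> \<Gamma> \<Longrightarrow> \<S> X 0 = 0" "act rho 0 f = 0" "X \<in> \<Gamma> \<Longrightarrow> act rho X 0 = 0"
  using skew_bracket_scale_left[of 0 X 0] skew_bracket_scale_right[of 0 X 0]
    act_scale_left[of 0 0 f] act_scale_right[of X 0 0]
  by (simp_all add: section_zero C_inf_zero)

lemma pair_minus_left: "X \<in> \<Gamma> \<Longrightarrow> Y \<in> \<Gamma> \<Longrightarrow> pair g (- X) Y = - pair g X Y"
  using pair_scale_left[of X Y "-1"] by simp

lemma skew_bracket_minus_left: "X \<in> \<Gamma> \<Longrightarrow> Y \<in> \<Gamma> \<Longrightarrow> \<S> (- X) Y = - \<S> X Y"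
  using skew_bracket_scale_left[of X Y "-1"] by simp

lemma cyc_swap:
  assumes "X \<in> \<Gamma>" "Y \<in> \<Gamma>" "Z \<in> \<Gamma>"
  shows "cyc Y X Z = - cyc X Y Z"
  using assms
  by (simp add: skew_bracket_swap[of X Y] skew_bracket_swap[of Z X] skew_bracket_swap[of Y Z]
      pair_minus_left closure_rules)

lemma cyc_zero: "X \<in> \<Gamma> \<Longrightarrow> Y \<in> \<Gamma> \<Longrightarrow> cyc 0 X Y = 0 \<and> cyc X 0 Y = 0 \<and> cyc X Y 0 = 0"
  by (simp add: zero_rules pair_zero_left pair_zero_right closure_rules)

section \<open>The identity for four sections\<close>

text \<open>The same cyclic sum is expanded around the bracket of the last two arguments, to be
  compared with \<open>cyc_eq\<close>.\<close>

lemma cyc_eq':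
  assumes "W \<in> \<Gamma>" "Y \<in> \<Gamma>" "Z \<in> \<Gamma>"
  shows "cyc W Y Z = 3 *\<^sub>R pair g (\<S> Y Z) W
    + (3/2) *\<^sub>R (act rho Z (pair g W Y) - act rho Y (pair g W Z))"
proof -
  have "cyc W Y Z = cyc Y Z W" by (simp add: algebra_simps)
  then show ?thesis
    using assms by (simp add: cyc_eq pair_commute[of Y W] pair_commute[of Z W])
qed

text \<open>Equates the expansions \<open>cyc_eq\<close> and \<open>cyc_eq'\<close> of
  \<open>cyc (\<S> X Y) Z W\<close>. Since the anchor annihilates values of \<open>\<D>\<close>, the
  derivative along \<open>\<S> X Y\<close> is a commutator of derivatives.\<close>

lemma pair_skew_bracket_skew_bracket:
  assumes XY: "X \<in> \<Gamma>" "Y \<in> \<Gamma>" and ZW: "Z \<in> \<Gamma>" "W \<in> \<Gamma>"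
  shows "pair g (\<S> (\<S> X Y) Z) W p = pair g (\<S> X Y) (\<S> Z W) p
    + act rho W (pair g (\<S> X Y) Z) p / 2 - act rho Z (pair g (\<S> X Y) W) p
    + (act rho X (act rho Y (pair g Z W)) p - act rho Y (act rho X (pair g Z W)) p) / 2"
proof -
  have S: "\<S> X Y \<in> \<Gamma>" "\<S> Z W \<in> \<Gamma>" using assms by (auto intro: closure_rules)
  have "(3 *\<^sub>R pair g (\<S> (\<S> X Y) Z) W
      + (3/2) *\<^sub>R (act rho Z (pair g (\<S> X Y) W) - act rho (\<S> X Y) (pair g Z W))) p
    = (3 *\<^sub>R pair g (\<S> Z W) (\<S> X Y)
      + (3/2) *\<^sub>R (act rho W (pair g (\<S> X Y) Z) - act rho Z (pair g (\<S> X Y) W))) p"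
    using cyc_eq[OF S(1) ZW] cyc_eq'[OF S(1) ZW] by simp
  moreover have "act rho (\<S> X Y) (pair g Z W) p
      = act rho X (act rho Y (pair g Z W)) p - act rho Y (act rho X (pair g Z W)) p"
    using act_skew_bracket[OF XY pair_closed[OF ZW]] by simp
  moreover have "pair g (\<S> Z W) (\<S> X Y) p = pair g (\<S> X Y) (\<S> Z W) p"
    using pair_commute[OF S] by simp
  ultimately show ?thesis
    by (simp add: scaleR_fun_apply field_simps)
qed

lemma act_cyc:
  assumes "X \<in> \<Gamma>" "Y \<in> \<Gamma>" "Z \<in> \<Gamma>" "W \<in> \<Gamma>"
  shows "act rho W (cyc X Y Z) p = 3 * act rho W (pair g (\<S> X Y) Z) p
    + 3/2 * (act rho W (act rho Y (pair g X Z)) p - act rho W (act rho X (pair g Y Z)) p)"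
  using assms unfolding cyc_eq[OF assms(1-3)]
  by (simp add: act_add_right act_scale_right act_diff_right closure_rules scaleR_fun_apply)

text \<open>Pairing the skew Jacobi identity of \<open>X\<^sub>1, X\<^sub>2, X\<^sub>3\<close> with \<open>X\<^sub>4\<close> gives the next identity.\<close>

lemma skew_bracket_quaternary:
  assumes X: "X\<^sub>1 \<in> \<Gamma>" "X\<^sub>2 \<in> \<Gamma>" "X\<^sub>3 \<in> \<Gamma>" "X\<^sub>4 \<in> \<Gamma>"
  shows "act rho X\<^sub>4 (cyc X\<^sub>1 X\<^sub>2 X\<^sub>3) p - act rho X\<^sub>3 (cyc X\<^sub>1 X\<^sub>2 X\<^sub>4) p
      + act rho X\<^sub>2 (cyc X\<^sub>1 X\<^sub>3 X\<^sub>4) p - act rho X\<^sub>1 (cyc X\<^sub>2 X\<^sub>3 X\<^sub>4) p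
    = - 3 * (pair g (\<S> X\<^sub>1 X\<^sub>2) (\<S> X\<^sub>3 X\<^sub>4) p - pair g (\<S> X\<^sub>1 X\<^sub>3) (\<S> X\<^sub>2 X\<^sub>4) p
        + pair g (\<S> X\<^sub>1 X\<^sub>4) (\<S> X\<^sub>2 X\<^sub>3) p)"
proof -
  have J: "pair g (\<S> (\<S> X\<^sub>1 X\<^sub>2) X\<^sub>3) X\<^sub>4 p + pair g (\<S> (\<S> X\<^sub>2 X\<^sub>3) X\<^sub>1) X\<^sub>4 p
      + pair g (\<S> (\<S> X\<^sub>3 X\<^sub>1) X\<^sub>2) X\<^sub>4 p = act rho X\<^sub>4 (cyc X\<^sub>1 X\<^sub>2 X\<^sub>3) p / 6"
  proof -
    have "pair g (\<S> (\<S> X\<^sub>1 X\<^sub>2) X\<^sub>3 + \<S> (\<S> X\<^sub>2 X\<^sub>3) X\<^sub>1 + \<S> (\<S> X\<^sub>3 X\<^sub>1) X\<^sub>2) X\<^sub>4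
        = pair g ((1/6) *\<^sub>R \<D> (cyc X\<^sub>1 X\<^sub>2 X\<^sub>3)) X\<^sub>4"
      using X by (simp only: skew_bracket_jacobi)
    then have "(pair g (\<S> (\<S> X\<^sub>1 X\<^sub>2) X\<^sub>3) X\<^sub>4 + pair g (\<S> (\<S> X\<^sub>2 X\<^sub>3) X\<^sub>1) X\<^sub>4
        + pair g (\<S> (\<S> X\<^sub>3 X\<^sub>1) X\<^sub>2) X\<^sub>4) p = ((1/6) *\<^sub>R act rho X\<^sub>4 (cyc X\<^sub>1 X\<^sub>2 X\<^sub>3)) p"
      using X by (simp add: pair_add_left pair_scale_left pair_courant_D_left closure_rules)
    then show ?thesis by (simp add: scaleR_fun_apply)
  qed
  have split: "act rho X\<^sub>4 (cyc X\<^sub>1 X\<^sub>2 X\<^sub>3) p = act rho X\<^sub>4 (pair g (\<S> X\<^sub>1 X\<^sub>2) X\<^sub>3) p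
      + act rho X\<^sub>4 (pair g (\<S> X\<^sub>2 X\<^sub>3) X\<^sub>1) p + act rho X\<^sub>4 (pair g (\<S> X\<^sub>3 X\<^sub>1) X\<^sub>2) p"
    using X by (simp add: act_add_right closure_rules)
  have swap: "act rho X\<^sub>2 (cyc X\<^sub>1 X\<^sub>3 X\<^sub>4) p = - act rho X\<^sub>2 (cyc X\<^sub>3 X\<^sub>1 X\<^sub>4) p"
    using X cyc_swap[of X\<^sub>3 X\<^sub>1 X\<^sub>4] act_scale_right[of X\<^sub>2 "cyc X\<^sub>3 X\<^sub>1 X\<^sub>4" "-1"]
    by (simp only: scaleR_minus1_left uminus_apply closure_rules)
  have B: "pair g (\<S> X\<^sub>2 X\<^sub>3) (\<S> X\<^sub>1 X\<^sub>4) p = pair g (\<S> X\<^sub>1 X\<^sub>4) (\<S> X\<^sub>2 X\<^sub>3) p"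
    "pair g (\<S> X\<^sub>3 X\<^sub>1) (\<S> X\<^sub>2 X\<^sub>4) p = - pair g (\<S> X\<^sub>1 X\<^sub>3) (\<S> X\<^sub>2 X\<^sub>4) p"
    using X by (simp_all add: pair_commute[of "\<S> X\<^sub>2 X\<^sub>3"] skew_bracket_swap[of X\<^sub>1 X\<^sub>3]
        pair_minus_left closure_rules)
  have C: "pair g X\<^sub>2 X\<^sub>1 = pair g X\<^sub>1 X\<^sub>2" "pair g X\<^sub>3 X\<^sub>1 = pair g X\<^sub>1 X\<^sub>3" "pair g X\<^sub>3 X\<^sub>2 = pair g X\<^sub>2 X\<^sub>3"
    using X by (auto intro: pair_commute)
  \<comment> \<open>The iterated derivatives in the three nested pairings cancel against those in
    the three instances of \<open>act_cyc\<close>. Collecting the derivatives along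
    \<open>X\<^sub>4\<close> gives \<open>1/6 - 1/2 = -1/3\<close>, which explains the factor
    3.\<close>
  show ?thesis
    using J split
      pair_skew_bracket_skew_bracket[OF X(1,2,3,4), of p] pair_skew_bracket_skew_bracket[OF X(2,3,1,4), of p]
      pair_skew_bracket_skew_bracket[OF X(3,1,2,4), of p]
      act_cyc[OF X(1,2,4,3), of p] act_cyc[OF X(2,3,4,1), of p] act_cyc[OF X(3,1,4,2), of p]
    unfolding swap B C by argo
qed

text \<open>Expanding each term by \<open>cyc_eq'\<close>, every pairing of two brackets occurs
  twice, and the derivatives regroup into \<open>3/2\<close> times the alternating sum on the right.
  The previous identity turns the pairings into \<open>-2\<close> times that sum, and
  \<open>-2 + 3/2 = -1/2\<close>.\<close>

lemma cyc_skew_bracket_quaternary: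
  assumes X: "X\<^sub>1 \<in> \<Gamma>" "X\<^sub>2 \<in> \<Gamma>" "X\<^sub>3 \<in> \<Gamma>" "X\<^sub>4 \<in> \<Gamma>"
  shows "cyc (\<S> X\<^sub>1 X\<^sub>2) X\<^sub>3 X\<^sub>4 p - cyc (\<S> X\<^sub>1 X\<^sub>3) X\<^sub>2 X\<^sub>4 p + cyc (\<S> X\<^sub>1 X\<^sub>4) X\<^sub>2 X\<^sub>3 p
      + cyc (\<S> X\<^sub>2 X\<^sub>3) X\<^sub>1 X\<^sub>4 p - cyc (\<S> X\<^sub>2 X\<^sub>4) X\<^sub>1 X\<^sub>3 p + cyc (\<S> X\<^sub>3 X\<^sub>4) X\<^sub>1 X\<^sub>2 p
    = - (act rho X\<^sub>4 (cyc X\<^sub>1 X\<^sub>2 X\<^sub>3) p - act rho X\<^sub>3 (cyc X\<^sub>1 X\<^sub>2 X\<^sub>4) p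
      + act rho X\<^sub>2 (cyc X\<^sub>1 X\<^sub>3 X\<^sub>4) p - act rho X\<^sub>1 (cyc X\<^sub>2 X\<^sub>3 X\<^sub>4) p) / 2"
proof -
  have S: "\<S> X Y \<in> \<Gamma>" if "X \<in> \<Gamma>" "Y \<in> \<Gamma>" for X Y
    using that by (rule skew_bracket_closed)
  have c: "cyc (\<S> X Y) Z W p = 3 * pair g (\<S> Z W) (\<S> X Y) p
      + 3/2 * (act rho W (pair g (\<S> X Y) Z) p - act rho Z (pair g (\<S> X Y) W) p)"
    if "X \<in> \<Gamma>" "Y \<in> \<Gamma>" "Z \<in> \<Gamma>" "W \<in> \<Gamma>" for X Y Z W
    unfolding cyc_eq'[OF S[OF that(1,2)] that(3,4)] by (simp add: scaleR_fun_apply)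
  have split: "act rho W (cyc X Y Z) p = act rho W (pair g (\<S> X Y) Z) p
      + act rho W (pair g (\<S> Y Z) X) p - act rho W (pair g (\<S> X Z) Y) p"
    if "X \<in> \<Gamma>" "Y \<in> \<Gamma>" "Z \<in> \<Gamma>" "W \<in> \<Gamma>" for X Y Z W
    using that act_scale_right[of W "pair g (\<S> X Z) Y" "-1"]
    by (simp add: act_add_right act_diff_right closure_rules skew_bracket_swap[of X Z] pair_minus_left)
  have B: "pair g (\<S> X\<^sub>3 X\<^sub>4) (\<S> X\<^sub>1 X\<^sub>2) p = pair g (\<S> X\<^sub>1 X\<^sub>2) (\<S> X\<^sub>3 X\<^sub>4) p"
    "pair g (\<S> X\<^sub>2 X\<^sub>4) (\<S> X\<^sub>1 X\<^sub>3) p = pair g (\<S> X\<^sub>1 X\<^sub>3) (\<S> X\<^sub>2 X\<^sub>4) p"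
    "pair g (\<S> X\<^sub>2 X\<^sub>3) (\<S> X\<^sub>1 X\<^sub>4) p = pair g (\<S> X\<^sub>1 X\<^sub>4) (\<S> X\<^sub>2 X\<^sub>3) p"
    using X by (simp_all add: pair_commute[of "\<S> X\<^sub>3 X\<^sub>4"] pair_commute[of "\<S> X\<^sub>2 X\<^sub>4" "\<S> X\<^sub>1 X\<^sub>3"]
        pair_commute[of "\<S> X\<^sub>2 X\<^sub>3" "\<S> X\<^sub>1 X\<^sub>4"] S)
  show ?thesis
    using skew_bracket_quaternary[OF X, of p]
      split[OF X(1,2,3,4)] split[OF X(1,2,4,3)] split[OF X(1,3,4,2)] split[OF X(2,3,4,1)]
    unfolding c[OF X(1,2,3,4)] c[OF X(1,3,2,4)] c[OF X(1,4,2,3)] c[OF X(2,3,1,4)] c[OF X(2,4,1,3)]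
      c[OF X(3,4,1,2)] B
    by argo
qed

section \<open>Grading, multilinearity and skew symmetry on \<open>L(E)\<close>\<close>

abbreviation "\<L> \<equiv> courant_L A E T"
abbreviation "\<l> \<equiv> courant_l E g br rho"

lemma courant_l_simps:
  shows "\<l> 1 [(f, X)] = (0, \<D> f)"
    and "\<lbrakk>f \<in> C_inf A; X \<in> \<Gamma>; h \<in> C_inf A; Y \<in> \<Gamma>\<rbrakk>
      \<Longrightarrow> \<l> 2 [(f, X), (h, Y)] = ((1/2) *\<^sub>R act rho X h - (1/2) *\<^sub>R act rho Y f, \<S> X Y)"
    and "\<l> 3 [(f, X), (h, Y), (k, Z)] = ((-1/6) *\<^sub>R cyc X Y Z, 0)"
    and "n > 3 \<Longrightarrow> \<l> n xs = 0"
  by (simp_all add: courant_l_def courant_l1_def courant_l2_def courant_l3_def pair_courant_D_right)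

lemma zero_in_courant_L: "0 \<in> \<L> d"
  by (simp add: courant_L_def C_inf_zero section_zero zero_prod_def)

lemma courant_L_cases:
  assumes "x \<in> \<L> d" "x \<noteq> 0"
  obtains f where "d = -1" "f \<in> C_inf A" "x = (f, 0)"
  | X where "d = 0" "X \<in> \<Gamma>" "x = (0, X)"
  using assms by (auto simp: courant_L_def split: if_splits)

lemma courant_L_trivial: "d \<noteq> 0 \<Longrightarrow> d \<noteq> -1 \<Longrightarrow> \<L> d = {0}"
  by (simp add: courant_L_def)

lemma courant_L_memI:
  shows "f \<in> C_inf A \<Longrightarrow> (f, 0) \<in> \<L> (-1)" "X \<in> \<Gamma> \<Longrightarrow> (0, X) \<in> \<L> 0"
  by (simp_all add: courant_L_def)

lemma subspace_courant_L: "subspace (\<L> d)"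
  unfolding courant_L_def
  by (auto intro!: subspace_Times subspace_C_inf subspace_sections)

lemma graded_total_courant_L:
  assumes "x \<in> graded_total \<L>"
  shows "fst x \<in> C_inf A" "snd x \<in> \<Gamma>"
proof -
  have "graded_total \<L> \<subseteq> C_inf A \<times> \<Gamma>"
    unfolding graded_total_def
  proof (rule span_minimal)
    show "(\<Union>d. \<L> d) \<subseteq> C_inf A \<times> \<Gamma>"
      by (auto simp: courant_L_def C_inf_zero section_zero zero_prod_def split: if_splits)
    show "subspace (C_inf A \<times> \<Gamma>)"
      by (intro subspace_Times subspace_C_inf subspace_sections)
  qed
  with assms show "fst x \<in> C_inf A" "snd x \<in> \<Gamma>" by auto
qed

lemma graded_vector_space_courant_L: "graded_vector_space \<L>"
  unfolding graded_vector_space_def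
proof (intro conjI allI impI subspace_courant_L ballI)
  fix I x d assume *: "finite I \<and> (\<forall>d\<in>I. x d \<in> \<L> d) \<and> sum x I = 0" and d: "d \<in> I"
  show "x d = 0"
  proof (rule ccontr)
    assume nz: "x d \<noteq> 0"
    \<comment> \<open>Degree -1 alone has function components and degree 0 alone has section
      components, so projecting the vanishing sum isolates one summand.\<close>
    have f: "fst (x e) = 0" if "e \<in> I" "e \<noteq> -1" for e
      using * that by (force simp: courant_L_def split: if_splits)
    have s: "snd (x e) = 0" if "e \<in> I" "e \<noteq> 0" for e
      using * that by (force simp: courant_L_def split: if_splits)
    have "x d \<in> \<L> d" using * d by blast
    then show False
      using nz
    proof (cases rule: courant_L_cases)
      case (1 h)
      have "0 = (\<Sum>e\<in>I. fst (x e))" using * by (simp flip: fst_sum)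
      also have "\<dots> = (\<Sum>e\<in>I. if e = d then h else 0)"
        using f 1 by (intro sum.cong) auto
      also have "\<dots> = h" using * d by simp
      finally show False using 1 nz by (simp add: zero_prod_def)
    next
      case (2 X)
      have "0 = (\<Sum>e\<in>I. snd (x e))" using * by (simp flip: snd_sum)
      also have "\<dots> = (\<Sum>e\<in>I. if e = d then X else 0)"
        using s 2 by (intro sum.cong) auto
      also have "\<dots> = X" using * d by simp
      finally show False using 2 nz by (simp add: zero_prod_def)
    qed
  qed
qed

lemma cyc_add_scale:
  assumes "X \<in> \<Gamma>" "X' \<in> \<Gamma>" "Y \<in> \<Gamma>" "Z \<in> \<Gamma>"
  shows "cyc (X + X') Y Z = cyc X Y Z + cyc X' Y Z" "cyc (c *\<^sub>R X) Y Z = c *\<^sub>R cyc X Y Z"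
  using assms
  by (simp_all add: skew_bracket_add_left skew_bracket_add_right skew_bracket_scale_left
      skew_bracket_scale_right pair_add_left pair_add_right pair_scale_left pair_scale_right
      closure_rules algebra_simps)

lemma cyc_rotate: "cyc Y Z X = cyc X Y Z" "cyc Z X Y = cyc X Y Z"
  by (simp_all add: algebra_simps)

lemma multilinear_courant_l:
  assumes "k \<ge> 1"
  shows "multilinear_on (graded_total \<L>) k (\<l> k)"
  unfolding multilinear_on_def
proof (intro allI impI, elim conjE)
  fix xs i x y and c :: real
  assume len: "length xs = k" and xs: "set xs \<subseteq> graded_total \<L>" and i: "i < k"
    and x: "x \<in> graded_total \<L>" and y: "y \<in> graded_total \<L>"
  have mem: "\<And>z. z \<in> set xs \<Longrightarrow> fst z \<in> C_inf A \<and> snd z \<in> \<Gamma>"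
    using xs graded_total_courant_L by blast
  obtain f X where fX: "x = (f, X)" "f \<in> C_inf A" "X \<in> \<Gamma>"
    using graded_total_courant_L[OF x] by (cases x) auto
  obtain h Y where hY: "y = (h, Y)" "h \<in> C_inf A" "Y \<in> \<Gamma>"
    using graded_total_courant_L[OF y] by (cases y) auto
  consider "k = 1" | "k = 2" | "k = 3" | "k > 3" using assms by linarith
  then show "\<l> k (xs[i := x + y]) = \<l> k (xs[i := x]) + \<l> k (xs[i := y]) \<and>
      \<l> k (xs[i := c *\<^sub>R x]) = c *\<^sub>R \<l> k (xs[i := x])"
  proof cases
    case 1
    then obtain a where "xs = [a]" using len by (auto simp: length_Suc_conv)
    then show ?thesis
      using 1 i fX hY courant_l_simps(1)
      by (simp add: courant_D_add courant_D_scale closure_rules)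
  next
    case 2
    then obtain a b where xs': "xs = [a, b]" using len length_2_cases by blast
    obtain u U v V where ab: "a = (u, U)" "u \<in> C_inf A" "U \<in> \<Gamma>" "b = (v, V)" "v \<in> C_inf A" "V \<in> \<Gamma>"
      using mem[of a] mem[of b] xs' by (cases a, cases b) auto
    have "i = 0 \<or> i = 1" using i 2 by linarith
    then show ?thesis
      using fX hY ab
      by (elim disjE) (simp_all add: 2 xs' courant_l_simps(2) closure_rules act_add_left act_add_right
          act_scale_left act_scale_right skew_bracket_add_left skew_bracket_add_right
          skew_bracket_scale_left skew_bracket_scale_right algebra_simps)
  next
    case 3
    then obtain a b d where xs': "xs = [a, b, d]" using len length_3_cases by blast
    obtain u U v V w W where ab: "a = (u, U)" "U \<in> \<Gamma>" "b = (v, V)" "V \<in> \<Gamma>" "d = (w, W)" "W \<in> \<Gamma>"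
      using mem[of a] mem[of b] mem[of d] xs' by (cases a, cases b, cases d) auto
    have "i = 0 \<or> i = 1 \<or> i = 2" using i 3 by linarith
    then show ?thesis
    proof (elim disjE)
      assume "i = 0"
      then show ?thesis
        using fX hY ab cyc_add_scale(1)[of X Y V W] cyc_add_scale(2)[of X Y V W c]
        by (simp add: 3 xs' courant_l_simps(3) algebra_simps)
    next
      \<comment> \<open>The cyclic sum is rotated so that the varied argument comes first, where
        \<open>cyc_add_scale\<close> applies.\<close>
      assume "i = 1"
      then show ?thesis
        using fX hY ab cyc_add_scale(1)[of X Y W U] cyc_add_scale(2)[of X Y W U c]
        by (simp add: 3 xs' courant_l_simps(3) algebra_simps)
    next
      assume "i = 2"
      then show ?thesis
        using fX hY ab cyc_add_scale(1)[of X Y U V] cyc_add_scale(2)[of X Y U V c]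
        by (simp add: 3 xs' courant_l_simps(3) algebra_simps)
    qed
  next
    case 4
    then show ?thesis by (simp add: courant_l_simps(4))
  qed
qed

lemma courant_l_eq_zero:
  assumes "k \<ge> 1" "length xs = k" "homogeneous \<L> ds xs" "0 \<in> set xs"
  shows "\<l> k xs = 0"
  using multilinear_on_zero[OF multilinear_courant_l[OF assms(1)] assms(2)
      homogeneous_subset_graded_total[OF assms(3)] assms(4)] .

lemma courant_l_degree:
  assumes k: "k \<ge> 1" and len: "length xs = k" and hom: "homogeneous \<L> ds xs"
  shows "\<l> k xs \<in> \<L> (sum_list ds + 2 - int k)"
proof (cases "0 \<in> set xs")
  case True
  then show ?thesis using courant_l_eq_zero[OF assms] by (simp add: zero_in_courant_L)
next
  case nz: False
  have lds: "length ds = k" using hom len by (auto simp: homogeneous_def dest: list_all2_lengthD)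
  consider "k = 1" | "k = 2" | "k = 3" | "k > 3" using k by linarith
  then show ?thesis
  proof cases
    case 1
    then obtain a d where xs: "xs = [a]" "ds = [d]" using len lds by (auto simp: length_Suc_conv)
    have "a \<in> \<L> d" "a \<noteq> 0" using hom nz by (auto simp: xs homogeneous_def)
    then show ?thesis
      by (cases rule: courant_L_cases)
        (use 1 xs in \<open>simp_all add: courant_l_simps(1)[simplified] courant_D_zero zero_in_courant_L
          courant_L_memI closure_rules flip: zero_prod_def\<close>)
  next
    case 2
    obtain a b where ab: "xs = [a, b]" using len length_2_cases 2 by blast
    obtain d e where de: "ds = [d, e]" using lds length_2_cases 2 by blast
    have "a \<in> \<L> d" "a \<noteq> 0" "b \<in> \<L> e" "b \<noteq> 0" using hom nz by (auto simp: ab de homogeneous_def)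
    then show ?thesis
      by (elim courant_L_cases)
        (use 2 ab de in \<open>simp_all add: courant_l_simps(2) zero_in_courant_L
          courant_L_memI zero_rules closure_rules flip: zero_prod_def scaleR_minus_left\<close>)
  next
    case 3
    obtain a b c where ab: "xs = [a, b, c]" using len length_3_cases 3 by blast
    obtain d e m where de: "ds = [d, e, m]" using lds length_3_cases 3 by blast
    have "a \<in> \<L> d" "a \<noteq> 0" "b \<in> \<L> e" "b \<noteq> 0" "c \<in> \<L> m" "c \<noteq> 0"
      using hom nz by (auto simp: ab de homogeneous_def)
    then show ?thesis
      by (elim courant_L_cases)
        (use 3 ab de in \<open>simp_all add: courant_l_simps(3) zero_in_courant_L
          courant_L_memI zero_rules pair_zero_left pair_zero_right closure_rules
          flip: zero_prod_def scaleR_minus_left\<close>)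
  next
    case 4
    then show ?thesis by (simp add: courant_l_simps(4) zero_in_courant_L)
  qed
qed

lemma graded_skew_symmetric_courant_l:
  assumes k: "k \<ge> 1"
  shows "graded_skew_symmetric \<L> k (\<l> k)"
  unfolding graded_skew_symmetric_def
proof (intro allI impI, elim conjE)
  fix ds xs and \<sigma> :: "nat \<Rightarrow> nat"
  assume len: "length xs = k" and hom: "homogeneous \<L> ds xs" and \<sigma>: "\<sigma> permutes {..<k}"
  have lds: "length ds = k" using hom len by (auto simp: homogeneous_def dest: list_all2_lengthD)
  have mem: "\<And>z. z \<in> set xs \<Longrightarrow> fst z \<in> C_inf A \<and> snd z \<in> \<Gamma>"
    using homogeneous_subset_graded_total[OF hom] graded_total_courant_L by blast
  show "\<l> k (map (\<lambda>a. xs ! \<sigma> a) [0..<k]) = chi ds \<sigma> *\<^sub>R \<l> k xs"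
  proof (cases "0 \<in> set xs")
    case True
    have "set (map (\<lambda>a. xs ! \<sigma> a) [0..<k]) = (\<lambda>a. xs ! a) ` \<sigma> ` {..<k}"
      by (auto simp: atLeast0LessThan)
    also have "\<dots> = set xs"
      unfolding permutes_image[OF \<sigma>] using len by (simp add: set_conv_nth image_def lessThan_def) blast
    finally have zero: "0 \<in> set (map (\<lambda>a. xs ! \<sigma> a) [0..<k])" using True by simp
    have hom': "homogeneous \<L> (map (\<lambda>k. ds ! \<sigma> k) [0..<k]) (map (\<lambda>a. xs ! \<sigma> a) [0..<k])"
      using homogeneous_permuted[OF hom, of \<sigma>] \<sigma> len by simp
    have "\<l> k (map (\<lambda>a. xs ! \<sigma> a) [0..<k]) = 0"
      by (rule courant_l_eq_zero[OF k _ hom' zero]) simp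
    then show ?thesis
      using courant_l_eq_zero[OF k len hom True] by simp
  next
    case nz: False
    consider "k = 1" | "k = 2" | "k = 3" | "k > 3" using k by linarith
    then show ?thesis
    proof cases
      case 1
      have "\<sigma> = id"
      proof (rule permutes_lessThan_eqI[OF \<sigma> permutes_id])
        show "\<sigma> j = id j" if "j < k" for j
          using that permutes_lessThan_less[OF \<sigma> that] 1 by simp
      qed
      then show ?thesis using map_nth[of xs] len by (simp add: chi_id)
    next
      case 2
      obtain a b where ab: "xs = [a, b]" using len length_2_cases 2 by blast
      obtain d e where de: "ds = [d, e]" using lds length_2_cases 2 by blast
      have ab': "a \<in> \<L> d" "a \<noteq> 0" "b \<in> \<L> e" "b \<noteq> 0" using hom nz by (auto simp: ab de homogeneous_def)
      have "\<l> 2 [b, a] = chi ds (swp 0 1) *\<^sub>R \<l> 2 [a, b]"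
      proof (cases "d * e = 0")
        case True
        obtain u U v V where uv: "a = (u, U)" "u \<in> C_inf A" "U \<in> \<Gamma>" "b = (v, V)" "v \<in> C_inf A" "V \<in> \<Gamma>"
          using mem[of a] mem[of b] ab by (cases a, cases b) auto
        have "chi ds (swp 0 1) = -1" using True by (intro chi_swap) (simp_all add: de)
        then show ?thesis
          using uv skew_bracket_swap[of U V] by (simp add: courant_l_simps(2))
      next
        \<comment> \<open>Both arguments are functions, on which \<open>l_2\<close> vanishes, so the
          sign is immaterial.\<close>
        case False
        then obtain u v where "a = (u, 0)" "u \<in> C_inf A" "b = (v, 0)" "v \<in> C_inf A"
          using ab' by (elim courant_L_cases) auto
        then show ?thesis
          by (simp add: courant_l_simps(2) zero_rules section_zero flip: zero_prod_def)
      qed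
      then show ?thesis
        using permutes_lessThan_2[of \<sigma>] \<sigma> 2
        by (auto simp: ab chi_id upt_small Transposition.transpose_def)
    next
      case 3
      obtain a b c where ab: "xs = [a, b, c]" using len length_3_cases 3 by blast
      obtain d e m where de: "ds = [d, e, m]" using lds length_3_cases 3 by blast
      have ab': "a \<in> \<L> d" "a \<noteq> 0" "b \<in> \<L> e" "b \<noteq> 0" "c \<in> \<L> m" "c \<noteq> 0"
        using hom nz by (auto simp: ab de homogeneous_def)
      obtain u U v V w W where uv: "a = (u, U)" "U \<in> \<Gamma>" "b = (v, V)" "V \<in> \<Gamma>" "c = (w, W)" "W \<in> \<Gamma>"
        using mem[of a] mem[of b] mem[of c] ab by (cases a, cases b, cases c) auto
      have cyc_perm: "cyc V U W = - cyc U V W" "cyc U W V = - cyc U V W" "cyc W V U = - cyc U V W"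
        "cyc V W U = cyc U V W" "cyc W U V = cyc U V W"
        using cyc_swap[OF uv(2,4,6)] cyc_rotate(1)[of V U W] cyc_rotate(2)[of U W V]
          cyc_rotate[of U V W] cyc_rotate[of V U W] by metis+
      show ?thesis
      proof (cases "d = 0 \<and> e = 0 \<and> m = 0")
        case True
        have "chi ds \<sigma> = of_int (sign \<sigma>)"
        proof (rule chi_eq_sign)
          show "\<sigma> permutes {..<length ds}" using \<sigma> by (simp only: lds)
        qed (use True in \<open>auto simp: de nth_Cons'\<close>)
        moreover have "\<l> 3 [(v, V), (u, U), (w, W)] = - \<l> 3 [(u, U), (v, V), (w, W)]"
          "\<l> 3 [(u, U), (w, W), (v, V)] = - \<l> 3 [(u, U), (v, V), (w, W)]"
          "\<l> 3 [(w, W), (v, V), (u, U)] = - \<l> 3 [(u, U), (v, V), (w, W)]"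
          "\<l> 3 [(v, V), (w, W), (u, U)] = \<l> 3 [(u, U), (v, V), (w, W)]"
          "\<l> 3 [(w, W), (u, U), (v, V)] = \<l> 3 [(u, U), (v, V), (w, W)]"
          unfolding courant_l_simps(3) cyc_perm by (simp_all add: algebra_simps)
        ultimately show ?thesis
          using permutes_lessThan_3[of \<sigma>] \<sigma> 3
          by (auto simp: ab uv upt_small Transposition.transpose_def sign_simps)
      next
        \<comment> \<open>A function among the arguments has section component 0, which makes all
          six values vanish whatever the sign is.\<close>
        case False
        then have "U = 0 \<or> V = 0 \<or> W = 0"
          using ab' by (elim courant_L_cases) (auto simp: uv)
        then have "cyc U V W = 0" using uv cyc_zero by blast
        then show ?thesis
          using permutes_lessThan_3[of \<sigma>] \<sigma> 3
          by (auto simp: ab uv upt_small Transposition.transpose_def courant_l_simps(3) cyc_perm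
              simp flip: zero_prod_def)
      qed
    next
      case 4
      then show ?thesis by (simp add: courant_l_simps(4))
    qed
  qed
qed

section \<open>The generalised Jacobi identities on \<open>L(E)\<close>\<close>

lemma courant_l_homogeneous:
  assumes "f \<in> C_inf A" "X \<in> \<Gamma>" "Y \<in> \<Gamma>" "Z \<in> \<Gamma>"
  shows "\<l> 1 [(f, 0)] = (0, \<D> f)" "\<l> 1 [(0, X)] = 0" "\<l> 1 [0] = 0"
    and "\<l> 2 [(0, X), (0, Y)] = (0, \<S> X Y)" "h \<in> C_inf A \<Longrightarrow> \<l> 2 [(f, 0), (h, 0)] = 0"
    and "\<l> 2 [(f, 0), (0, X)] = (- (1/2) *\<^sub>R act rho X f, 0)"
    and "\<l> 2 [(0, X), (f, 0)] = ((1/2) *\<^sub>R act rho X f, 0)"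
    and "\<l> 3 [(0, X), (0, Y), (0, Z)] = (- (1/6) *\<^sub>R cyc X Y Z, 0)"
    and "\<l> 3 [(f, 0), (0, X), (0, Y)] = 0" "\<l> 3 [(0, X), (f, 0), (0, Y)] = 0"
    and "\<l> 3 [(0, X), (0, Y), (f, 0)] = 0" "\<l> 3 [0, (0, X), (0, Y)] = 0"
    and "\<l> 3 [0, (f, 0), (0, Y)] = 0" "\<l> 3 [0, (0, X), (f, 0)] = 0"
    and "\<l> 2 [0, (0, X)] = 0" "\<l> 2 [0, (f, 0)] = 0"
    and "\<l> 3 [(0, \<D> f), (0, X), (0, Y)]
      = ((1/4) *\<^sub>R act rho Y (act rho X f) - (1/4) *\<^sub>R act rho X (act rho Y f), 0)"
  using assms cyc_zero[of X Y] cyc_zero[of 0 X] cyc_zero[of 0 Y] cyc_zero[of X 0] cyc_zero[of Y 0]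
  by (simp_all add: courant_l_simps(1-3) courant_D_zero zero_rules section_zero C_inf_zero
      cyc_courant_D zero_prod_def scaleR_diff_right del: One_nat_def)

text \<open>By \<open>cyc_courant_D\<close> the term with \<open>l_3\<close> gives
  \<open>(-1/6) * (3/2) = -1/4\<close> times the commutator of the two derivatives of
  \<open>f\<close>. The terms with \<open>l_2\<close> give \<open>1/2 - 1/4 = 1/4\<close> times it.
  The three statements differ in the position of the function and, for the middle one, by an overall
  sign.\<close>

lemma courant_l_jacobi_one_function:
  assumes f: "f \<in> C_inf A" and X: "X \<in> \<Gamma>" and Y: "Y \<in> \<Gamma>"
  defines "a \<equiv> (f, 0)" and "b \<equiv> (0, X)" and "c \<equiv> (0, Y)"
  shows "(\<l> 3 [\<l> 1 [a], b, c] - \<l> 3 [\<l> 1 [b], a, c] + \<l> 3 [\<l> 1 [c], a, b])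
      + (\<l> 2 [\<l> 2 [a, b], c] - \<l> 2 [\<l> 2 [a, c], b] + \<l> 2 [\<l> 2 [b, c], a]) + \<l> 1 [\<l> 3 [a, b, c]] = 0"
    and "(\<l> 3 [\<l> 1 [b], a, c] - \<l> 3 [\<l> 1 [a], b, c] + \<l> 3 [\<l> 1 [c], b, a])
      + (\<l> 2 [\<l> 2 [b, a], c] - \<l> 2 [\<l> 2 [b, c], a] + \<l> 2 [\<l> 2 [a, c], b]) + \<l> 1 [\<l> 3 [b, a, c]] = 0"
    and "(\<l> 3 [\<l> 1 [b], c, a] - \<l> 3 [\<l> 1 [c], b, a] + \<l> 3 [\<l> 1 [a], b, c])
      + (\<l> 2 [\<l> 2 [b, c], a] - \<l> 2 [\<l> 2 [b, a], c] + \<l> 2 [\<l> 2 [c, a], b]) + \<l> 1 [\<l> 3 [b, c, a]] = 0"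
proof -
  note ev = courant_l_homogeneous[OF f X Y X] courant_l_homogeneous[OF f Y X X]
  have l1: "\<l> 1 [a] = (0, \<D> f)" "\<l> 1 [b] = 0" "\<l> 1 [c] = 0" "\<l> 1 [\<l> 3 [a, b, c]] = 0"
    "\<l> 1 [\<l> 3 [b, a, c]] = 0" "\<l> 1 [\<l> 3 [b, c, a]] = 0"
    and l3: "\<l> 3 [0, a, b] = 0" "\<l> 3 [0, a, c] = 0" "\<l> 3 [0, b, a] = 0" "\<l> 3 [0, c, a] = 0"
      "\<l> 3 [(0, \<D> f), b, c] = ((1/4) *\<^sub>R act rho Y (act rho X f) - (1/4) *\<^sub>R act rho X (act rho Y f), 0)"
    unfolding a_def b_def c_def by (simp_all only: ev)
  have half: "(1/2) *\<^sub>R act rho Z f \<in> C_inf A" "- (1/2) *\<^sub>R act rho Z f \<in> C_inf A" if "Z \<in> \<Gamma>" for Z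
    by (intro C_inf_scale act_closed that f)+
  have scale: "act rho Z (c *\<^sub>R act rho W f) = c *\<^sub>R act rho Z (act rho W f)" if "Z \<in> \<Gamma>" "W \<in> \<Gamma>" for Z W c
    using that f by (intro act_scale_right closure_rules)
  have S: "\<S> X Y \<in> \<Gamma>" using X Y by (rule skew_bracket_closed)
  have l2: "\<l> 2 [\<l> 2 [a, b], c] = ((1/4) *\<^sub>R act rho Y (act rho X f), 0)"
    "\<l> 2 [\<l> 2 [b, a], c] = (- (1/4) *\<^sub>R act rho Y (act rho X f), 0)"
    "\<l> 2 [\<l> 2 [a, c], b] = ((1/4) *\<^sub>R act rho X (act rho Y f), 0)"
    "\<l> 2 [\<l> 2 [c, a], b] = (- (1/4) *\<^sub>R act rho X (act rho Y f), 0)"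
    "\<l> 2 [\<l> 2 [b, c], a] = ((1/2) *\<^sub>R (act rho X (act rho Y f) - act rho Y (act rho X f)), 0)"
    unfolding a_def b_def c_def
    by (simp_all add: ev courant_l_homogeneous(6,7)[OF half(1)[OF X] Y X X]
        courant_l_homogeneous(6,7)[OF half(2)[OF X] Y X X] courant_l_homogeneous(6,7)[OF half(1)[OF Y] X X X]
        courant_l_homogeneous(6,7)[OF half(2)[OF Y] X X X] courant_l_homogeneous(7)[OF f S X X]
        act_skew_bracket[OF X Y f] scale X Y del: scaleR_minus_left)
  show "(\<l> 3 [\<l> 1 [a], b, c] - \<l> 3 [\<l> 1 [b], a, c] + \<l> 3 [\<l> 1 [c], a, b])
      + (\<l> 2 [\<l> 2 [a, b], c] - \<l> 2 [\<l> 2 [a, c], b] + \<l> 2 [\<l> 2 [b, c], a]) + \<l> 1 [\<l> 3 [a, b, c]] = 0"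
    and "(\<l> 3 [\<l> 1 [b], a, c] - \<l> 3 [\<l> 1 [a], b, c] + \<l> 3 [\<l> 1 [c], b, a])
      + (\<l> 2 [\<l> 2 [b, a], c] - \<l> 2 [\<l> 2 [b, c], a] + \<l> 2 [\<l> 2 [a, c], b]) + \<l> 1 [\<l> 3 [b, a, c]] = 0"
    and "(\<l> 3 [\<l> 1 [b], c, a] - \<l> 3 [\<l> 1 [c], b, a] + \<l> 3 [\<l> 1 [a], b, c])
      + (\<l> 2 [\<l> 2 [b, c], a] - \<l> 2 [\<l> 2 [b, a], c] + \<l> 2 [\<l> 2 [c, a], b]) + \<l> 1 [\<l> 3 [b, c, a]] = 0"
    unfolding l2 l3 l1
    by (auto intro!: prod_eqI ext simp: scaleR_fun_apply field_simps)
qed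

text \<open>The value has degree \<open>sum_list ds + 3 - n\<close>, which must be -1 or 0, while
  \<open>sum_list ds\<close> is minus the number of functions. This leaves two arguments with at
  least one function, three with at most one function, and four sections.\<close>

lemma courant_l_jacobi:
  assumes n: "n \<ge> 1" and len: "length xs = n" and hom: "homogeneous \<L> ds xs" and nz: "0 \<notin> set xs"
    and deg: "\<L> (sum_list ds + 3 - int n) \<noteq> {0}"
  shows "(\<Sum>(i, j)\<in>{(i, j). i \<ge> 1 \<and> j \<ge> 1 \<and> i + j = n + 1}. \<Sum>\<sigma>\<in>shuffle_perms i n.
        (chi ds \<sigma> * (-1) ^ (i * (j - 1))) *\<^sub>R nested \<l> \<l> j i \<sigma> xs) = 0"
proof -
  have lds: "length ds = n" using hom len by (auto simp: homogeneous_def dest: list_all2_lengthD)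
  have ds: "d = 0 \<or> d = -1" if d: "d \<in> set ds" for d
  proof -
    obtain k where k: "k < n" "d = ds ! k" using d lds by (auto simp: in_set_conv_nth)
    then have "xs ! k \<in> \<L> d" "xs ! k \<noteq> 0"
      using hom nz len by (auto simp: homogeneous_def list_all2_conv_all_nth in_set_conv_nth)
    then show ?thesis by (cases rule: courant_L_cases) auto
  qed
  have deg': "sum_list ds + 3 - int n = 0 \<or> sum_list ds + 3 - int n = -1"
    using deg courant_L_trivial by blast
  have "sum_list ds \<le> 0" using ds by (intro sum_list_nonpos) force
  then consider "n = 1" | "n = 2" | "n = 3" | "n = 4" using n deg' by linarith
  then show ?thesis
  proof cases
    case 1
    \<comment> \<open>A single argument would need degree -2 or -3; thus \<open>l_1\<close> squares
      to zero for degree reasons.\<close>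
    then obtain d where "ds = [d]" using lds by (auto simp: length_Suc_conv)
    with 1 ds deg' show ?thesis by auto
  next
    case 2
    obtain a b where ab: "xs = [a, b]" using len length_2_cases 2 by blast
    obtain d e where de: "ds = [d, e]" using lds length_2_cases 2 by blast
    have ab': "a \<in> \<L> d" "a \<noteq> 0" "b \<in> \<L> e" "b \<noteq> 0" using hom nz by (auto simp: ab de homogeneous_def)
    have de': "d + e \<noteq> 0" using deg' by (auto simp: 2 de)
    have chi: "chi ds (swp 0 1) = (if d * e = 0 then -1 else 1)"
    proof (cases "d * e = 0")
      case True
      then show ?thesis using chi_swap[of ds] by (simp add: de)
    next
      case False
      then have "ds = [-1, -1]" using ds by (auto simp: de)
      then show ?thesis using False chi_swap_odd by (simp add: de)
    qed
    \<comment> \<open>With one function the claim is \<open>skew_bracket_courant_D\<close>; with two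
      functions it follows from \<open>act_courant_D\<close>.\<close>
    show ?thesis
      unfolding 2 ab jacobi_sum_2 chi
      using ab' de' courant_l_homogeneous(3,16)[OF _ section_zero section_zero section_zero]
      by (elim courant_L_cases)
        (simp_all add: courant_l_simps(1,2) closure_rules zero_rules courant_D_zero act_courant_D
          skew_bracket_courant_D courant_D_scale
          flip: zero_prod_def scaleR_minus_left del: One_nat_def)
  next
    case 3
    obtain a b c where ab: "xs = [a, b, c]" using len length_3_cases 3 by blast
    obtain d e m where de: "ds = [d, e, m]" using lds length_3_cases 3 by blast
    have ab': "a \<in> \<L> d" "a \<noteq> 0" "b \<in> \<L> e" "b \<noteq> 0" "c \<in> \<L> m" "c \<noteq> 0"
      using hom nz by (auto simp: ab de homogeneous_def)
    have dem: "d + e + m \<ge> -1" using deg' by (auto simp: 3 de)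
    have "ds ! a * ds ! b = 0" if "a < 3" "b < 3" "a \<noteq> b" for a b
    proof -
      have "d * e = 0" "d * m = 0" "e * m = 0"
        using dem ds[of d] ds[of e] ds[of m] by (auto simp: de)
      moreover have "a = 0 \<or> a = 1 \<or> a = 2" "b = 0 \<or> b = 1 \<or> b = 2"
        using that by linarith+
      ultimately show ?thesis
        using that(3) by (elim disjE) (simp_all add: de mult.commute)
    qed
    then have "\<forall>a<3. \<forall>b<3. a \<noteq> b \<longrightarrow> ds ! a * ds ! b = 0" by blast
    note n3 = 3 and J = jacobi_sum_3[OF lds[unfolded 3] this, of \<l> a b c]
    consider "d = 0" "e = 0" "m = 0" | "d = -1" "e = 0" "m = 0" | "d = 0" "e = -1" "m = 0"
      | "d = 0" "e = 0" "m = -1"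
      using dem ds[of d] ds[of e] ds[of m] by (auto simp: de)
    then show ?thesis
    proof cases
      case 1
      then obtain X Y Z where X: "X \<in> \<Gamma>" "Y \<in> \<Gamma>" "Z \<in> \<Gamma>" "a = (0, X)" "b = (0, Y)" "c = (0, Z)"
        using ab' by (elim courant_L_cases) auto
      note ev = courant_l_homogeneous[OF C_inf_zero]
      have swap: "\<S> (\<S> X Z) Y = - \<S> (\<S> Z X) Y"
        using X by (simp add: skew_bracket_swap[of Z X] skew_bracket_minus_left closure_rules)
      have D: "\<D> ((-1/6) *\<^sub>R cyc X Y Z) = (-1/6) *\<^sub>R \<D> (cyc X Y Z)"
        using X by (intro courant_D_scale closure_rules)
      have "\<S> (\<S> X Y) Z - \<S> (\<S> X Z) Y + \<S> (\<S> Y Z) X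
          = \<S> (\<S> X Y) Z + \<S> (\<S> Y Z) X + \<S> (\<S> Z X) Y"
        unfolding swap by simp
      then have key: "\<S> (\<S> X Y) Z - \<S> (\<S> X Z) Y + \<S> (\<S> Y Z) X + \<D> ((-1/6) *\<^sub>R cyc X Y Z) = 0"
        unfolding D skew_bracket_jacobi[OF X(1-3)] by simp
      have l2: "\<l> 2 [\<l> 2 [(0, U), (0, V)], (0, W)] = (0, \<S> (\<S> U V) W)"
        if "U \<in> \<Gamma>" "V \<in> \<Gamma>" "W \<in> \<Gamma>" for U V W
        using that by (simp add: ev closure_rules)
      have l3: "\<l> 3 [\<l> 1 [(0, U)], (0, V), (0, W)] = 0" if "U \<in> \<Gamma>" "V \<in> \<Gamma>" "W \<in> \<Gamma>" for U V W
        unfolding ev(2)[OF that] by (rule ev(12)[OF that(2,3,1)])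
      have l1: "\<l> 1 [\<l> 3 [(0, X), (0, Y), (0, Z)]] = (0, \<D> ((-1/6) *\<^sub>R cyc X Y Z))"
        unfolding courant_l_simps(1,3) ..
      show ?thesis
        unfolding n3 ab J unfolding X(4-6) l2[OF X(1,2,3)] l2[OF X(1,3,2)] l2[OF X(2,3,1)]
          l3[OF X(1,2,3)] l3[OF X(2,1,3)] l3[OF X(3,1,2)] l1
        by (rule prod_eqI) (simp_all only: fst_add snd_add fst_diff snd_diff fst_conv snd_conv fst_zero
              snd_zero diff_self add_0_left add_0_right key)
    next
      case 2
      then obtain f X Y where X: "f \<in> C_inf A" "X \<in> \<Gamma>" "Y \<in> \<Gamma>" "a = (f, 0)" "b = (0, X)" "c = (0, Y)"
        using ab' by (elim courant_L_cases) auto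
      show ?thesis
        unfolding n3 ab J unfolding X(4-6) using X(1-3) by (rule courant_l_jacobi_one_function)
    next
      case 3
      then obtain f X Y where X: "f \<in> C_inf A" "X \<in> \<Gamma>" "Y \<in> \<Gamma>" "b = (f, 0)" "a = (0, X)" "c = (0, Y)"
        using ab' by (elim courant_L_cases) auto
      show ?thesis
        unfolding n3 ab J unfolding X(4-6) using X(1-3) by (rule courant_l_jacobi_one_function)
    next
      case 4
      then obtain f X Y where X: "f \<in> C_inf A" "X \<in> \<Gamma>" "Y \<in> \<Gamma>" "c = (f, 0)" "a = (0, X)" "b = (0, Y)"
        using ab' by (elim courant_L_cases) auto
      show ?thesis
        unfolding n3 ab J unfolding X(4-6) using X(1-3) by (rule courant_l_jacobi_one_function)
    qed
  next
    case 4
    obtain a b c d where ab: "xs = [a, b, c, d]" using len length_4_cases 4 by blast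
    obtain d1 d2 d3 d4 where de: "ds = [d1, d2, d3, d4]" using lds length_4_cases 4 by blast
    have ab': "a \<in> \<L> d1" "a \<noteq> 0" "b \<in> \<L> d2" "b \<noteq> 0" "c \<in> \<L> d3" "c \<noteq> 0" "d \<in> \<L> d4" "d \<noteq> 0"
      using hom nz by (auto simp: ab de homogeneous_def)
    have ds0: "d1 = 0" "d2 = 0" "d3 = 0" "d4 = 0"
      using deg' ds[of d1] ds[of d2] ds[of d3] ds[of d4] by (auto simp: 4 de)
    obtain X1 X2 X3 X4 where X: "X1 \<in> \<Gamma>" "X2 \<in> \<Gamma>" "X3 \<in> \<Gamma>" "X4 \<in> \<Gamma>"
      "a = (0, X1)" "b = (0, X2)" "c = (0, X3)" "d = (0, X4)"
      using ab' ds0 by (elim courant_L_cases) auto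
    have "ds ! a * ds ! b = 0" if "a < 4" "b < 4" "a \<noteq> b" for a b
      using that by (auto simp: de ds0 numeral_eq_Suc less_Suc_eq)
    then have "\<forall>a<4. \<forall>b<4. a \<noteq> b \<longrightarrow> ds ! a * ds ! b = 0" by blast
    note J = jacobi_sum_4[OF lds[unfolded 4] this, of \<l> a b c d]
    show ?thesis
      unfolding 4 ab
    proof (subst J)
      fix xs show "\<l> 4 xs = 0" by (simp add: courant_l_simps(4))
    next
      show "\<l> 1 [0] = 0" using courant_l_homogeneous(3)[OF C_inf_zero section_zero section_zero section_zero] .
    next
      have l32: "\<l> 3 [\<l> 2 [(0, X), (0, Y)], (0, Z), (0, W)] = (- (1/6) *\<^sub>R cyc (\<S> X Y) Z W, 0)"
        if "X \<in> \<Gamma>" "Y \<in> \<Gamma>" "Z \<in> \<Gamma>" "W \<in> \<Gamma>" for X Y Z W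
        using that by (simp add: courant_l_simps(2,3) C_inf_zero zero_rules)
      have l23: "\<l> 2 [\<l> 3 [(0, X), (0, Y), (0, Z)], (0, W)] = ((1/12) *\<^sub>R act rho W (cyc X Y Z), 0)"
        if "X \<in> \<Gamma>" "Y \<in> \<Gamma>" "Z \<in> \<Gamma>" "W \<in> \<Gamma>" for X Y Z W
      proof -
        have "cyc X Y Z \<in> C_inf A" using that by (intro closure_rules)
        moreover from this have "(-1/6) *\<^sub>R cyc X Y Z \<in> C_inf A" by (rule C_inf_scale)
        ultimately show ?thesis
          using that unfolding courant_l_simps(3)
          by (subst courant_l_simps(2)) (simp_all add: C_inf_zero section_zero zero_rules
              act_scale_right[of W "cyc X Y Z" "-1/6", simplified])
      qed
      \<comment> \<open>Up to the factor \<open>-1/6\<close> this is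
        \<open>cyc_skew_bracket_quaternary\<close>; the factor \<open>1/12\<close> in
        \<open>l23\<close> is the product of \<open>-1/6\<close> from \<open>l_3\<close> and
        \<open>-1/2\<close> from \<open>l_2\<close>.\<close>
      have "fst (\<l> 3 [\<l> 2 [a, b], c, d] - \<l> 3 [\<l> 2 [a, c], b, d] + \<l> 3 [\<l> 2 [a, d], b, c] +
          \<l> 3 [\<l> 2 [b, c], a, d] - \<l> 3 [\<l> 2 [b, d], a, c] + \<l> 3 [\<l> 2 [c, d], a, b] -
          (\<l> 2 [\<l> 3 [a, b, c], d] - \<l> 2 [\<l> 3 [a, b, d], c] + \<l> 2 [\<l> 3 [a, c, d], b] -
            \<l> 2 [\<l> 3 [b, c, d], a])) p = 0" for p
        unfolding X(5-8)
          l32[OF X(1,2,3,4)] l32[OF X(1,3,2,4)] l32[OF X(1,4,2,3)] l32[OF X(2,3,1,4)]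
          l32[OF X(2,4,1,3)] l32[OF X(3,4,1,2)]
          l23[OF X(1,2,3,4)] l23[OF X(1,2,4,3)] l23[OF X(1,3,4,2)] l23[OF X(2,3,4,1)]
          fst_add fst_diff fst_conv plus_fun_apply minus_apply scaleR_fun_apply real_scaleR_def
        using cyc_skew_bracket_quaternary[OF X(1-4), of p] unfolding plus_fun_apply by argo
      moreover have "snd (\<l> 3 [\<l> 2 [a, b], c, d] - \<l> 3 [\<l> 2 [a, c], b, d] + \<l> 3 [\<l> 2 [a, d], b, c] +
          \<l> 3 [\<l> 2 [b, c], a, d] - \<l> 3 [\<l> 2 [b, d], a, c] + \<l> 3 [\<l> 2 [c, d], a, b] -
          (\<l> 2 [\<l> 3 [a, b, c], d] - \<l> 2 [\<l> 3 [a, b, d], c] + \<l> 2 [\<l> 3 [a, c, d], b] -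
            \<l> 2 [\<l> 3 [b, c, d], a])) = 0"
        using X(1-4) unfolding X(5-8) by (simp add: l32 l23)
      ultimately show "\<l> 3 [\<l> 2 [a, b], c, d] - \<l> 3 [\<l> 2 [a, c], b, d] + \<l> 3 [\<l> 2 [a, d], b, c] +
          \<l> 3 [\<l> 2 [b, c], a, d] - \<l> 3 [\<l> 2 [b, d], a, c] + \<l> 3 [\<l> 2 [c, d], a, b] -
          (\<l> 2 [\<l> 3 [a, b, c], d] - \<l> 2 [\<l> 3 [a, b, d], c] + \<l> 2 [\<l> 3 [a, c, d], b] -
            \<l> 2 [\<l> 3 [b, c, d], a]) = 0"
        by (intro prod_eqI ext) (simp_all only: fst_zero snd_zero zero_fun_apply)
    qed
  qed
qed

theorem L_infinity_algebra_courant_l: "L_infinity_algebra \<L> \<l>"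
  by (intro L_infinity_algebraI graded_vector_space_courant_L multilinear_courant_l
      graded_skew_symmetric_courant_l courant_l_degree courant_l_jacobi)

end


section \<open>Compatible Courant algebroids\<close>

lemma tangent_space_add:
  "v \<in> tangent_space A p \<Longrightarrow> w \<in> tangent_space A p \<Longrightarrow> v + w \<in> tangent_space A p"
  by (auto simp: tangent_space_def algebra_simps)

lemma act_plus: "act (\<lambda>p e. rho p e + rho' p e) X f = act rho X f + act rho' X f"
  by (simp add: act_def anchored_def fun_eq_iff)

context compatible_courant_algebroids
begin

text \<open>The sum of the two values represents the sum of the two functionals. Uniqueness comes
  from the common pairing, since the summed structure is not yet known to be a Courant
  algebroid.\<close>

lemma courant_D_plus:
  assumes f: "f \<in> C_inf A"
  shows "courant_D E g (\<lambda>p e. rho p e + rho' p e) f = courant_D E g rho f + courant_D E g rho' f"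
proof
  fix p
  let ?e = "(courant_D E g rho f + courant_D E g rho' f) p"
  have mem: "?e \<in> E p"
    using f by (simp add: first.courant_D_in_fibre second.courant_D_in_fibre
        subspace_add[OF first.subspace_fibre])
  moreover have eq: "g p ?e v = rho p v f + rho' p v f" if "v \<in> E p" for v
    using f that by (simp add: first.courant_D_in_fibre second.courant_D_in_fibre first.pairing_add
        first.pairing_courant_D second.pairing_courant_D)
  ultimately show "courant_D E g (\<lambda>p e. rho p e + rho' p e) f p = ?e"
    unfolding courant_D_def[of E g "\<lambda>p e. rho p e + rho' p e"] sharp_def dual_anchor_def differential_def
    by (intro the_equality) (auto intro: first.pairing_eqI)
qed

lemma act_compatible:
  assumes "X \<in> sections A E T" "Y \<in> sections A E T"
  shows "act rho (br' X Y) f + act rho' (br X Y) f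
    = act rho X (act rho' Y f) - act rho' Y (act rho X f)
      + (act rho' X (act rho Y f) - act rho Y (act rho' X f))"
proof
  fix p
  show "(act rho (br' X Y) f + act rho' (br X Y) f) p
    = (act rho X (act rho' Y f) - act rho' Y (act rho X f)
      + (act rho' X (act rho Y f) - act rho Y (act rho' X f))) p"
    using fun_cong[OF fun_cong[OF compatible_anchor[OF assms], of p], of f]
    by (simp add: act_def lie_bracket_def)
qed

text \<open>Apart from the Jacobi identity and the compatibility of the anchor with brackets, the
  axioms involving bracket or anchor are linear in that pair. These two are quadratic, and their
  mixed terms are the two compatibility conditions.\<close>

sublocale total: courant_algebroid A E T g "\<lambda>X Y. br X Y + br' X Y" "\<lambda>p e. rho p e + rho' p e"
proof unfold_locales
  note closure = first.closure_rules second.closure_rules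
  show "g p (x + y) z = g p x z + g p y z" if "x \<in> E p" "y \<in> E p" "z \<in> E p" for x p y z
    using that by (rule first.pairing_add)
  show "g p (c *\<^sub>R x) z = c * g p x z" if "x \<in> E p" "z \<in> E p" for x p z c
    using that by (rule first.pairing_scale)
  show "g p x y = g p y x" if "x \<in> E p" "y \<in> E p" for x p y
    using that by (rule first.pairing_sym)
  show "x = 0" if "x \<in> E p" "\<And>y. y \<in> E p \<Longrightarrow> g p x y = 0" for x p
    using that by (rule first.pairing_nondegenerate)
  show "smooth_map_on A W (pair g X Y)"
    if "open W" "smooth_section_on A E T W X" "smooth_section_on A E T W Y" for W X Y
    using that by (rule first.pairing_smooth)
  show "rho p x + rho' p x \<in> tangent_space A p" if "x \<in> E p" for x p
    using that by (intro tangent_space_add first.anchor_tangent second.anchor_tangent)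
  show "rho p (x + y) + rho' p (x + y) = rho p x + rho' p x + (rho p y + rho' p y)"
    if "x \<in> E p" "y \<in> E p" for x p y
    using that by (simp add: first.anchor_add second.anchor_add)
  show "rho p (c *\<^sub>R x) + rho' p (c *\<^sub>R x) = c *\<^sub>R (rho p x + rho' p x)" if "x \<in> E p" for x p c
    using that by (simp add: first.anchor_scale second.anchor_scale scaleR_add_right)
  show "smooth_vector_field_on A W (anchored (\<lambda>p e. rho p e + rho' p e) X)"
    if "open W" "smooth_section_on A E T W X" for W X
    using first.anchor_smooth[OF that] second.anchor_smooth[OF that] that(1)
    by (auto simp: smooth_vector_field_on_def anchored_def
        intro: tangent_space_add[unfolded plus_fun_def] first.smooth_map_on_add)
  fix X assume X: "X \<in> sections A E T"
  show "br X X + br' X X = (1/2) *\<^sub>R courant_D E g (\<lambda>p e. rho p e + rho' p e) (pair g X X)"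
    using X by (simp add: courant_D_plus first.pair_closed first.bracket_self second.bracket_self
        scaleR_add_right)
  fix Y assume Y: "Y \<in> sections A E T"
  show "br X Y + br' X Y \<in> sections A E T"
    using X Y by (intro closure)
  show "br (c *\<^sub>R X) Y + br' (c *\<^sub>R X) Y = c *\<^sub>R (br X Y + br' X Y)"
    "br X (c *\<^sub>R Y) + br' X (c *\<^sub>R Y) = c *\<^sub>R (br X Y + br' X Y)" for c
    using X Y by (simp_all add: first.bracket_scale_left second.bracket_scale_left
        first.bracket_scale_right second.bracket_scale_right scaleR_add_right)
  show "br X (fscale f Y) + br' X (fscale f Y)
      = fscale f (br X Y + br' X Y) + fscale (act (\<lambda>p e. rho p e + rho' p e) X f) Y"
    if "f \<in> C_inf A" for f
    using X Y that
    by (simp add: first.bracket_leibniz second.bracket_leibniz act_plus)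
      (simp add: fscale_def fun_eq_iff algebra_simps)
  show "anchored (\<lambda>p e. rho p e + rho' p e) (br X Y + br' X Y)
      = lie_bracket (anchored (\<lambda>p e. rho p e + rho' p e) X) (anchored (\<lambda>p e. rho p e + rho' p e) Y)"
  proof (intro ext)
    fix p f
    let ?s = "\<lambda>p e. rho p e + rho' p e"
    have "act ?s (br X Y + br' X Y) f = act ?s X (act ?s Y f) - act ?s Y (act ?s X f)"
    \<comment> \<open>The equality is one of total functions, but derivations are additive only on
      smooth functions. On other functions tangent vectors are normalised to 0, so both sides
      vanish.\<close>
    proof (cases "f \<in> C_inf A")
      case True
      have "act ?s (br X Y + br' X Y) f
          = act rho (br X Y) f + act rho' (br' X Y) f + (act rho (br' X Y) f + act rho' (br X Y) f)"
        using X Y by (simp add: act_plus first.act_add_left second.act_add_left closure)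
      also have "\<dots> = act ?s X (act ?s Y f) - act ?s Y (act ?s X f)"
        using X Y True
        by (simp add: act_compatible first.act_bracket second.act_bracket act_plus
            first.act_add_right second.act_add_right closure)
      finally show ?thesis .
    next
      case False
      then have "act ?s Z f = 0" if "Z \<in> sections A E T" for Z
        using first.anchor_tangent[OF first.section_in_fibre[OF that]]
          second.anchor_tangent[OF first.section_in_fibre[OF that]]
        by (auto simp: act_def anchored_def tangent_space_def fun_eq_iff)
      moreover have "act ?s Z 0 = 0" if "Z \<in> sections A E T" for Z
        using that by (simp add: act_plus first.zero_rules second.zero_rules)
      ultimately show ?thesis using X Y by (simp add: closure)
    qed
    from fun_cong[OF this, of p]
    show "anchored ?s (br X Y + br' X Y) p f = lie_bracket (anchored ?s X) (anchored ?s Y) p f"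
      by (simp add: act_def lie_bracket_def)
  qed
  fix Z assume Z: "Z \<in> sections A E T"
  show "br (X + Y) Z + br' (X + Y) Z = br X Z + br' X Z + (br Y Z + br' Y Z)"
    "br X (Y + Z) + br' X (Y + Z) = br X Y + br' X Y + (br X Z + br' X Z)"
    using X Y Z by (simp_all add: first.bracket_add_left second.bracket_add_left
        first.bracket_add_right second.bracket_add_right)
  \<comment> \<open>Both sides of the Jacobi identity are sorted into the two pure parts, settled by
    the given structures, and the mixed part, settled by \<open>compatible_jacobi\<close>.\<close>
  have l: "br X (br Y Z + br' Y Z) + br' X (br Y Z + br' Y Z)
      = br X (br Y Z) + br' X (br' Y Z) + (br' X (br Y Z) + br X (br' Y Z))"
    using X Y Z by (simp add: first.bracket_add_right second.bracket_add_right closure)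
  have r: "br (br X Y + br' X Y) Z + br' (br X Y + br' X Y) Z
        + (br Y (br X Z + br' X Z) + br' Y (br X Z + br' X Z))
      = br (br X Y) Z + br Y (br X Z) + (br' (br' X Y) Z + br' Y (br' X Z))
        + (br' (br X Y) Z + br (br' X Y) Z + br' Y (br X Z) + br Y (br' X Z))"
    using X Y Z by (simp add: first.bracket_add_left second.bracket_add_left
        first.bracket_add_right second.bracket_add_right closure)
  show "br X (br Y Z + br' Y Z) + br' X (br Y Z + br' Y Z)
      = br (br X Y + br' X Y) Z + br' (br X Y + br' X Y) Z
        + (br Y (br X Z + br' X Z) + br' Y (br X Z + br' X Z))"
    unfolding l r compatible_jacobi[OF X Y Z] first.bracket_jacobi[OF X Y Z, symmetric]
      second.bracket_jacobi[OF X Y Z, symmetric] ..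
  show "act (\<lambda>p e. rho p e + rho' p e) X (pair g Y Z)
      = pair g (br X Y + br' X Y) Z + pair g Y (br X Z + br' X Z)"
    using X Y Z
    by (simp add: act_plus first.pairing_invariant second.pairing_invariant first.pair_add_left
        first.pair_add_right closure)
qed

text \<open>With the pairing fixed, \<open>\<D>\<close> and the skew bracket are additive in anchor
  and bracket, and each operation contains only one of them in every term.\<close>

lemma courant_l_plus:
  assumes k: "k \<ge> 1" and len: "length xs = k" and hom: "homogeneous (courant_L A E T) ds xs"
  shows "courant_l E g (\<lambda>X Y. br X Y + br' X Y) (\<lambda>p e. rho p e + rho' p e) k xs
    = courant_l E g br rho k xs + courant_l E g br' rho' k xs"
proof -
  have mem: "\<And>z. z \<in> set xs \<Longrightarrow> fst z \<in> C_inf A \<and> snd z \<in> sections A E T"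
    using homogeneous_subset_graded_total[OF hom] first.graded_total_courant_L by blast
  have skew: "skew_bracket E g (\<lambda>X Y. br X Y + br' X Y) (\<lambda>p e. rho p e + rho' p e) X Y
      = skew_bracket E g br rho X Y + skew_bracket E g br' rho' X Y"
    if "X \<in> sections A E T" "Y \<in> sections A E T" for X Y
    using that by (simp add: skew_bracket_def courant_D_plus first.pair_closed scaleR_add_right)
  consider "k = 1" | "k = 2" | "k = 3" | "k > 3" using k by linarith
  then show ?thesis
  proof cases
    case 1
    then obtain a where "xs = [a]" using len by (auto simp: length_Suc_conv)
    then show ?thesis
      using 1 mem by (cases a) (simp add: courant_l_def courant_l1_def courant_D_plus)
  next
    case 2
    then obtain a b where xs: "xs = [a, b]" using len length_2_cases by blast
    obtain u U v V where "a = (u, U)" "u \<in> C_inf A" "U \<in> sections A E T"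
      "b = (v, V)" "v \<in> C_inf A" "V \<in> sections A E T"
      using mem[of a] mem[of b] xs by (cases a, cases b) auto
    then show ?thesis
      by (simp add: 2 xs total.courant_l_simps(2) first.courant_l_simps(2) second.courant_l_simps(2)
          act_plus skew algebra_simps)
  next
    case 3
    then obtain a b d where xs: "xs = [a, b, d]" using len length_3_cases by blast
    obtain u U v V w W where "a = (u, U)" "U \<in> sections A E T" "b = (v, V)" "V \<in> sections A E T"
      "d = (w, W)" "W \<in> sections A E T"
      using mem[of a] mem[of b] mem[of d] xs by (cases a, cases b, cases d) auto
    then show ?thesis
      by (simp add: 3 xs total.courant_l_simps(3) first.courant_l_simps(3) second.courant_l_simps(3)
          skew first.pair_add_left first.skew_bracket_closed second.skew_bracket_closed algebra_simps)
  next
    case 4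
    then show ?thesis
      by (simp add: total.courant_l_simps(4) first.courant_l_simps(4) second.courant_l_simps(4))
  qed
qed

end

theorem proposition4p15:
  fixes A :: "('m::{t2_space,second_countable_topology} set \<times> ('m \<Rightarrow> 'b::real_inner)) set"
    and E :: "'m \<Rightarrow> 'e::real_vector set"
    and T :: "('m set \<times> ('m \<Rightarrow> 'v::real_inner \<Rightarrow> 'e)) set"
    and g :: "'m \<Rightarrow> 'e \<Rightarrow> 'e \<Rightarrow> real"
    and br br' :: "('m \<Rightarrow> 'e) \<Rightarrow> ('m \<Rightarrow> 'e) \<Rightarrow> ('m \<Rightarrow> 'e)"
    and rho rho' :: "'m \<Rightarrow> 'e \<Rightarrow> ('m \<Rightarrow> real) \<Rightarrow> real"
  assumes "compatible_courant_algebroids A E T g br rho br' rho'"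
  shows "compatible_L_infinity_algebra (courant_L A E T)
           (courant_l E g br rho) (courant_l E g br' rho')"
proof -
  interpret compatible_courant_algebroids A E T g br rho br' rho' by (rule assms)
  show ?thesis
    by (rule compatible_L_infinity_algebraI[OF first.L_infinity_algebra_courant_l
          second.L_infinity_algebra_courant_l total.L_infinity_algebra_courant_l courant_l_plus])
qed

end
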